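(* Let $0<s<S$, $p,q\in[1,\infty]$, $1\le p'<\infty$, $F>0$, and assume $s>(1/p-1/(p'\vee2))_+$. Let $\{f_{0,jk}\}$ be the wavelet coefficients (in the indexing described in the context) of a function $f_0$ with $\|f_0\|_{B^s_{pq}}\le F$. For each $n\ge1$ observe $$X_{jk}=f_{0,jk}+\tfrac1{\sqrt n}\xi_{jk},\qquad j\ge-1,\ 0\le k<2^j,$$ with $\xi_{jk}$ i.i.d. $\mathcal N(0,1)$. Let $\Pi$ be the prior under which independently $f_{jk}=2^{-j^2}\zeta_{jk}$, where $\zeta_{jk}$ are i.i.d. with density $h$ satisfying: (H1) $h$ is symmetric, positive, and decreasing on $[0,\infty)$; (H2) there exist $c_1>0$, $\kappa\ge0$ with $\log(1/h(x))\le c_1(1+\log^{1+\kappa}(1+x))$ for all $x\ge0$; (H3) there exists $c_2>0$ with $\int_x^\infty h(u)\,du\le c_2/x$ for all $x\ge1$. Define $\eta:=sp-\frac{p'-p}{2}$, $s':=s-1/p+1/p'$, and $$r:=\begin{cases} s/(1+2s), & \eta>0,\\ s'/(1+2(s-1/p)), & \eta\le0.\end{cases}$$ Then there is $\delta>0$ such that, with $\mathcal L_n=\log^\delta n$, as $n\to\infty$, $$E_{f_0}\,\Pi\big[\{f:\ \|f-f_0\|_{p'}\ge\mathcal L_n n^{-r}\}\,\big|\,X\big]\to0.$$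
   Context: Let $J$ be the smallest integer with $2^J\ge2S$ and let $\{\phi_{Jk}:0\le k<2^J\}\cup\{\psi_{jk}:j\ge J,0\le k<2^j\}$ be an orthonormal, boundary-corrected, $S$-regular (Daubechies-type) wavelet basis of $L_2([0,1])$. For a function $f$, set $f_{jk}=\langle f,\psi_{jk}\rangle$ for $j\ge J$; $f_{jk}=\langle f,\phi_{J,2^j+k}\rangle$ for $0\le j<J$, $0\le k<2^j$; and $f_{-1,0}=\langle f,\phi_{J,0}\rangle$ (for $j=-1$ only $k=0$). A coefficient sequence $(f_{jk})$ is identified with the function $f=\sum f_{jk}\cdot(\text{corresponding basis function})$, and $\|f\|_{p'}$ denotes its $L_{p'}([0,1])$ norm. With $\|f_{j\cdot}\|_p=(\sum_{k}|f_{jk}|^p)^{1/p}$, the Besov norm is $\|f\|_{B^s_{pq}}=\big(\sum_{j\ge-1}2^{qj(s+1/2-1/p)}\|f_{j\cdot}\|_p^q\big)^{1/q}$ (usual modification if $p$ or $q$ is $\infty$). The posterior is $\Pi[B\mid X]\propto\int_B e^{-\frac n2\sum_{j,k}(X_{jk}-f_{jk})^2}d\Pi(f)$; $E_{f_0}$ is expectation under the model with true coefficients $f_{0,jk}$. *)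

theory Defs
  imports "HOL-Probability.Probability"
begin

definition nlev :: "int \<Rightarrow> nat" where
  "nlev j = (if j < 0 then 1 else 2 ^ nat j)"

definition wav_idx :: "(int \<times> nat) set" where
  "wav_idx = {(j, k). j \<ge> -1 \<and> k < nlev j}"

definition lvl_sum :: "(int \<times> nat \<Rightarrow> real) \<Rightarrow> real" where
  "lvl_sum a = (\<Sum>l. \<Sum>k<nlev (int l - 1). a (int l - 1, k))"

definition wavJ :: "nat \<Rightarrow> nat" where
  "wavJ S = (LEAST J. 2 ^ J \<ge> 2 * S)"

text \<open>Reindexed basis: phi k = phi_{J,k} (k < 2^J), psi j k = psi_{jk} (j >= J, k < 2^j).
  basis_fn J phi psi j k is the basis function belonging to coefficient f_{jk}
  in the indexing of the paper.\<close>
definition basis_fn ::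
  "nat \<Rightarrow> (nat \<Rightarrow> real \<Rightarrow> real) \<Rightarrow> (nat \<Rightarrow> nat \<Rightarrow> real \<Rightarrow> real) \<Rightarrow> int \<Rightarrow> nat \<Rightarrow> real \<Rightarrow> real"
  where
  "basis_fn J phi psi j k =
     (if j < 0 then phi 0 else if j < int J then phi (2 ^ nat j + k) else psi (nat j) k)"

text \<open>Daubechies-type (Cohen-Daubechies-Vial) dilation structure: at level j, interior
  functions are 2^{j/2} g(2^j x - k) of one compactly supported generator g,
  and the S functions at each boundary are dilations of S fixed left / right
  boundary generators.\<close>
definition cdv_level ::
  "nat \<Rightarrow> nat \<Rightarrow> (real \<Rightarrow> real) \<Rightarrow> (nat \<Rightarrow> real \<Rightarrow> real) \<Rightarrow> (nat \<Rightarrow> real \<Rightarrow> real)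
     \<Rightarrow> nat \<Rightarrow> real \<Rightarrow> real" where
  "cdv_level S j g gL gR k x =
     2 powr (real j / 2) *
       (if k < S then gL k (2 ^ j * x)
        else if 2 ^ j - S \<le> k then gR (2 ^ j - 1 - k) (2 ^ j * (x - 1))
        else g (2 ^ j * x - real k))"

definition bounded_compact_gen :: "real \<Rightarrow> (real \<Rightarrow> real) \<Rightarrow> bool" where
  "bounded_compact_gen A g \<longleftrightarrow>
     g \<in> borel_measurable borel \<and> (\<forall>x. \<bar>g x\<bar> \<le> A) \<and> (\<forall>x. \<bar>x\<bar> > A \<longrightarrow> g x = 0)"

definition cdv_wavelet_basis ::
  "nat \<Rightarrow> (nat \<Rightarrow> real \<Rightarrow> real) \<Rightarrow> (nat \<Rightarrow> nat \<Rightarrow> real \<Rightarrow> real) \<Rightarrow> bool" where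
  "cdv_wavelet_basis S phi psi \<longleftrightarrow>
     (let J = wavJ S; e = basis_fn J phi psi in
       \<comment> \<open>orthonormal in L2([0,1])\<close>
       (\<forall>(j, k) \<in> wav_idx. e j k \<in> borel_measurable borel \<and>
            set_integrable lborel {0..1} (\<lambda>x. (e j k x)\<^sup>2)) \<and>
       (\<forall>(j, k) \<in> wav_idx. \<forall>(j', k') \<in> wav_idx.
            (LINT x:{0..1}|lborel. e j k x * e j' k' x) = (if (j, k) = (j', k') then 1 else 0)) \<and>
       \<comment> \<open>complete in L2([0,1])\<close>
       (\<forall>g :: real \<Rightarrow> real. g \<in> borel_measurable borel \<longrightarrow>
            set_integrable lborel {0..1} (\<lambda>x. (g x)\<^sup>2) \<longrightarrow>
            (\<forall>(j, k) \<in> wav_idx. (LINT x:{0..1}|lborel. g x * e j k x) = 0) \<longrightarrow>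
            (AE x in lborel. x \<in> {0..1} \<longrightarrow> g x = 0)) \<and>
       \<comment> \<open>Daubechies-type boundary-corrected dilation structure\<close>
       (\<exists>A > 0. \<exists>g0 h0 :: real \<Rightarrow> real. \<exists>gL gR hL hR :: nat \<Rightarrow> real \<Rightarrow> real.
            bounded_compact_gen A g0 \<and> bounded_compact_gen A h0 \<and>
            (\<forall>k. bounded_compact_gen A (gL k) \<and> bounded_compact_gen A (gR k) \<and>
                 bounded_compact_gen A (hL k) \<and> bounded_compact_gen A (hR k)) \<and>
            (\<forall>k < 2 ^ J. \<forall>x \<in> {0..1}. phi k x = cdv_level S J g0 gL gR k x) \<and>
            (\<forall>j \<ge> J. \<forall>k < 2 ^ j. \<forall>x \<in> {0..1}. psi j k x = cdv_level S j h0 hL hR k x)) \<and>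
       \<comment> \<open>S-regularity: S vanishing moments of the wavelets\<close>
       (\<forall>j \<ge> J. \<forall>k < 2 ^ j. \<forall>m < S.
            (LINT x:{0..1}|lborel. x ^ m * psi j k x) = 0))"

definition wav_fun :: "(int \<Rightarrow> nat \<Rightarrow> real \<Rightarrow> real) \<Rightarrow> (int \<times> nat \<Rightarrow> real) \<Rightarrow> real \<Rightarrow> real" where
  "wav_fun e c x = lvl_sum (\<lambda>(j, k). c (j, k) * e j k x)"

definition Lp_norm :: "real \<Rightarrow> (real \<Rightarrow> real) \<Rightarrow> ennreal" where
  "Lp_norm p g =
     (let I = (\<integral>\<^sup>+ x \<in> {0..1}. ennreal (\<bar>g x\<bar> powr p) \<partial>lborel)
      in if I = \<infinity> then \<infinity> else ennreal (enn2real I powr (1 / p)))"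

definition inv_e :: "ereal \<Rightarrow> real" where
  "inv_e p = (if p = \<infinity> then 0 else 1 / real_of_ereal p)"

definition lvl_norm :: "ereal \<Rightarrow> (int \<times> nat \<Rightarrow> real) \<Rightarrow> int \<Rightarrow> real" where
  "lvl_norm p c j =
     (if p = \<infinity> then Max ((\<lambda>k. \<bar>c (j, k)\<bar>) ` {..<nlev j})
      else (\<Sum>k<nlev j. \<bar>c (j, k)\<bar> powr real_of_ereal p) powr (1 / real_of_ereal p))"

definition besov_norm :: "real \<Rightarrow> ereal \<Rightarrow> ereal \<Rightarrow> (int \<times> nat \<Rightarrow> real) \<Rightarrow> ereal" where
  "besov_norm s p q c =
     (let a = (\<lambda>l::nat. 2 powr (real_of_int (int l - 1) * (s + 1/2 - inv_e p))
                          * lvl_norm p c (int l - 1))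
      in if q = \<infinity> then (SUP l. ereal (a l))
         else if summable (\<lambda>l. a l powr real_of_ereal q)
              then ereal ((\<Sum>l. a l powr real_of_ereal q) powr (1 / real_of_ereal q))
              else \<infinity>)"

definition data_law :: "(int \<times> nat \<Rightarrow> real) \<Rightarrow> nat \<Rightarrow> (int \<times> nat \<Rightarrow> real) measure" where
  "data_law f0 n = (\<Pi>\<^sub>M i \<in> wav_idx. density lborel (normal_density (f0 i) (1 / sqrt (real n))))"

definition prior :: "(real \<Rightarrow> real) \<Rightarrow> (int \<times> nat \<Rightarrow> real) measure" where
  "prior h = (\<Pi>\<^sub>M (j, k) \<in> wav_idx.
                 distr (density lborel h) borel (\<lambda>z. 2 powr (- (real_of_int j)\<^sup>2) * z))"

text \<open>Likelihood (density of the model at f w.r.t. the model at f = 0):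
  exp(-n/2 sum (X-f)^2) up to the f-independent factor exp(n/2 sum X^2).\<close>
definition lik :: "nat \<Rightarrow> (int \<times> nat \<Rightarrow> real) \<Rightarrow> (int \<times> nat \<Rightarrow> real) \<Rightarrow> real" where
  "lik n X f = exp (real n * lvl_sum (\<lambda>i. X i * f i) - real n / 2 * lvl_sum (\<lambda>i. (f i)\<^sup>2))"

definition posterior ::
  "(real \<Rightarrow> real) \<Rightarrow> nat \<Rightarrow> (int \<times> nat \<Rightarrow> real) set \<Rightarrow> (int \<times> nat \<Rightarrow> real) \<Rightarrow> ennreal" where
  "posterior h n B X =
     (\<integral>\<^sup>+ f. indicator B f * ennreal (lik n X f) \<partial>prior h) / (\<integral>\<^sup>+ f. ennreal (lik n X f) \<partial>prior h)"

definition eta :: "real \<Rightarrow> ereal \<Rightarrow> real \<Rightarrow> ereal" where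
  "eta s p p' = (if p = \<infinity> then \<infinity> else ereal (s * real_of_ereal p - (p' - real_of_ereal p) / 2))"

definition rate :: "real \<Rightarrow> ereal \<Rightarrow> real \<Rightarrow> real" where
  "rate s p p' =
     (if eta s p p' > 0 then s / (1 + 2 * s)
      else (s - inv_e p + 1 / p') / (1 + 2 * (s - inv_e p)))"

end

theory Submission
  imports Defs "HOL-Real_Asymp.Real_Asymp"
begin

text \<open>The posterior factorises over wavelet coefficients, so it suffices to control single
  coefficients on the event that all noise variables are at most \<open>sqrt (8 (ln n + j + 2))\<close> at level \<open>j\<close>,
  and to combine the bounds by union bounds. The logarithm of the prior density at scale \<open>2 powr (-j\<^sup>2)\<close> is
  polylogarithmic in \<open>n\<close> as long as \<open>j\<close> is of order \<open>ln n\<close>, hence a coefficient is always recovered up to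
  a polylogarithmic multiple of \<open>1 / sqrt n\<close>. Once \<open>j \<ge> 10 sqrt (ln n)\<close>, the prior scale is below every
  power of \<open>n\<close>, and coefficients whose true value is below the noise level are moreover shrunk
  to essentially zero. So the error is at most a polylogarithmic factor times
  \<open>min \<bar>f0 i\<bar> (1 / sqrt n)\<close>, as for a thresholding estimator, and it remains to sum
  this over a Besov ball; the coefficients at the levels below \<open>10 sqrt (ln n)\<close> are too few to matter.\<close>

section \<open>Posterior of a single coefficient\<close>

text \<open>Two opposing costs fix the constants. Where the posterior must follow the data, the
  price is ln (1/h) at an argument of size 2^(j^2); by (H2) with j = O(ln n) this is of order (ln
  n)^(2(1+\<kappa>)), and a radius \<open>R n\<close> of exactly that size has a square which
  dominates it with room for all constants. Where the posterior must ignore the data, the price is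
  the largest possible likelihood ratio, a fixed power of n times a geometric factor in j, while
  (H3) gains the scale 2^(-j^2); the gain wins once j is a large enough multiple of sqrt (ln n), and
  the factor 10 is generous. The levels below that contain only n^o(1) coefficients, each off by
  \<open>R n / sqrt n\<close>; this is negligible because the rate exponent is strictly below 1/2,
  which rests on the lower bound on s. The final power of the logarithm is 2(1+\<kappa>) from
  \<open>R n\<close>, plus one for the number of levels, plus one to swallow constants. Neither the
  event in the theorem nor the posterior as a function of the data is shown measurable: both are
  dominated by measurable majorants, so monotonicity of the integral suffices.\<close>

definition coord_prior :: "(real \<Rightarrow> real) \<Rightarrow> real \<Rightarrow> real measure" where
  "coord_prior h \<sigma> = distr (density lborel h) borel (\<lambda>z. \<sigma> * z)"

definition coord_lik :: "nat \<Rightarrow> real \<Rightarrow> real \<Rightarrow> real" where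
  "coord_lik n x t = exp (real n * (x * t) - real n / 2 * t\<^sup>2)"

lemma coord_lik_measurable [measurable]: "coord_lik n x \<in> borel_measurable borel"
  unfolding coord_lik_def by measurable

lemma coord_lik_nonneg [simp]: "0 \<le> coord_lik n x t"
  by (simp add: coord_lik_def)

text \<open>Completing the square: in \<open>t\<close> this is a multiple of the Gaussian density
  with mean \<open>x\<close> and variance 1/n. The prefactor cancels in
  \<open>coord_posterior_concentrates\<close> but has to be paid for in
  \<open>coord_posterior_shrinks\<close>.\<close>

lemma coord_lik_eq: "coord_lik n x t = exp (real n * x\<^sup>2 / 2) * exp (- (real n * (t - x)\<^sup>2 / 2))"
  unfolding coord_lik_def exp_add [symmetric]
  by (simp add: power2_eq_square algebra_simps add_divide_distrib diff_divide_distrib)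

lemma coord_lik_le: "coord_lik n x t \<le> exp (real n * x\<^sup>2 / 2)"
  unfolding coord_lik_eq by (simp add: mult_le_cancel_left1)

text \<open>\<open>1 \<le> c\<close> is arranged later by \<open>max 1 c2\<close>; it makes the tail
  bound \<open>2 * c / x\<close> trivially true for \<open>x < 1\<close>. The lower bound (H2) joins
  only in \<open>posterior_setting\<close>, because the estimates here keep the value of
  \<open>h\<close> explicit.\<close>

locale heavy_tail =
  fixes h :: "real \<Rightarrow> real" and c :: real
  assumes h_meas [measurable]: "h \<in> borel_measurable borel"
    and h_int: "integrable lborel h" "(\<integral>x. h x \<partial>lborel) = 1"
    and h_pos: "0 < h x"
    and h_sym: "h (- x) = h x"
    and h_dec: "0 \<le> x \<Longrightarrow> x \<le> y \<Longrightarrow> h y \<le> h x"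
    and h_tail: "1 \<le> x \<Longrightarrow> (LINT u:{x..}|lborel. h u) \<le> c / x"
    and c_ge: "1 \<le> c"
begin

lemma h_nonneg [simp]: "0 \<le> h x"
  using h_pos[of x] by simp

lemma h_abs: "\<bar>x\<bar> \<le> y \<Longrightarrow> h y \<le> h x"
  using h_dec[of "\<bar>x\<bar>" y] h_sym[of x] by (cases "x \<ge> 0") auto

lemma nn_integral_h: "(\<integral>\<^sup>+ z. ennreal (h z) \<partial>lborel) = 1"
  using nn_integral_eq_integral[OF h_int(1)] h_int(2) by simp

lemma prob_space_coord_prior: "prob_space (coord_prior h \<sigma>)"
proof -
  have "prob_space (density lborel h)"
    by (rule prob_spaceI) (simp add: emeasure_density nn_integral_h)
  then show ?thesis
    unfolding coord_prior_def by (rule prob_space.prob_space_distr) simp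
qed

lemma nn_integral_coord_prior:
  assumes [measurable]: "u \<in> borel_measurable borel"
  shows "(\<integral>\<^sup>+ x. u x \<partial>coord_prior h \<sigma>) = (\<integral>\<^sup>+ z. ennreal (h z) * u (\<sigma> * z) \<partial>lborel)"
  unfolding coord_prior_def by (simp add: nn_integral_distr nn_integral_density)

lemma nn_integral_tail:
  assumes "0 < x"
  shows "(\<integral>\<^sup>+ z. ennreal (h z) * indicator {z. x < \<bar>z\<bar>} z \<partial>lborel) \<le> ennreal (2 * c / x)"
proof (cases "1 \<le> x")
  case False
  have "(\<integral>\<^sup>+ z. ennreal (h z) * indicator {z. x < \<bar>z\<bar>} z \<partial>lborel) \<le> (\<integral>\<^sup>+ z. ennreal (h z) \<partial>lborel)"
    by (intro nn_integral_mono) (simp split: split_indicator)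
  also have "\<dots> \<le> ennreal (2 * c / x)"
    using False assms c_ge by (simp add: nn_integral_h field_simps)
  finally show ?thesis .
next
  case True
  have int: "set_integrable lborel {x..} h"
    unfolding set_integrable_def using h_int(1) by (intro integrable_mult_indicator) auto
  have "(\<integral>\<^sup>+ z. ennreal (h z) * indicator {x..} z \<partial>lborel) = ennreal (LINT u:{x..}|lborel. h u)"
    unfolding set_lebesgue_integral_def
    by (subst nn_integral_eq_integral[symmetric])
       (use int in \<open>auto simp: set_integrable_def intro!: nn_integral_cong split: split_indicator\<close>)
  then have right: "(\<integral>\<^sup>+ z. ennreal (h z) * indicator {x..} z \<partial>lborel) \<le> ennreal (c / x)"
    using h_tail[OF True] by (simp add: ennreal_leI)
  have left: "(\<integral>\<^sup>+ z. ennreal (h z) * indicator {..-x} z \<partial>lborel)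
      = (\<integral>\<^sup>+ z. ennreal (h z) * indicator {x..} z \<partial>lborel)"
    by (subst nn_integral_real_affine[where c = "-1" and t = 0])
       (auto simp: h_sym intro!: nn_integral_cong split: split_indicator)
  have "(\<integral>\<^sup>+ z. ennreal (h z) * indicator {z. x < \<bar>z\<bar>} z \<partial>lborel)
      \<le> (\<integral>\<^sup>+ z. ennreal (h z) * indicator {x..} z + ennreal (h z) * indicator {..-x} z \<partial>lborel)"
    using assms by (intro nn_integral_mono) (auto split: split_indicator)
  also have "\<dots> = (\<integral>\<^sup>+ z. ennreal (h z) * indicator {x..} z \<partial>lborel)
                + (\<integral>\<^sup>+ z. ennreal (h z) * indicator {..-x} z \<partial>lborel)"
    by (intro nn_integral_add) auto
  also have "\<dots> \<le> ennreal (c / x) + ennreal (c / x)"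
    using right by (simp add: left add_mono)
  also have "\<dots> = ennreal (2 * c / x)"
    using assms c_ge by (simp add: ennreal_plus[symmetric] del: ennreal_plus)
  finally show ?thesis .
qed

lemma coord_prior_tail:
  assumes "0 < \<sigma>" "0 < t"
  shows "(\<integral>\<^sup>+ x. indicator {x. t < \<bar>x\<bar>} x \<partial>coord_prior h \<sigma>) \<le> ennreal (2 * c * \<sigma> / t)"
proof -
  have "(\<integral>\<^sup>+ x. indicator {x. t < \<bar>x\<bar>} x \<partial>coord_prior h \<sigma>)
      = (\<integral>\<^sup>+ z. ennreal (h z) * indicator {x. t < \<bar>x\<bar>} (\<sigma> * z) \<partial>lborel)"
    by (subst nn_integral_coord_prior) auto
  also have "\<dots> = (\<integral>\<^sup>+ z. ennreal (h z) * indicator {z. t / \<sigma> < \<bar>z\<bar>} z \<partial>lborel)"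
    using assms by (intro nn_integral_cong) (auto split: split_indicator simp: field_simps abs_mult)
  also have "\<dots> \<le> ennreal (2 * c / (t / \<sigma>))"
    using assms by (intro nn_integral_tail) auto
  finally show ?thesis by simp
qed

text \<open>The normalising constant is bounded below by restricting to \<open>\<bar>u\<bar> \<le> \<sigma>\<close> and \<open>0 \<le> x * u\<close>, where the
  likelihood is at least \<open>exp (-1/2)\<close>.\<close>
lemma coord_posterior_shrinks:
  assumes "0 < \<sigma>" "0 < t" and n\<sigma>: "real n * \<sigma>\<^sup>2 \<le> 1"
  shows "(\<integral>\<^sup>+ u. indicator {u. t < \<bar>u\<bar>} u * ennreal (coord_lik n x u) \<partial>coord_prior h \<sigma>)
    \<le> ennreal (exp (real n * x\<^sup>2 / 2) * (2 * c * \<sigma> / t) * exp (1/2) / h 1)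
      * (\<integral>\<^sup>+ u. ennreal (coord_lik n x u) \<partial>coord_prior h \<sigma>)"
proof -
  let ?D = "\<integral>\<^sup>+ u. ennreal (coord_lik n x u) \<partial>coord_prior h \<sigma>"
  define I where "I = (if x \<ge> 0 then {0..1} else {-1..0::real})"
  have [measurable]: "I \<in> sets borel" and I1: "emeasure lborel I = 1"
    by (auto simp: I_def)
  have "ennreal (h 1 * exp (-1/2)) = (\<integral>\<^sup>+ z. ennreal (h 1 * exp (-1/2)) * indicator I z \<partial>lborel)"
    by (simp add: nn_integral_cmult_indicator I1)
  also have "\<dots> \<le> (\<integral>\<^sup>+ z. ennreal (h z) * ennreal (coord_lik n x (\<sigma> * z)) \<partial>lborel)"
  proof (intro nn_integral_mono)
    fix z :: real
    show "ennreal (h 1 * exp (-1/2)) * indicator I z \<le> ennreal (h z) * ennreal (coord_lik n x (\<sigma> * z))"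
    proof (cases "z \<in> I")
      case True
      then have "\<bar>z\<bar> \<le> 1" "0 \<le> x * z"
        by (auto simp: I_def mult_nonpos_nonpos split: if_splits)
      have "real n * (\<sigma> * z)\<^sup>2 = real n * \<sigma>\<^sup>2 * z\<^sup>2"
        by (simp add: power_mult_distrib)
      also have "\<dots> \<le> 1 * 1"
        using n\<sigma> \<open>\<bar>z\<bar> \<le> 1\<close> by (intro mult_mono) (auto simp: abs_square_le_1)
      finally have "real n * (\<sigma> * z)\<^sup>2 \<le> 1" by simp
      moreover have "0 \<le> real n * (x * (\<sigma> * z))"
        using \<open>0 \<le> x * z\<close> \<open>0 < \<sigma>\<close> by (metis mult.left_commute mult_nonneg_nonneg of_nat_0_le_iff order_less_imp_le)
      ultimately have "exp (-1/2) \<le> coord_lik n x (\<sigma> * z)"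
        unfolding coord_lik_def by simp
      with h_abs[OF \<open>\<bar>z\<bar> \<le> 1\<close>] have "h 1 * exp (-1/2) \<le> h z * coord_lik n x (\<sigma> * z)"
        by (intro mult_mono) auto
      then show ?thesis using True by (simp add: ennreal_mult[symmetric] ennreal_leI)
    qed simp
  qed
  also have "\<dots> = ?D" by (subst nn_integral_coord_prior) auto
  finally have den: "ennreal (h 1 * exp (-1/2)) \<le> ?D" .
  \<comment> \<open>The numerator is treated crudely: the likelihood is replaced by its maximum,
    attained at \<open>u = x\<close>, and all the gain comes from the prior tail. This is affordable
    when \<open>x\<close> is of the order of the noise and \<open>\<sigma>\<close> is tiny.\<close>
  have "(\<integral>\<^sup>+ u. indicator {u. t < \<bar>u\<bar>} u * ennreal (coord_lik n x u) \<partial>coord_prior h \<sigma>)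
    \<le> (\<integral>\<^sup>+ u. ennreal (exp (real n * x\<^sup>2 / 2)) * indicator {u. t < \<bar>u\<bar>} u \<partial>coord_prior h \<sigma>)"
    by (intro nn_integral_mono) (auto split: split_indicator intro!: ennreal_leI coord_lik_le)
  also have "\<dots> = ennreal (exp (real n * x\<^sup>2 / 2)) * (\<integral>\<^sup>+ u. indicator {u. t < \<bar>u\<bar>} u \<partial>coord_prior h \<sigma>)"
    by (intro nn_integral_cmult) (auto simp: coord_prior_def)
  also have "\<dots> \<le> ennreal (exp (real n * x\<^sup>2 / 2)) * ennreal (2 * c * \<sigma> / t)"
    using assms by (intro mult_left_mono coord_prior_tail) auto
  also have "\<dots> = ennreal (exp (real n * x\<^sup>2 / 2) * (2 * c * \<sigma> / t) * exp (1/2) / h 1) * ennreal (h 1 * exp (-1/2))"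
    using assms c_ge h_pos[of 1]
    by (simp add: ennreal_mult[symmetric] exp_minus field_simps)
  also have "\<dots> \<le> ennreal (exp (real n * x\<^sup>2 / 2) * (2 * c * \<sigma> / t) * exp (1/2) / h 1) * ?D"
    by (intro mult_left_mono den) auto
  finally show ?thesis .
qed

text \<open>The normalising constant is bounded below on the window of half-width 1/sqrt n around
  \<open>x\<close>: there the likelihood is within a factor \<open>exp (-1/2)\<close> of its
  maximum, and the prior density at \<open>u\<close>, which is
  \<open>h (u / \<sigma>) / \<sigma>\<close>, is at least
  \<open>h ((\<bar>x\<bar> + 1) / \<sigma>)\<close> as \<open>\<sigma> \<le> 1\<close>. The factor
  \<open>sqrt n\<close> is the reciprocal of the window size.\<close>

lemma coord_posterior_concentrates:
  assumes "0 < \<sigma>" "\<sigma> \<le> 1" and n: "0 < n" and "l \<le> R" and x: "\<bar>x - \<theta>\<bar> \<le> l / sqrt n"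
  shows "(\<integral>\<^sup>+ u. indicator {u. R / sqrt n < \<bar>u - \<theta>\<bar>} u * ennreal (coord_lik n x u) \<partial>coord_prior h \<sigma>)
    \<le> ennreal (exp (- (R - l)\<^sup>2 / 2) * sqrt n / h ((\<bar>x\<bar> + 1) / \<sigma>))
      * (\<integral>\<^sup>+ u. ennreal (coord_lik n x u) \<partial>coord_prior h \<sigma>)"
proof -
  let ?D = "\<integral>\<^sup>+ u. ennreal (coord_lik n x u) \<partial>coord_prior h \<sigma>"
  let ?e = "exp (real n * x\<^sup>2 / 2)" and ?b = "h ((\<bar>x\<bar> + 1) / \<sigma>)"
  define w where "w = 1 / sqrt n"
  have w: "0 < w" "w \<le> 1" "real n * w\<^sup>2 = 1" and sq: "sqrt n * w = 1"
    using n by (auto simp: w_def field_simps power_divide)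
  define I where "I = {(x - w) / \<sigma> .. (x + w) / \<sigma>}"
  have [measurable]: "I \<in> sets borel" by (simp add: I_def)
  have "(x - w) / \<sigma> \<le> (x + w) / \<sigma>"
    using assms w by (simp add: divide_right_mono)
  then have I: "emeasure lborel I = ennreal (2 * w / \<sigma>)"
    by (simp add: I_def diff_divide_distrib[symmetric])
  \<comment> \<open>The window has length \<open>2 * w\<close>; this 2 compensates the loss
    \<open>exp (-1/2)\<close> of the likelihood inside it.\<close>
  have half: "(1::real) \<le> 2 * exp (-1/2)"
    using exp_ge_add_one_self[of "-1/2::real"] by simp
  have "ennreal (?e * (?b * w)) \<le> ennreal (?e * (exp (-1/2) * ?b) * (2 * w / \<sigma>))"
  proof (rule ennreal_leI)
    have "1 * w \<le> (2 * exp (-1/2)) * (w / \<sigma>)"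
      using half w assms by (intro mult_mono) (auto simp: field_simps)
    then have "?e * ?b * (1 * w) \<le> ?e * ?b * ((2 * exp (-1/2)) * (w / \<sigma>))"
      by (intro mult_left_mono) auto
    then show "?e * (?b * w) \<le> ?e * (exp (-1/2) * ?b) * (2 * w / \<sigma>)"
      by (simp add: field_simps)
  qed
  also have "\<dots> = (\<integral>\<^sup>+ z. ennreal (?e * (exp (-1/2) * ?b)) * indicator I z \<partial>lborel)"
    using assms w by (simp add: nn_integral_cmult_indicator I ennreal_mult[symmetric])
  also have "\<dots> \<le> (\<integral>\<^sup>+ z. ennreal (h z) * ennreal (coord_lik n x (\<sigma> * z)) \<partial>lborel)"
  proof (intro nn_integral_mono)
    fix z :: real
    show "ennreal (?e * (exp (-1/2) * ?b)) * indicator I z \<le> ennreal (h z) * ennreal (coord_lik n x (\<sigma> * z))"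
    proof (cases "z \<in> I")
      case True
      then have "x - w \<le> \<sigma> * z" "\<sigma> * z \<le> x + w"
        using \<open>0 < \<sigma>\<close> by (auto simp: I_def field_simps)
      then have d: "\<bar>\<sigma> * z - x\<bar> \<le> w" by linarith
      then have "\<bar>\<sigma> * z\<bar> \<le> \<bar>x\<bar> + 1" using w by linarith
      then have "\<bar>z\<bar> \<le> (\<bar>x\<bar> + 1) / \<sigma>"
        using \<open>0 < \<sigma>\<close> by (simp add: field_simps abs_mult)
      then have hz: "?b \<le> h z" by (rule h_abs)
      have "(\<sigma> * z - x)\<^sup>2 \<le> w\<^sup>2"
        using d w by (simp add: abs_le_square_iff[symmetric])
      then have "real n * (\<sigma> * z - x)\<^sup>2 \<le> 1"
        using w(3) by (metis mult_left_mono of_nat_0_le_iff)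
      then have "?e * exp (-1/2) \<le> coord_lik n x (\<sigma> * z)"
        unfolding coord_lik_eq by (intro mult_left_mono) auto
      with hz have "?b * (?e * exp (-1/2)) \<le> h z * coord_lik n x (\<sigma> * z)"
        by (intro mult_mono) auto
      then show ?thesis using True by (simp add: ennreal_mult[symmetric] ennreal_leI ac_simps)
    qed simp
  qed
  also have "\<dots> = ?D" by (subst nn_integral_coord_prior) auto
  finally have den: "ennreal (?e * (?b * w)) \<le> ?D" .
  \<comment> \<open>By the triangle inequality \<open>u\<close> is at least
    \<open>(R - l) / sqrt n\<close> away from \<open>x\<close>, the centre of the
    likelihood.\<close>
  have far: "coord_lik n x u \<le> ?e * exp (- (R - l)\<^sup>2 / 2)" if "R / sqrt n < \<bar>u - \<theta>\<bar>" for u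
  proof -
    have "(R - l) * w \<le> \<bar>u - x\<bar>"
      using that x unfolding w_def by (simp add: diff_divide_distrib algebra_simps)
    then have "((R - l) * w)\<^sup>2 \<le> (u - x)\<^sup>2"
      using assms w by (simp add: abs_le_square_iff[symmetric])
    then have "real n * ((R - l) * w)\<^sup>2 \<le> real n * (u - x)\<^sup>2"
      by (intro mult_left_mono) auto
    moreover have "real n * ((R - l) * w)\<^sup>2 = (R - l)\<^sup>2"
      using w(3) by (simp add: power_mult_distrib mult.left_commute)
    ultimately show ?thesis
      unfolding coord_lik_eq by (intro mult_left_mono) auto
  qed
  have "(\<integral>\<^sup>+ u. indicator {u. R / sqrt n < \<bar>u - \<theta>\<bar>} u * ennreal (coord_lik n x u) \<partial>coord_prior h \<sigma>)
    \<le> (\<integral>\<^sup>+ u. ennreal (?e * exp (- (R - l)\<^sup>2 / 2)) * 1 \<partial>coord_prior h \<sigma>)"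
    by (intro nn_integral_mono) (auto split: split_indicator intro!: ennreal_leI dest: far)
  also have "\<dots> = ennreal (?e * exp (- (R - l)\<^sup>2 / 2))"
    using prob_space.emeasure_space_1[OF prob_space_coord_prior[of \<sigma>]]
    by (subst nn_integral_cmult) auto
  also have "\<dots> = ennreal (exp (- (R - l)\<^sup>2 / 2) * sqrt n / ?b) * ennreal (?e * (?b * w))"
  proof -
    have "?e * exp (- (R - l)\<^sup>2 / 2) = exp (- (R - l)\<^sup>2 / 2) * ?e * (sqrt n * w)"
      by (simp add: sq)
    also have "\<dots> = (exp (- (R - l)\<^sup>2 / 2) * sqrt n / ?b) * (?e * (?b * w))"
      using h_pos[of "(\<bar>x\<bar> + 1) / \<sigma>"] by simp
    finally show ?thesis
      using w by (simp add: ennreal_mult[symmetric])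
  qed
  also have "\<dots> \<le> ennreal (exp (- (R - l)\<^sup>2 / 2) * sqrt n / ?b) * ?D"
    by (intro mult_left_mono den) auto
  finally show ?thesis .
qed

end

text \<open>Half of the Gaussian exponent is at least l^2/4 in absolute value on the tail; the other
  half is the exponent of a normal density with doubled variance, whose total mass is 1. The change
  of normalisation costs \<open>sqrt 2\<close>.\<close>

lemma normal_tail:
  assumes "0 < \<tau>" "0 \<le> l"
  shows "emeasure (density lborel (normal_density m \<tau>)) {x. l * \<tau> < \<bar>x - m\<bar>} \<le> ennreal (2 * exp (- l\<^sup>2 / 4))"
proof -
  let ?t = "sqrt 2 * \<tau>"
  have "emeasure (density lborel (normal_density m \<tau>)) {x. l * \<tau> < \<bar>x - m\<bar>}
      = (\<integral>\<^sup>+ x. ennreal (normal_density m \<tau> x) * indicator {x. l * \<tau> < \<bar>x - m\<bar>} x \<partial>lborel)"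
    by (intro emeasure_density) auto
  also have "\<dots> \<le> (\<integral>\<^sup>+ x. ennreal (sqrt 2 * exp (- l\<^sup>2 / 4)) * ennreal (normal_density m ?t x) \<partial>lborel)"
  proof (intro nn_integral_mono)
    fix x :: real
    show "ennreal (normal_density m \<tau> x) * indicator {x. l * \<tau> < \<bar>x - m\<bar>} x
      \<le> ennreal (sqrt 2 * exp (- l\<^sup>2 / 4)) * ennreal (normal_density m ?t x)"
    proof (cases "l * \<tau> < \<bar>x - m\<bar>")
      case True
      then have "(l * \<tau>)\<^sup>2 \<le> (x - m)\<^sup>2"
        using assms by (simp add: abs_le_square_iff[symmetric] abs_mult)
      then have "l\<^sup>2 \<le> (x - m)\<^sup>2 / \<tau>\<^sup>2"
        using assms by (simp add: field_simps power_mult_distrib)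
      then have "exp (- (x - m)\<^sup>2 / (2 * \<tau>\<^sup>2)) \<le> exp (- l\<^sup>2 / 4 + - (x - m)\<^sup>2 / (2 * ?t\<^sup>2))"
        using assms by (simp add: power_mult_distrib field_simps)
      then have "normal_density m \<tau> x
          \<le> 1 / sqrt (2 * pi * \<tau>\<^sup>2) * (exp (- l\<^sup>2 / 4) * exp (- (x - m)\<^sup>2 / (2 * ?t\<^sup>2)))"
        unfolding normal_density_def exp_add by (intro mult_left_mono) auto
      also have "\<dots> = (sqrt 2 * exp (- l\<^sup>2 / 4)) * normal_density m ?t x"
        unfolding normal_density_def using assms by (simp add: real_sqrt_mult power_mult_distrib field_simps)
      finally show ?thesis using True by (simp add: ennreal_mult[symmetric] ennreal_leI)
    qed simp
  qed
  also have "\<dots> = ennreal (sqrt 2 * exp (- l\<^sup>2 / 4)) * (\<integral>\<^sup>+ x. ennreal (normal_density m ?t x) \<partial>lborel)"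
    by (intro nn_integral_cmult) auto
  also have "(\<integral>\<^sup>+ x. ennreal (normal_density m ?t x) \<partial>lborel) = 1"
    using assms by (subst nn_integral_eq_integral) auto
  also have "ennreal (sqrt 2 * exp (- l\<^sup>2 / 4)) * 1 \<le> ennreal (2 * exp (- l\<^sup>2 / 4))"
    using real_sqrt_le_mono[of 2 4] by (auto intro!: ennreal_leI mult_right_mono)
  finally show ?thesis .
qed


section \<open>The posterior on sequence space\<close>

text \<open>Throughout, \<open>l\<close> counts levels from \<open>0\<close>, so that it corresponds to \<open>j = int l - 1\<close>.\<close>
lemma wav_idx_iff: "(int l - 1, k) \<in> wav_idx \<longleftrightarrow> k < nlev (int l - 1)"
  by (simp add: wav_idx_def)

lemma wav_idxE:
  assumes "i \<in> wav_idx"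
  obtains l k where "i = (int l - 1, k)" "k < nlev (int l - 1)"
proof -
  obtain j k where i: "i = (j, k)" "j \<ge> -1" "k < nlev j"
    using assms by (auto simp: wav_idx_def)
  then show ?thesis
    using that[of "nat (j + 1)" k] by simp
qed

lemma nlev_le: "nlev (int l - 1) \<le> 2 ^ l"
  by (auto simp: nlev_def intro!: power_increasing)

lemma nlev_le_real: "real (nlev (int l - 1)) \<le> 2 ^ l"
  using of_nat_mono[OF nlev_le[of l], where 'a = real] by simp

lemma countable_wav_idx: "countable wav_idx"
  by (rule countable_subset[OF subset_UNIV]) simp

text \<open>\<open>lvl_sum\<close> is a \<open>suminf\<close> and carries no information where the
  series diverges, so this predicate is the side condition for splitting off a coordinate.\<close>

definition lvl_summable :: "(int \<times> nat \<Rightarrow> real) \<Rightarrow> bool" where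
  "lvl_summable a \<longleftrightarrow> summable (\<lambda>l. \<Sum>k<nlev (int l - 1). a (int l - 1, k))"

lemma lvl_sum_upd:
  assumes i: "i \<in> wav_idx" and a: "lvl_summable (a(i := 0))"
  shows "lvl_summable a" "lvl_sum a = a i + lvl_sum (a(i := 0))"
proof -
  obtain l k where lk: "i = (int l - 1, k)" "k < nlev (int l - 1)"
    using i by (rule wav_idxE)
  let ?s = "\<lambda>a m. \<Sum>k<nlev (int m - 1). a (int m - 1, k) :: real"
  have eq: "?s a = (\<lambda>m. (if m = l then a i else 0) + ?s (a(i := 0)) m)"
  proof
    fix m
    show "?s a m = (if m = l then a i else 0) + ?s (a(i := 0)) m"
    proof (cases "m = l")
      case True
      have "?s a l = a i + (\<Sum>k'\<in>{..<nlev (int l - 1)} - {k}. a (int l - 1, k'))"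
        using lk by (subst sum.remove[of _ k]) auto
      also have "(\<Sum>k'\<in>{..<nlev (int l - 1)} - {k}. a (int l - 1, k')) = ?s (a(i := 0)) l"
        using lk by (subst (2) sum.remove[of _ k]) (auto intro!: sum.cong)
      finally show ?thesis using True by simp
    qed (auto simp: lk intro!: sum.cong)
  qed
  have "?s a sums (a i + (\<Sum>m. ?s (a(i := 0)) m))"
    unfolding eq using a unfolding lvl_summable_def
    by (intro sums_add sums_single summable_sums)
  then show "lvl_summable a" "lvl_sum a = a i + lvl_sum (a(i := 0))"
    by (auto simp: lvl_summable_def lvl_sum_def sums_iff)
qed

text \<open>The exponential turns splitting off one term into a product. Lumping all other
  coordinates into the likelihood at \<open>f(i := 0)\<close> gives a two-factor identity and avoids
  infinite products.\<close>

lemma lik_upd: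
  assumes i: "i \<in> wav_idx"
    and "lvl_summable (\<lambda>i'. X i' * (f(i := 0)) i')" "lvl_summable (\<lambda>i'. ((f(i := 0)) i')\<^sup>2)"
  shows "lik n X f = coord_lik n (X i) (f i) * lik n X (f(i := 0))"
proof -
  have 1: "(\<lambda>i'. X i' * (f(i := 0)) i') = (\<lambda>i'. X i' * f i')(i := 0)"
    and 2: "(\<lambda>i'. ((f(i := 0)) i')\<^sup>2) = (\<lambda>i'. (f i')\<^sup>2)(i := 0)"
    by auto
  have "lvl_sum (\<lambda>i'. X i' * f i') = X i * f i + lvl_sum (\<lambda>i'. X i' * (f(i := 0)) i')"
    using lvl_sum_upd(2)[OF i, of "\<lambda>i'. X i' * f i'"] assms unfolding 1 by simp
  moreover have "lvl_sum (\<lambda>i'. (f i')\<^sup>2) = (f i)\<^sup>2 + lvl_sum (\<lambda>i'. ((f(i := 0)) i')\<^sup>2)"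
    using lvl_sum_upd(2)[OF i, of "\<lambda>i'. (f i')\<^sup>2"] assms unfolding 2 by simp
  ultimately show ?thesis
    unfolding lik_def coord_lik_def exp_add[symmetric] by (simp add: algebra_simps)
qed

text \<open>Tonelli after splitting the coordinate \<open>i\<close> off the possibly infinite
  product. Independence of \<open>G\<close> from that coordinate is expressed by invariance under
  updates, so \<open>G\<close> keeps its domain; \<open>y\<close> is a dummy value filling the
  vacant place.\<close>

lemma nn_integral_PiM_coord:
  assumes M: "\<And>i. i \<in> I \<Longrightarrow> prob_space (M i)" and i: "i \<in> I" and y: "y \<in> space (M i)"
    and [measurable]: "u \<in> borel_measurable (M i)" "G \<in> borel_measurable (PiM I M)"
    and G: "\<And>f x. G (f(i := x)) = G f"
  shows "(\<integral>\<^sup>+ f. u (f i) * G f \<partial>PiM I M) = (\<integral>\<^sup>+ x. u x \<partial>M i) * (\<integral>\<^sup>+ f. G f \<partial>PiM I M)"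
proof -
  let ?I = "I - {i}"
  let ?P = "PiM ?I M"
  have I: "insert i ?I = I" using i by auto
  interpret Mi: prob_space "M i" using M i by auto
  interpret Q: prob_space ?P using M by (intro prob_space_PiM) auto
  have eq: "PiM I M = distr (M i \<Otimes>\<^sub>M ?P) (PiM I M) (\<lambda>(x, X). X(i := x))"
    using distr_pair_PiM_eq_PiM[of ?I M i] M i unfolding I by auto
  have [measurable]: "(\<lambda>(x, X). X(i := x)) \<in> measurable (M i \<Otimes>\<^sub>M ?P) (PiM I M)"
    using measurable_add_dim[of i ?I M] i unfolding I
    by (auto simp: I case_prod_beta intro!: measurable_fun_upd[where J = ?I])
  have [measurable]: "(\<lambda>X. X(i := y)) \<in> measurable ?P (PiM I M)"
    using y i by (intro measurable_fun_upd[where J = ?I]) (auto simp: I)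
  have main: "(\<integral>\<^sup>+ f. v (f i) * G f \<partial>PiM I M)
      = (\<integral>\<^sup>+ x. v x \<partial>M i) * (\<integral>\<^sup>+ Y. G (Y(i := y)) \<partial>?P)"
    if [measurable]: "v \<in> borel_measurable (M i)" for v :: "'b \<Rightarrow> ennreal"
  proof -
    have [measurable]: "(\<lambda>f. f i) \<in> measurable (PiM I M) (M i)"
      using i by (rule measurable_component_singleton)
    have "(\<integral>\<^sup>+ f. v (f i) * G f \<partial>PiM I M)
        = (\<integral>\<^sup>+ (x, Y). v x * G (Y(i := y)) \<partial>(M i \<Otimes>\<^sub>M ?P))"
      by (subst eq, subst nn_integral_distr)
         (auto simp: case_prod_beta G intro!: nn_integral_cong)
    also have "\<dots> = (\<integral>\<^sup>+ x. \<integral>\<^sup>+ Y. v x * G (Y(i := y)) \<partial>?P \<partial>M i)"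
      using Q.nn_integral_fst[of "\<lambda>(x, Y). v x * G (Y(i := y))" "M i"] by simp
    also have "\<dots> = (\<integral>\<^sup>+ x. v x * (\<integral>\<^sup>+ Y. G (Y(i := y)) \<partial>?P) \<partial>M i)"
      by (intro nn_integral_cong nn_integral_cmult) auto
    also have "\<dots> = (\<integral>\<^sup>+ x. v x \<partial>M i) * (\<integral>\<^sup>+ Y. G (Y(i := y)) \<partial>?P)"
      by (intro nn_integral_multc) auto
    finally show ?thesis .
  qed
  \<comment> \<open>The instance with the constant 1 identifies the integral over the remaining
    coordinates as the full integral of \<open>G\<close>, since \<open>M i\<close> has mass
    1.\<close>
  show ?thesis
    using main[of u] main[of "\<lambda>_. 1"] Mi.emeasure_space_1 by simp
qed

text \<open>Level \<open>l\<close> has at most 2^l indices, which turns (1/4)^l into (1/2)^l, with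
  sum 2. The factor \<open>D\<close> is the normalising constant of an unnormalised posterior in one
  application and 1 in the other.\<close>

lemma emeasure_UN_wav_idx_le:
  assumes A: "\<And>i. i \<in> wav_idx \<Longrightarrow> A i \<in> sets M"
    and le: "\<And>l k. k < nlev (int l - 1) \<Longrightarrow> emeasure M (A (int l - 1, k)) \<le> ennreal (e * (1/4) ^ l) * D"
    and "0 \<le> e"
  shows "emeasure M (\<Union>i\<in>wav_idx. A i) \<le> ennreal (2 * e) * D"
proof -
  let ?U = "\<lambda>l. \<Union>k<nlev (int l - 1). A (int l - 1, k)"
  have U: "(\<Union>i\<in>wav_idx. A i) = (\<Union>l. ?U l)"
  proof (intro equalityI subsetI)
    fix x assume "x \<in> (\<Union>i\<in>wav_idx. A i)"
    then obtain i where "i \<in> wav_idx" "x \<in> A i" by blast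
    then show "x \<in> (\<Union>l. ?U l)" by (elim wav_idxE) auto
  next
    fix x assume "x \<in> (\<Union>l. ?U l)"
    then show "x \<in> (\<Union>i\<in>wav_idx. A i)" using wav_idx_iff by blast
  qed
  have [simp]: "A (int l - 1, k) \<in> sets M" if "k < nlev (int l - 1)" for l k
    using A that by (simp add: wav_idx_iff)
  have lev: "emeasure M (?U l) \<le> ennreal (e * (1/2) ^ l) * D" for l
  proof -
    have "emeasure M (?U l) \<le> (\<Sum>k<nlev (int l - 1). emeasure M (A (int l - 1, k)))"
      by (intro emeasure_subadditive_finite) auto
    also have "\<dots> \<le> (\<Sum>k<nlev (int l - 1). ennreal (e * (1/4) ^ l) * D)"
      using le by (intro sum_mono) auto
    also have "\<dots> = ennreal (real (nlev (int l - 1))) * ennreal (e * (1/4) ^ l) * D"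
      by (simp add: ennreal_of_nat_eq_real_of_nat mult.assoc)
    also have "\<dots> \<le> ennreal (2 ^ l) * ennreal (e * (1/4) ^ l) * D"
      using nlev_le_real[of l] by (intro mult_right_mono ennreal_leI) auto
    also have "\<dots> = ennreal (e * (1/2) ^ l) * D"
      using \<open>0 \<le> e\<close> by (simp add: ennreal_mult[symmetric] power_mult_distrib[symmetric] mult.left_commute)
    finally show ?thesis .
  qed
  have "emeasure M (\<Union>l. ?U l) \<le> (\<Sum>l. emeasure M (?U l))"
    by (intro emeasure_subadditive_countably) auto
  also have "\<dots> \<le> (\<Sum>l. ennreal (e * (1/2) ^ l) * D)"
    using lev by (intro suminf_le) auto
  also have "\<dots> = ennreal (\<Sum>l. e * (1/2) ^ l) * D"
    using \<open>0 \<le> e\<close> by (simp add: suminf_ennreal2 summable_mult)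
  also have "(\<Sum>l. e * (1/2::real) ^ l) = 2 * e"
    by (simp add: suminf_mult suminf_geometric)
  finally show ?thesis unfolding U .
qed

section \<open>Almost sure decay of prior draws and factorisation of the posterior\<close>

context heavy_tail
begin

abbreviation pc :: "int \<times> nat \<Rightarrow> real measure" where
  "pc i \<equiv> coord_prior h (2 powr - (real_of_int (fst i))\<^sup>2)"

lemma prior_eq: "prior h = PiM wav_idx pc"
  unfolding prior_def coord_prior_def by (intro arg_cong[where f = "PiM wav_idx"]) auto

lemma sets_pc [simp, measurable_cong]: "sets (coord_prior h \<sigma>) = sets borel"
  by (simp add: coord_prior_def)

lemma space_pc [simp]: "space (coord_prior h \<sigma>) = UNIV"
  by (simp add: coord_prior_def)

lemma prior_component_measurable [measurable]:
  "i \<in> wav_idx \<Longrightarrow> (\<lambda>f. f i) \<in> borel_measurable (prior h)"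
  unfolding prior_eq
  using measurable_component_singleton[of i wav_idx pc] by (simp cong: measurable_cong_sets)

lemma prob_space_prior: "prob_space (prior h)"
  unfolding prior_eq by (intro prob_space_PiM prob_space_coord_prior)

lemma lvl_sum_measurable_prior:
  assumes "\<And>i. i \<in> wav_idx \<Longrightarrow> (\<lambda>f. a f i) \<in> borel_measurable (prior h)"
  shows "(\<lambda>f. lvl_sum (a f)) \<in> borel_measurable (prior h)"
  unfolding lvl_sum_def
  by (intro borel_measurable_suminf borel_measurable_sum assms) (simp add: wav_idx_iff)

lemma lik_measurable [measurable]: "lik n X \<in> borel_measurable (prior h)"
proof -
  have [measurable]: "(\<lambda>f. lvl_sum (\<lambda>i. X i * f i)) \<in> borel_measurable (prior h)"
    "(\<lambda>f. lvl_sum (\<lambda>i. (f i)\<^sup>2)) \<in> borel_measurable (prior h)"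
    by (intro lvl_sum_measurable_prior borel_measurable_times borel_measurable_const
          borel_measurable_power prior_component_measurable; assumption)+
  show ?thesis unfolding lik_def by measurable
qed

text \<open>Borel-Cantelli: the scale 2^(-j^2) beats every geometric sequence, even under the weak
  tail bound. The threshold 8^(-l) leaves room for 2^l coefficients per level and for data growing
  like 2^l.\<close>

lemma AE_prior_decay:
  "AE f in prior h. \<exists>L. \<forall>l\<ge>L. \<forall>k<nlev (int l - 1). \<bar>f (int l - 1, k)\<bar> \<le> (1/8) ^ l"
proof -
  interpret P: prob_space "prior h" by (rule prob_space_prior)
  define A where "A l = (\<Union>k<nlev (int l - 1). {f \<in> space (prior h). (1/8) ^ l < \<bar>f (int l - 1, k)\<bar>})" for l
  have meas: "{f \<in> space (prior h). (1/8) ^ l < \<bar>f (int l - 1, k)\<bar>} \<in> sets (prior h)"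
    if "k < nlev (int l - 1)" for l k
  proof -
    have [measurable]: "(\<lambda>f. f (int l - 1, k)) \<in> borel_measurable (prior h)"
      using that by (simp add: wav_idx_iff)
    show ?thesis by measurable
  qed
  have [measurable]: "A l \<in> sets (prior h)" for l
    unfolding A_def using meas by (intro sets.finite_UN) auto
  define K where "K = 2 * c * 2 ^ 13"
  have one: "emeasure (prior h) {f \<in> space (prior h). (1/8) ^ l < \<bar>f (int l - 1, k)\<bar>} \<le> ennreal (K * (1/4) ^ l)"
    if k: "k < nlev (int l - 1)" for l k
  proof -
    have i: "(int l - 1, k) \<in> wav_idx" using k by (simp add: wav_idx_iff)
    let ?\<sigma> = "2 powr - (real_of_int (int l - 1))\<^sup>2"
    have "emeasure (prior h) {f \<in> space (prior h). (1/8) ^ l < \<bar>f (int l - 1, k)\<bar>}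
        = emeasure (distr (PiM wav_idx pc) (pc (int l - 1, k)) (\<lambda>f. f (int l - 1, k))) {x. (1/8) ^ l < \<bar>x\<bar>}"
      unfolding prior_eq using i
      by (subst emeasure_distr) (auto intro!: arg_cong2[where f = emeasure] simp: measurable_component_singleton)
    also have "\<dots> = emeasure (pc (int l - 1, k)) {x. (1/8) ^ l < \<bar>x\<bar>}"
      using i by (subst distr_PiM_component) (auto intro: prob_space_coord_prior)
    also have "\<dots> = (\<integral>\<^sup>+ x. indicator {x. (1/8) ^ l < \<bar>x\<bar>} x \<partial>coord_prior h ?\<sigma>)"
      by (subst nn_integral_indicator) auto
    also have "\<dots> \<le> ennreal (2 * c * ?\<sigma> / (1/8) ^ l)"
      by (intro coord_prior_tail) auto
    also have "\<dots> \<le> ennreal (K * (1/4) ^ l)"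
    proof (rule ennreal_leI)
      \<comment> \<open>The 5 comes from 8^l * 4^l = 2^(5l). The exponent -(l-1)^2 + 5l = -l^2 + 7l
        - 1 has maximum 45/4, so 13 suffices.\<close>
      have "0 \<le> (real l - 7/2)\<^sup>2" by simp
      then have "real l * 7 - 49/4 \<le> (real l)\<^sup>2"
        by (simp add: power2_eq_square algebra_simps)
      then have ex: "- (real_of_int (int l - 1))\<^sup>2 + 5 * real l \<le> 13"
        by (simp add: power2_eq_square algebra_simps)
      have "?\<sigma> * 8 ^ l * 4 ^ l = ?\<sigma> * 2 powr (5 * real l)"
        by (simp add: powr_powr[symmetric] powr_realpow power_mult_distrib[symmetric] mult.assoc)
      also have "\<dots> = 2 powr (- (real_of_int (int l - 1))\<^sup>2 + 5 * real l)"
        by (simp only: powr_add)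
      also have "\<dots> \<le> 2 powr 13"
        using ex by (intro powr_mono) auto
      finally have "?\<sigma> * 8 ^ l * 4 ^ l \<le> 2 ^ 13"
        using powr_realpow[of 2 13] by simp
      then show "2 * c * ?\<sigma> / (1/8) ^ l \<le> K * (1/4) ^ l"
        unfolding K_def using c_ge by (simp add: field_simps power_divide)
    qed
    finally show ?thesis .
  qed
  have Al: "emeasure (prior h) (A l) \<le> ennreal (K * (1/2) ^ l)" for l
  proof -
    have "emeasure (prior h) (A l) \<le> (\<Sum>k<nlev (int l - 1). ennreal (K * (1/4) ^ l))"
      unfolding A_def using meas one
      by (intro order_trans[OF emeasure_subadditive_finite] sum_mono) auto
    also have "\<dots> = ennreal (real (nlev (int l - 1))) * ennreal (K * (1/4) ^ l)"
      by (simp add: ennreal_of_nat_eq_real_of_nat)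
    also have "\<dots> \<le> ennreal (2 ^ l) * ennreal (K * (1/4) ^ l)"
      using nlev_le_real[of l] by (intro mult_right_mono ennreal_leI) auto
    also have "\<dots> = ennreal (K * (1/2) ^ l)"
      using c_ge by (simp add: ennreal_mult[symmetric] power_mult_distrib[symmetric] mult.left_commute K_def)
    finally show ?thesis .
  qed
  have K0: "0 \<le> K" using c_ge by (simp add: K_def)
  have "AE f in prior h. eventually (\<lambda>l. f \<in> space (prior h) - A l) sequentially"
  proof (rule borel_cantelli_AE1)
    show "summable (\<lambda>l. measure (prior h) (A l))"
    proof (rule summable_comparison_test')
      show "summable (\<lambda>l. K * (1/2::real) ^ l)" by (intro summable_mult) simp
      show "norm (measure (prior h) (A l)) \<le> K * (1/2) ^ l" for l
        using Al[of l] K0 by (simp add: P.emeasure_eq_measure)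
    qed
  qed (auto simp: P.emeasure_eq_measure)
  then show ?thesis
    by eventually_elim (auto simp: A_def eventually_sequentially not_less)
qed

text \<open>The quantifier over \<open>i\<close> sits inside \<open>AE\<close>, so a single null set
  serves all coordinates: zeroing one coefficient does not harm the decay of the draw.\<close>

lemma AE_prior_summable:
  assumes X: "\<And>l k. k < nlev (int l - 1) \<Longrightarrow> \<bar>X (int l - 1, k)\<bar> \<le> C * 2 ^ l"
  shows "AE f in prior h. \<forall>i. lvl_summable (\<lambda>i'. X i' * (f(i := 0)) i') \<and> lvl_summable (\<lambda>i'. ((f(i := 0)) i')\<^sup>2)"
  using AE_prior_decay
proof eventually_elim
  case (elim f)
  then obtain L where L: "\<And>l k. l \<ge> L \<Longrightarrow> k < nlev (int l - 1) \<Longrightarrow> \<bar>f (int l - 1, k)\<bar> \<le> (1/8) ^ l"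
    by blast
  have "0 \<le> C" using X[of 0 0] by (simp add: nlev_def)
  have *: "lvl_summable a" if a: "\<And>l k. l \<ge> L \<Longrightarrow> k < nlev (int l - 1) \<Longrightarrow> \<bar>a (int l - 1, k)\<bar> \<le> D * (1/4) ^ l"
      and "0 \<le> D" for a D
    unfolding lvl_summable_def
  proof (rule summable_comparison_test')
    show "summable (\<lambda>l. D * (1/2::real) ^ l)" by (intro summable_mult) simp
    fix l assume "L \<le> l"
    have "norm (\<Sum>k<nlev (int l - 1). a (int l - 1, k)) \<le> (\<Sum>k<nlev (int l - 1). D * (1/4) ^ l)"
      using a[OF \<open>L \<le> l\<close>] by (intro order_trans[OF norm_sum] sum_mono) auto
    also have "\<dots> = real (nlev (int l - 1)) * (D * (1/4) ^ l)" by simp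
    also have "\<dots> \<le> 2 ^ l * (D * (1/4) ^ l)"
      using nlev_le_real[of l] \<open>0 \<le> D\<close> by (intro mult_right_mono) auto
    also have "\<dots> = D * (1/2) ^ l" by (simp add: power_mult_distrib[symmetric] mult.left_commute)
    finally show "norm (\<Sum>k<nlev (int l - 1). a (int l - 1, k)) \<le> D * (1/2) ^ l" .
  qed
  have upd: "\<bar>(f(i := 0)) i'\<bar> \<le> \<bar>f i'\<bar>" for i i' by simp
  show ?case
  proof (intro allI conjI)
    fix i
    show "lvl_summable (\<lambda>i'. X i' * (f(i := 0)) i')"
    proof (rule *[OF _ \<open>0 \<le> C\<close>])
      fix l k assume l: "L \<le> l" "k < nlev (int l - 1)"
      have "\<bar>X (int l - 1, k)\<bar> * \<bar>(f(i := 0)) (int l - 1, k)\<bar> \<le> (C * 2 ^ l) * (1/8) ^ l"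
        using X[OF l(2)] L[OF l] order_trans[OF upd L[OF l]] \<open>0 \<le> C\<close> by (intro mult_mono) auto
      also have "\<dots> = C * (1/4) ^ l" by (simp add: power_mult_distrib[symmetric] mult.assoc)
      finally show "\<bar>X (int l - 1, k) * (f(i := 0)) (int l - 1, k)\<bar> \<le> C * (1/4) ^ l"
        by (simp add: abs_mult)
    qed
    show "lvl_summable (\<lambda>i'. ((f(i := 0)) i')\<^sup>2)"
    proof (rule *[of _ 1])
      fix l k assume l: "L \<le> l" "k < nlev (int l - 1)"
      have "\<bar>(f(i := 0)) (int l - 1, k)\<bar> * \<bar>(f(i := 0)) (int l - 1, k)\<bar> \<le> (1/8) ^ l * (1/8) ^ l"
        using order_trans[OF upd L[OF l]] by (intro mult_mono) auto
      also have "\<dots> = (1/64) ^ l" by (simp add: power_mult_distrib[symmetric])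
      also have "\<dots> \<le> (1/4) ^ l" by (intro power_mono) auto
      finally show "\<bar>((f(i := 0)) (int l - 1, k))\<^sup>2\<bar> \<le> 1 * (1/4) ^ l"
        by (simp add: power2_eq_square abs_mult)
    qed simp
  qed
qed

text \<open>The likelihood factorises over coordinates, so coordinatewise posterior bounds combine by a
  union bound. If the normalising constant is \<open>0\<close> or infinite, the posterior is \<open>0\<close> by the conventions of
  division in \<open>ennreal\<close>.\<close>
lemma posterior_le:
  assumes X: "\<And>l k. k < nlev (int l - 1) \<Longrightarrow> \<bar>X (int l - 1, k)\<bar> \<le> C * 2 ^ l"
    and B: "\<And>f. f \<in> B \<Longrightarrow> \<exists>i\<in>wav_idx. r i < \<bar>f i - f0 i\<bar>"
    and coord: "\<And>l k. k < nlev (int l - 1) \<Longrightarrow>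
      (\<integral>\<^sup>+ u. indicator {u. r (int l - 1, k) < \<bar>u - f0 (int l - 1, k)\<bar>} u
          * ennreal (coord_lik n (X (int l - 1, k)) u) \<partial>pc (int l - 1, k))
      \<le> ennreal (e * (1/4) ^ l) * (\<integral>\<^sup>+ u. ennreal (coord_lik n (X (int l - 1, k)) u) \<partial>pc (int l - 1, k))"
    and e: "0 \<le> e"
  shows "posterior h n B X \<le> ennreal (2 * e)"
proof -
  let ?D = "\<integral>\<^sup>+ f. ennreal (lik n X f) \<partial>prior h"
  let ?N = "density (prior h) (lik n X)"
  define A where "A i = {f \<in> space (prior h). r i < \<bar>f i - f0 i\<bar>}" for i
  have A: "A i \<in> sets ?N" if "i \<in> wav_idx" for i
  proof -
    have [measurable]: "(\<lambda>f. f i) \<in> borel_measurable (prior h)" using that by simp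
    show ?thesis unfolding A_def by simp
  qed
  have AEs: "AE f in prior h. \<forall>i. lvl_summable (\<lambda>i'. X i' * (f(i := 0)) i')
      \<and> lvl_summable (\<lambda>i'. ((f(i := 0)) i')\<^sup>2)"
    by (rule AE_prior_summable) (rule X)
  have NA: "emeasure ?N (A (int l - 1, k)) \<le> ennreal (e * (1/4) ^ l) * ?D" if k: "k < nlev (int l - 1)" for l k
  proof -
    let ?i = "(int l - 1, k)"
    let ?G = "\<lambda>f. ennreal (lik n X (f(?i := 0)))"
    have i: "?i \<in> wav_idx" using k by (simp add: wav_idx_iff)
    have [measurable]: "(\<lambda>f. f(?i := 0)) \<in> measurable (prior h) (prior h)"
      unfolding prior_eq using i by (intro measurable_fun_upd[where J = wav_idx]) auto
    have fact: "(\<integral>\<^sup>+ f. u (f ?i) * ennreal (lik n X f) \<partial>prior h)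
        = (\<integral>\<^sup>+ x. u x * ennreal (coord_lik n (X ?i) x) \<partial>pc ?i) * (\<integral>\<^sup>+ f. ?G f \<partial>prior h)"
      if [measurable]: "u \<in> borel_measurable borel" for u
    proof -
      have "(\<integral>\<^sup>+ f. u (f ?i) * ennreal (lik n X f) \<partial>prior h)
          = (\<integral>\<^sup>+ f. (u (f ?i) * ennreal (coord_lik n (X ?i) (f ?i))) * ?G f \<partial>prior h)"
      proof (rule nn_integral_cong_AE)
        show "AE f in prior h. u (f ?i) * ennreal (lik n X f)
            = (u (f ?i) * ennreal (coord_lik n (X ?i) (f ?i))) * ?G f"
          using AEs
        proof eventually_elim
          case (elim f)
          then show ?case
            using lik_upd[OF i, of X f n] by (simp add: ennreal_mult lik_def mult.assoc)
        qed
      qed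
      also have "\<dots> = (\<integral>\<^sup>+ x. u x * ennreal (coord_lik n (X ?i) x) \<partial>pc ?i) * (\<integral>\<^sup>+ f. ?G f \<partial>prior h)"
        unfolding prior_eq
        by (rule nn_integral_PiM_coord[where y = 0])
           (use i in \<open>auto simp: prior_eq[symmetric] intro: prob_space_coord_prior cong: measurable_cong_sets\<close>)
      finally show ?thesis .
    qed
    have "emeasure ?N (A ?i) = (\<integral>\<^sup>+ f. indicator {u. r ?i < \<bar>u - f0 ?i\<bar>} (f ?i) * ennreal (lik n X f) \<partial>prior h)"
      using A[OF i] by (subst emeasure_density)
        (auto simp: A_def intro!: nn_integral_cong split: split_indicator)
    also have "\<dots> = (\<integral>\<^sup>+ u. indicator {u. r ?i < \<bar>u - f0 ?i\<bar>} u * ennreal (coord_lik n (X ?i) u) \<partial>pc ?i)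
        * (\<integral>\<^sup>+ f. ?G f \<partial>prior h)"
      by (rule fact) auto
    also have "\<dots> \<le> ennreal (e * (1/4) ^ l) * (\<integral>\<^sup>+ u. ennreal (coord_lik n (X ?i) u) \<partial>pc ?i)
        * (\<integral>\<^sup>+ f. ?G f \<partial>prior h)"
      by (intro mult_right_mono coord k) auto
    \<comment> \<open>With \<open>u = 1\<close>, \<open>fact\<close> recombines the one-coordinate
      constant and the integral of \<open>?G\<close> into the full normalising constant.\<close>
    also have "\<dots> = ennreal (e * (1/4) ^ l) * ?D"
      using fact[of "\<lambda>_. 1"] by (simp add: mult.assoc)
    finally show ?thesis .
  qed
  have UN: "(\<Union>i\<in>wav_idx. A i) \<in> sets ?N"
    using A by (intro sets.countable_UN' countable_wav_idx) auto
  \<comment> \<open>\<open>B\<close> is an arbitrary set, so its integral is compared with the one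
    over the measurable union before any measure of a set is taken.\<close>
  have "(\<integral>\<^sup>+ f. indicator B f * ennreal (lik n X f) \<partial>prior h)
      \<le> (\<integral>\<^sup>+ f. ennreal (lik n X f) * indicator (\<Union>i\<in>wav_idx. A i) f \<partial>prior h)"
    using B by (intro nn_integral_mono) (auto simp: A_def split: split_indicator)
  also have "\<dots> = emeasure ?N (\<Union>i\<in>wav_idx. A i)"
    using UN by (subst emeasure_density) auto
  also have "\<dots> \<le> ennreal (2 * e) * ?D"
    using A NA e by (intro emeasure_UN_wav_idx_le) auto
  finally have *: "(\<integral>\<^sup>+ f. indicator B f * ennreal (lik n X f) \<partial>prior h) \<le> ennreal (2 * e) * ?D" .
  show ?thesis
  proof (cases "?D = 0 \<or> ?D = top")
    case True
    then show ?thesis using * by (auto simp: posterior_def)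
  next
    case False
    then show ?thesis
      unfolding posterior_def using divide_right_mono_ennreal[OF *, of ?D]
      by (simp add: ennreal_times_divide[symmetric] less_top)
  qed
qed

end


section \<open>Norms of wavelet series\<close>

text \<open>The tangent of y^p at 1, obtained from the weighted AM-GM inequality for y^p and 1 with
  weights 1/p and 1 - 1/p.\<close>

lemma powr_ge_tangent:
  fixes y p :: real
  assumes "1 \<le> p" "0 \<le> y"
  shows "1 + p * (y - 1) \<le> y powr p"
proof (cases "y = 0")
  case False
  then have "(y powr p) powr (1/p) * 1 powr (1 - 1/p) \<le> (1/p) * (y powr p) + (1 - 1/p) * 1"
    using assms by (intro Youngs_inequality_0) auto
  then have "y \<le> (1/p) * (y powr p) + (1 - 1/p)"
    using assms False by (simp add: powr_powr)
  then have "p * y \<le> p * ((1/p) * (y powr p) + (1 - 1/p))"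
    using assms by (intro mult_left_mono) auto
  then show ?thesis using assms by (simp add: algebra_simps)
qed (use assms in auto)

text \<open>Jensen for t^p at the points \<open>a i / (w i * A)\<close> with weights
  \<open>w i\<close>, by summing the tangent inequality. Weights of total mass below 1 are allowed
  because their mass enters with the nonpositive coefficient \<open>1 - p\<close>.\<close>

lemma powr_sum_le_weighted:
  fixes a w :: "'a \<Rightarrow> real"
  assumes "1 \<le> p" "finite I" and a: "\<And>i. i \<in> I \<Longrightarrow> 0 \<le> a i" and w: "\<And>i. i \<in> I \<Longrightarrow> 0 < w i"
    and W: "(\<Sum>i\<in>I. w i) \<le> 1"
  shows "(\<Sum>i\<in>I. a i) powr p \<le> (\<Sum>i\<in>I. w i powr (1 - p) * a i powr p)"
proof (cases "(\<Sum>i\<in>I. a i) = 0")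
  case True
  then show ?thesis by (simp add: sum_nonneg)
next
  case False
  define A where "A = (\<Sum>i\<in>I. a i)"
  have A: "0 < A" using False a by (simp add: A_def sum_nonneg order.strict_iff_order)
  have "1 \<le> (1 - p) * (\<Sum>i\<in>I. w i) + p"
    using mult_left_mono_neg[OF W, of "1 - p"] assms(1) by simp
  also have "\<dots> = (1 - p) * (\<Sum>i\<in>I. w i) + p * (\<Sum>i\<in>I. a i / A)"
    using A by (simp add: sum_divide_distrib[symmetric] A_def[symmetric])
  also have "\<dots> = (\<Sum>i\<in>I. w i * (1 + p * (a i / (w i * A) - 1)))"
    unfolding sum_distrib_left sum.distrib[symmetric]
    by (intro sum.cong refl) (use w A in \<open>auto simp: field_simps dest: order_less_imp_not_eq2\<close>)
  also have "\<dots> \<le> (\<Sum>i\<in>I. w i * (a i / (w i * A)) powr p)"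
    using w a A by (intro sum_mono mult_left_mono powr_ge_tangent assms) (auto simp: less_imp_le)
  also have "\<dots> = (\<Sum>i\<in>I. w i powr (1 - p) * a i powr p) / A powr p"
    unfolding sum_divide_distrib
  proof (intro sum.cong refl)
    fix i assume i: "i \<in> I"
    have "w i * (a i / (w i * A)) powr p = w i powr 1 * (a i powr p / (w i powr p * A powr p))"
      using w[OF i] a[OF i] A by (simp add: powr_divide powr_mult)
    also have "\<dots> = w i powr (1 - p) * a i powr p / A powr p"
      by (simp add: powr_diff)
    finally show "w i * (a i / (w i * A)) powr p = w i powr (1 - p) * a i powr p / A powr p" .
  qed
  finally show ?thesis using A by (simp add: A_def[symmetric] field_simps)
qed

lemma powr_sum_le:
  fixes a :: "'a \<Rightarrow> real"
  assumes "1 \<le> p" "finite I" "\<And>i. i \<in> I \<Longrightarrow> 0 \<le> a i" "real (card I) \<le> K" "0 < K"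
  shows "(\<Sum>i\<in>I. a i) powr p \<le> K powr (p - 1) * (\<Sum>i\<in>I. a i powr p)"
proof -
  have "(\<Sum>i\<in>I. a i) powr p \<le> (\<Sum>i\<in>I. (1 / K) powr (1 - p) * a i powr p)"
    using assms by (intro powr_sum_le_weighted) auto
  also have "\<dots> = K powr (p - 1) * (\<Sum>i\<in>I. a i powr p)"
    unfolding sum_distrib_left using assms by (intro sum.cong) (auto simp: powr_divide powr_diff)
  finally show ?thesis .
qed

text \<open>The classical localisation properties with constants uniform in the level: height
  2^(j/2), support of length 2^(-j), boundedly many overlaps. They are stated on [0,1] only, the
  basis being described only there.\<close>

definition wavelet_bounds :: "(int \<Rightarrow> nat \<Rightarrow> real \<Rightarrow> real) \<Rightarrow> real \<Rightarrow> real \<Rightarrow> bool" where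
  "wavelet_bounds e K M \<longleftrightarrow> 1 \<le> K \<and> 1 \<le> M \<and> (\<forall>(j, k) \<in> wav_idx. e j k \<in> borel_measurable borel
      \<and> (\<forall>x\<in>{0..1}. \<bar>e j k x\<bar> \<le> M * 2 powr (real_of_int j / 2))
      \<and> (\<exists>z. \<forall>x\<in>{0..1}. e j k x \<noteq> 0 \<longrightarrow> \<bar>x - z\<bar> \<le> M * 2 powr - real_of_int j))
    \<and> (\<forall>j\<ge>-1. \<forall>x\<in>{0..1}. real (card {k. k < nlev j \<and> e j k x \<noteq> 0}) \<le> K)"

lemma cdv_level_abs_le:
  assumes "bounded_compact_gen A g" "\<And>k. bounded_compact_gen A (gL k)" "\<And>k. bounded_compact_gen A (gR k)"
  shows "\<bar>cdv_level S j g gL gR k x\<bar> \<le> 2 powr (real j / 2) * A"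
proof -
  have "\<bar>g y\<bar> \<le> A" "\<bar>gL k y\<bar> \<le> A" "\<bar>gR k y\<bar> \<le> A" for k y
    using assms unfolding bounded_compact_gen_def by blast+
  then show ?thesis
    unfolding cdv_level_def by (simp add: abs_mult)
qed

lemma cdv_level_support:
  assumes "bounded_compact_gen A g" "\<And>k. bounded_compact_gen A (gL k)" "\<And>k. bounded_compact_gen A (gR k)"
    and "0 < A"
  shows "\<exists>z. \<forall>x. cdv_level S j g gL gR k x \<noteq> 0 \<longrightarrow> \<bar>x - z\<bar> \<le> A * 2 powr - real j"
proof -
  define z where "z = (if k < S then 0 else if 2 ^ j - S \<le> k then 1 else real k / 2 ^ j)"
  have "\<bar>x - z\<bar> \<le> A * 2 powr - real j" if "cdv_level S j g gL gR k x \<noteq> 0" for x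
  proof -
    have gen: "\<bar>y\<bar> \<le> A" if "g y \<noteq> 0 \<or> gL k y \<noteq> 0 \<or> gR k y \<noteq> 0" for k y
      using assms(1-3) that unfolding bounded_compact_gen_def by (meson not_le)
    have "2 ^ j * (x - real k / 2 ^ j) = 2 ^ j * x - real k"
      by (simp add: right_diff_distrib)
    then have "\<bar>2 ^ j * (x - z)\<bar> \<le> A"
      using that gen unfolding cdv_level_def z_def by (auto split: if_splits)
    then have "\<bar>x - z\<bar> \<le> A / 2 ^ j"
      by (simp add: abs_mult pos_le_divide_eq mult.commute)
    then show ?thesis
      by (simp add: powr_minus powr_realpow divide_inverse)
  qed
  then show ?thesis by blast
qed

lemma card_near_le:
  fixes y :: real
  assumes "0 \<le> y"
  shows "card {k::nat. \<bar>y - real k\<bar> \<le> real m} \<le> 2 * m + 1" "finite {k::nat. \<bar>y - real k\<bar> \<le> real m}"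
proof -
  let ?k = "nat \<lfloor>y\<rfloor>"
  have sub: "{k::nat. \<bar>y - real k\<bar> \<le> real m} \<subseteq> {?k - m..?k + m}"
  proof
    fix k assume "k \<in> {k::nat. \<bar>y - real k\<bar> \<le> real m}"
    then have "\<bar>y - real k\<bar> \<le> real m" by simp
    then have "real_of_int (int k - int m) \<le> y" "y \<le> real_of_int (int k + int m)" by simp_all
    then have "int k - int m \<le> \<lfloor>y\<rfloor>" "\<lfloor>y\<rfloor> \<le> int k + int m"
      unfolding le_floor_iff floor_le_iff by linarith+
    then show "k \<in> {?k - m..?k + m}" using assms by auto
  qed
  show "finite {k::nat. \<bar>y - real k\<bar> \<le> real m}" using sub by (rule finite_subset) simp
  show "card {k::nat. \<bar>y - real k\<bar> \<le> real m} \<le> 2 * m + 1"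
    using card_mono[OF _ sub] by simp
qed

text \<open>Besides the at most \<open>2 * S\<close> boundary functions, only translates
  \<open>k\<close> within \<open>m\<close> of 2^j x can be nonzero at \<open>x\<close>.\<close>

lemma cdv_level_overlap:
  assumes "bounded_compact_gen A g" "A \<le> real m" "0 \<le> x"
  shows "card {k. k < 2 ^ j \<and> cdv_level S j g gL gR k x \<noteq> 0} \<le> 2 * S + 2 * m + 1"
proof -
  let ?N = "{k::nat. \<bar>2 ^ j * x - real k\<bar> \<le> real m}"
  have "{k. k < 2 ^ j \<and> cdv_level S j g gL gR k x \<noteq> 0} \<subseteq> {..<S} \<union> {2 ^ j - S..<2 ^ j} \<union> ?N"
  proof
    fix k assume k: "k \<in> {k. k < 2 ^ j \<and> cdv_level S j g gL gR k x \<noteq> 0}"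
    show "k \<in> {..<S} \<union> {2 ^ j - S..<2 ^ j} \<union> ?N"
    proof (cases "k < S \<or> 2 ^ j - S \<le> k")
      case True
      then show ?thesis using k by auto
    next
      case False
      then have "g (2 ^ j * x - real k) \<noteq> 0"
        using k by (auto simp: cdv_level_def)
      then have "\<bar>2 ^ j * x - real k\<bar> \<le> A"
        using assms(1) unfolding bounded_compact_gen_def by (meson not_le)
      then show ?thesis using assms(2) by simp
    qed
  qed
  then have "card {k. k < 2 ^ j \<and> cdv_level S j g gL gR k x \<noteq> 0} \<le> card ({..<S} \<union> {2 ^ j - S..<2 ^ j} \<union> ?N)"
    using card_near_le(2)[of "2 ^ j * x" m] assms by (intro card_mono) auto
  also have "\<dots> \<le> card {..<S} + card {2 ^ j - S..<2 ^ j} + card ?N"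
    by (meson add_mono card_Un_le order_refl order_trans)
  also have "\<dots> \<le> S + S + (2 * m + 1)"
    using card_near_le(1)[of "2 ^ j * x" m] assms by (intro add_mono) auto
  finally show ?thesis by simp
qed

text \<open>For j < J the reindexed functions are scaling functions of the fixed level J, so their
  height and support do not match j. Only finitely many levels are concerned, and factors 2^J in
  \<open>K\<close> and \<open>M\<close> absorb the mismatch.\<close>

lemma cdv_wavelet_bounds:
  assumes "cdv_wavelet_basis S phi psi"
  obtains K M where "wavelet_bounds (basis_fn (wavJ S) phi psi) K M"
proof -
  define J where "J = wavJ S"
  define e where "e = basis_fn J phi psi"
  have meas: "e j k \<in> borel_measurable borel" if "(j, k) \<in> wav_idx" for j k
    using assms that unfolding cdv_wavelet_basis_def J_def e_def Let_def by blast
  have "\<exists>A > 0. \<exists>g0 h0 :: real \<Rightarrow> real. \<exists>gL gR hL hR :: nat \<Rightarrow> real \<Rightarrow> real.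
            bounded_compact_gen A g0 \<and> bounded_compact_gen A h0 \<and>
            (\<forall>k. bounded_compact_gen A (gL k) \<and> bounded_compact_gen A (gR k) \<and>
                 bounded_compact_gen A (hL k) \<and> bounded_compact_gen A (hR k)) \<and>
            (\<forall>k < 2 ^ J. \<forall>x \<in> {0..1}. phi k x = cdv_level S J g0 gL gR k x) \<and>
            (\<forall>j \<ge> J. \<forall>k < 2 ^ j. \<forall>x \<in> {0..1}. psi j k x = cdv_level S j h0 hL hR k x)"
    using assms unfolding cdv_wavelet_basis_def J_def[symmetric] Let_def by (elim conjE)
  then obtain A g0 h0 gL gR hL hR where A: "A > 0"
    and gen: "bounded_compact_gen A g0 \<and> bounded_compact_gen A h0 \<and>
            (\<forall>k. bounded_compact_gen A (gL k) \<and> bounded_compact_gen A (gR k) \<and>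
                 bounded_compact_gen A (hL k) \<and> bounded_compact_gen A (hR k))"
    and phi': "\<forall>k < 2 ^ J. \<forall>x \<in> {0..1}. phi k x = cdv_level S J g0 gL gR k x"
    and psi': "\<forall>j \<ge> J. \<forall>k < 2 ^ j. \<forall>x \<in> {0..1}. psi j k x = cdv_level S j h0 hL hR k x"
    by (elim exE conjE) blast
  have g: "bounded_compact_gen A g0" "\<And>k. bounded_compact_gen A (gL k)" "\<And>k. bounded_compact_gen A (gR k)"
    and h: "bounded_compact_gen A h0" "\<And>k. bounded_compact_gen A (hL k)" "\<And>k. bounded_compact_gen A (hR k)"
    using gen by auto
  have phi: "\<And>k x. k < 2 ^ J \<Longrightarrow> x \<in> {0..1} \<Longrightarrow> phi k x = cdv_level S J g0 gL gR k x"
    and psi: "\<And>j k x. j \<ge> J \<Longrightarrow> k < 2 ^ j \<Longrightarrow> x \<in> {0..1} \<Longrightarrow> psi j k x = cdv_level S j h0 hL hR k x"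
    using phi' psi' by blast+
  define m where "m = nat \<lceil>A\<rceil>"
  have m: "A \<le> real m" unfolding m_def by linarith
  define K where "K = real (2 * S + 2 * m + 1) + 2 ^ J"
  \<comment> \<open>2^J covers both the height 2^(J/2) and the support bound 1 against 2^(-j) for j
    < J; the 2 covers j = -1, where 2^(j/2) is below 1.\<close>
  define M where "M = 2 * 2 ^ J * (A + 1)"
  have low: "\<exists>k'<2 ^ J. e j k = phi k'" if "j \<ge> -1" "k < nlev j" "j < int J" for j k
  proof (cases "j < 0")
    case True
    then show ?thesis by (intro exI[of _ 0]) (auto simp: e_def basis_fn_def)
  next
    case False
    have "2 ^ nat j + k < 2 ^ Suc (nat j)" using that False by (simp add: nlev_def)
    also have "(2::nat) ^ Suc (nat j) \<le> 2 ^ J" using that False by (intro power_increasing) auto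
    finally show ?thesis using that False by (intro exI[of _ "2 ^ nat j + k"]) (auto simp: e_def basis_fn_def)
  qed
  have high: "e j k = psi (nat j) k" "k < 2 ^ nat j" "nat j \<ge> J" "real_of_int j = real (nat j)"
    if "k < nlev j" "\<not> j < int J" for j k
    using that by (auto simp: e_def basis_fn_def nlev_def)
  have "1 \<le> K" unfolding K_def by simp
  have J1: "(1::real) \<le> 2 ^ J" by simp
  have AM: "A \<le> M" "2 ^ J \<le> M" "1 \<le> M"
  proof -
    define P where "P = 2 ^ J * (A + 1)"
    have "1 * (A + 1) \<le> P" "2 ^ J * 1 \<le> P"
      unfolding P_def using A J1 by (intro mult_right_mono mult_left_mono; simp)+
    moreover have "M = 2 * P" by (simp add: M_def P_def)
    ultimately have "A \<le> M" "2 ^ J \<le> M" "1 \<le> M" using A by auto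
    then show "A \<le> M" "2 ^ J \<le> M" "1 \<le> M" by auto
  qed
  have main: "(\<forall>x\<in>{0..1}. \<bar>e j k x\<bar> \<le> M * 2 powr (real_of_int j / 2))
      \<and> (\<exists>z. \<forall>x\<in>{0..1}. e j k x \<noteq> 0 \<longrightarrow> \<bar>x - z\<bar> \<le> M * 2 powr - real_of_int j)"
    if jk: "j \<ge> -1" "k < nlev j" for j k
  proof (cases "j < int J")
    case True
    then obtain k' where k': "k' < 2 ^ J" "e j k = phi k'" using low jk by blast
    have "\<bar>e j k x\<bar> \<le> M * 2 powr (real_of_int j / 2)" if "x \<in> {0..1}" for x
    proof -
      have "\<bar>e j k x\<bar> \<le> 2 powr (real J / 2) * A"
        unfolding k'(2) phi[OF k'(1) that] using g by (intro cdv_level_abs_le)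
      also have "\<dots> \<le> 2 powr real J * A"
        using A by (intro mult_right_mono powr_mono) auto
      also have "\<dots> \<le> M * (1/2)"
        using A by (simp add: M_def powr_realpow)
      also have "(1/2::real) = 2 powr (-1)" by (simp add: powr_minus)
      also have "M * 2 powr (-1) \<le> M * 2 powr (real_of_int j / 2)"
        using AM jk by (intro mult_left_mono powr_mono) auto
      finally show ?thesis .
    qed
    moreover have "\<bar>x - 0\<bar> \<le> M * 2 powr - real_of_int j" if "x \<in> {0..1}" for x
    proof -
      have "1 = 2 ^ J * 2 powr - real J" by (simp add: powr_minus powr_realpow)
      also have "\<dots> \<le> M * 2 powr - real_of_int j"
        using AM True by (intro mult_mono powr_mono) auto
      finally show ?thesis using that by auto
    qed
    ultimately show ?thesis by blast
  next
    case False
    note H = high[OF jk(2) False]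
    have "\<bar>e j k x\<bar> \<le> M * 2 powr (real_of_int j / 2)" if "x \<in> {0..1}" for x
    proof -
      have "\<bar>e j k x\<bar> \<le> 2 powr (real (nat j) / 2) * A"
        unfolding H(1) psi[OF H(3,2) that] using h by (intro cdv_level_abs_le)
      also have "\<dots> \<le> 2 powr (real (nat j) / 2) * M"
        using AM by (intro mult_left_mono) auto
      finally show ?thesis by (simp add: H(4) mult.commute)
    qed
    moreover obtain z where z: "\<And>x. cdv_level S (nat j) h0 hL hR k x \<noteq> 0 \<Longrightarrow> \<bar>x - z\<bar> \<le> A * 2 powr - real (nat j)"
      using cdv_level_support[where S = S and j = "nat j" and k = k and gL = hL and gR = hR, OF h A] by blast
    have "\<bar>x - z\<bar> \<le> M * 2 powr - real_of_int j" if "x \<in> {0..1}" "e j k x \<noteq> 0" for x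
    proof -
      have "\<bar>x - z\<bar> \<le> A * 2 powr - real (nat j)"
        using that psi[OF H(3,2) that(1)] unfolding H(1) by (intro z) simp
      also have "\<dots> \<le> M * 2 powr - real (nat j)"
        using AM by (intro mult_right_mono) auto
      finally show ?thesis by (simp add: H(4))
    qed
    ultimately show ?thesis by blast
  qed
  have over: "real (card {k. k < nlev j \<and> e j k x \<noteq> 0}) \<le> K" if j: "j \<ge> -1" and x: "x \<in> {0..1}" for j x
  proof (cases "j < int J")
    case True
    have "card {k. k < nlev j \<and> e j k x \<noteq> 0} \<le> card {..<nlev j}"
      by (intro card_mono) auto
    also have "\<dots> \<le> 2 ^ J"
      using True by (auto simp: nlev_def intro!: power_increasing)
    finally have "real (card {k. k < nlev j \<and> e j k x \<noteq> 0}) \<le> real (2 ^ J)" by (rule of_nat_mono)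
    also have "\<dots> \<le> K" by (simp add: K_def)
    finally show ?thesis .
  next
    case False
    have "{k. k < nlev j \<and> e j k x \<noteq> 0} = {k. k < 2 ^ nat j \<and> cdv_level S (nat j) h0 hL hR k x \<noteq> 0}"
    proof -
      have "k < nlev j \<longleftrightarrow> k < 2 ^ nat j" for k
        using False by (simp add: nlev_def)
      moreover have "e j k x = cdv_level S (nat j) h0 hL hR k x" if "k < nlev j" for k
        using high(1)[OF that False] psi[OF high(3)[OF that False] high(2)[OF that False] x] by simp
      ultimately show ?thesis by auto
    qed
    then have "card {k. k < nlev j \<and> e j k x \<noteq> 0} \<le> 2 * S + 2 * m + 1"
      using cdv_level_overlap[OF h(1) m, of x "nat j" S hL hR] x by (metis atLeastAtMost_iff)
    then have "real (card {k. k < nlev j \<and> e j k x \<noteq> 0}) \<le> real (2 * S + 2 * m + 1)" by (rule of_nat_mono)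
    also have "\<dots> \<le> K" by (simp add: K_def)
    finally show ?thesis .
  qed
  have "wavelet_bounds e K M"
    unfolding wavelet_bounds_def using \<open>1 \<le> K\<close> AM main over meas by (auto simp: wav_idx_def)
  then show ?thesis using that unfolding e_def J_def by blast
qed

text \<open>Bounded overlap allows the power to be moved inside the sum at the price K^(p-1); each
  wavelet then contributes height^p times support length, that is 2^(jp/2 - j). The constant is
  K^(p-1) * 2 * M^(p+1) rounded up to a p-th power.\<close>

lemma wavelet_level_Lp_le:
  assumes wb: "wavelet_bounds e K M" and p: "1 \<le> p" and j: "j \<ge> -1"
  shows "(\<integral>\<^sup>+ x \<in> {0..1}. ennreal (\<bar>\<Sum>k<nlev j. c k * e j k x\<bar> powr p) \<partial>lborel)
    \<le> ennreal ((2 * K * M\<^sup>2) powr p * 2 powr (real_of_int j * (p / 2 - 1)) * (\<Sum>k<nlev j. \<bar>c k\<bar> powr p))"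
proof -
  have K: "1 \<le> K" and M: "1 \<le> M"
    and over: "\<And>x. x \<in> {0..1} \<Longrightarrow> real (card {k. k < nlev j \<and> e j k x \<noteq> 0}) \<le> K"
    using wb j unfolding wavelet_bounds_def by auto
  have wbk: "e j k \<in> borel_measurable borel" "\<And>x. x \<in> {0..1} \<Longrightarrow> \<bar>e j k x\<bar> \<le> M * 2 powr (real_of_int j / 2)"
    "\<exists>z. \<forall>x\<in>{0..1}. e j k x \<noteq> 0 \<longrightarrow> \<bar>x - z\<bar> \<le> M * 2 powr - real_of_int j" if "k < nlev j" for k
    using wb j that unfolding wavelet_bounds_def by (auto simp: wav_idx_def)
  let ?B = "M * 2 powr (real_of_int j / 2)" and ?w = "M * 2 powr - real_of_int j"
  have point: "\<bar>\<Sum>k<nlev j. c k * e j k x\<bar> powr p \<le> K powr (p - 1) * (\<Sum>k<nlev j. \<bar>c k\<bar> powr p * \<bar>e j k x\<bar> powr p)"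
    if x: "x \<in> {0..1}" for x
  proof -
    let ?I = "{k. k < nlev j \<and> e j k x \<noteq> 0}"
    have "(\<Sum>k<nlev j. c k * e j k x) = (\<Sum>k\<in>?I. c k * e j k x)"
      by (intro sum.mono_neutral_right) auto
    then have "\<bar>\<Sum>k<nlev j. c k * e j k x\<bar> powr p \<le> (\<Sum>k\<in>?I. \<bar>c k * e j k x\<bar>) powr p"
      using p by (intro powr_mono2) auto
    also have "\<dots> \<le> K powr (p - 1) * (\<Sum>k\<in>?I. \<bar>c k * e j k x\<bar> powr p)"
      using p K over[OF x] by (intro powr_sum_le) auto
    also have "(\<Sum>k\<in>?I. \<bar>c k * e j k x\<bar> powr p) = (\<Sum>k<nlev j. \<bar>c k * e j k x\<bar> powr p)"
      using p by (intro sum.mono_neutral_left) auto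
    finally show ?thesis by (simp add: abs_mult powr_mult)
  qed
  have int: "(\<integral>\<^sup>+ x \<in> {0..1}. ennreal (\<bar>e j k x\<bar> powr p) \<partial>lborel) \<le> ennreal (?B powr p * (2 * ?w))"
    if k: "k < nlev j" for k
  proof -
    obtain z where z: "\<And>x. x \<in> {0..1} \<Longrightarrow> e j k x \<noteq> 0 \<Longrightarrow> \<bar>x - z\<bar> \<le> ?w" using wbk(3)[OF k] by blast
    have "(\<integral>\<^sup>+ x \<in> {0..1}. ennreal (\<bar>e j k x\<bar> powr p) \<partial>lborel)
        \<le> (\<integral>\<^sup>+ x. ennreal (?B powr p) * indicator {z - ?w..z + ?w} x \<partial>lborel)"
    proof (intro nn_integral_mono)
      fix x :: real
      show "ennreal (\<bar>e j k x\<bar> powr p) * indicator {0..1} x \<le> ennreal (?B powr p) * indicator {z - ?w..z + ?w} x"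
      proof (cases "x \<in> {0..1} \<and> e j k x \<noteq> 0")
        case True
        then have "\<bar>x - z\<bar> \<le> ?w" using z by blast
        then have "x \<in> {z - ?w..z + ?w}" unfolding atLeastAtMost_iff by linarith
        then show ?thesis
          using True wbk(2)[OF k, of x] p by (auto intro!: ennreal_leI powr_mono2)
      qed (use p in \<open>auto split: split_indicator\<close>)
    qed
    also have "\<dots> = ennreal (?B powr p * (2 * ?w))"
      using M by (simp add: nn_integral_cmult_indicator ennreal_mult[symmetric])
    finally show ?thesis .
  qed
  have "(\<integral>\<^sup>+ x \<in> {0..1}. ennreal (\<bar>\<Sum>k<nlev j. c k * e j k x\<bar> powr p) \<partial>lborel)
      \<le> (\<integral>\<^sup>+ x. ennreal (K powr (p - 1)) * (\<Sum>k<nlev j. ennreal (\<bar>c k\<bar> powr p)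
            * (ennreal (\<bar>e j k x\<bar> powr p) * indicator {0..1} x)) \<partial>lborel)"
  proof (intro nn_integral_mono)
    fix x :: real
    show "ennreal (\<bar>\<Sum>k<nlev j. c k * e j k x\<bar> powr p) * indicator {0..1} x
      \<le> ennreal (K powr (p - 1)) * (\<Sum>k<nlev j. ennreal (\<bar>c k\<bar> powr p) * (ennreal (\<bar>e j k x\<bar> powr p) * indicator {0..1} x))"
      using point[of x] by (cases "x \<in> {0..1}") (simp_all add: ennreal_mult[symmetric] sum_ennreal ennreal_leI sum_nonneg)
  qed
  also have "\<dots> = ennreal (K powr (p - 1)) * (\<Sum>k<nlev j. ennreal (\<bar>c k\<bar> powr p)
            * (\<integral>\<^sup>+ x \<in> {0..1}. ennreal (\<bar>e j k x\<bar> powr p) \<partial>lborel))"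
  proof -
    have m: "(\<lambda>x. ennreal (\<bar>e j k x\<bar> powr p) * indicator {0..1} x) \<in> borel_measurable lborel" if "k < nlev j" for k
    proof -
      note [measurable] = wbk(1)[OF that]
      show ?thesis by measurable
    qed
    have "(\<integral>\<^sup>+ x. (\<Sum>k<nlev j. ennreal (\<bar>c k\<bar> powr p) * (ennreal (\<bar>e j k x\<bar> powr p) * indicator {0..1} x)) \<partial>lborel)
        = (\<Sum>k<nlev j. \<integral>\<^sup>+ x. ennreal (\<bar>c k\<bar> powr p) * (ennreal (\<bar>e j k x\<bar> powr p) * indicator {0..1} x) \<partial>lborel)"
      by (intro nn_integral_sum borel_measurable_times_ennreal borel_measurable_const m) auto
    also have "\<dots> = (\<Sum>k<nlev j. ennreal (\<bar>c k\<bar> powr p) * (\<integral>\<^sup>+ x \<in> {0..1}. ennreal (\<bar>e j k x\<bar> powr p) \<partial>lborel))"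
      by (intro sum.cong refl nn_integral_cmult m) auto
    finally have "(\<integral>\<^sup>+ x. (\<Sum>k<nlev j. ennreal (\<bar>c k\<bar> powr p) * (ennreal (\<bar>e j k x\<bar> powr p) * indicator {0..1} x)) \<partial>lborel)
        = (\<Sum>k<nlev j. ennreal (\<bar>c k\<bar> powr p) * (\<integral>\<^sup>+ x \<in> {0..1}. ennreal (\<bar>e j k x\<bar> powr p) \<partial>lborel))" .
    moreover have "(\<integral>\<^sup>+ x. ennreal (K powr (p - 1)) * (\<Sum>k<nlev j. ennreal (\<bar>c k\<bar> powr p)
            * (ennreal (\<bar>e j k x\<bar> powr p) * indicator {0..1} x)) \<partial>lborel)
        = ennreal (K powr (p - 1)) * (\<integral>\<^sup>+ x. (\<Sum>k<nlev j. ennreal (\<bar>c k\<bar> powr p) * (ennreal (\<bar>e j k x\<bar> powr p) * indicator {0..1} x)) \<partial>lborel)"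
      by (intro nn_integral_cmult borel_measurable_sum borel_measurable_times_ennreal borel_measurable_const m) auto
    ultimately show ?thesis by simp
  qed
  also have "\<dots> \<le> ennreal (K powr (p - 1)) * (\<Sum>k<nlev j. ennreal (\<bar>c k\<bar> powr p) * ennreal (?B powr p * (2 * ?w)))"
    using int by (intro mult_left_mono sum_mono) auto
  also have "\<dots> = ennreal ((K powr (p - 1) * (?B powr p * (2 * ?w))) * (\<Sum>k<nlev j. \<bar>c k\<bar> powr p))"
  proof -
    define D where "D = ?B powr p * (2 * ?w)"
    have "0 \<le> D" using M by (simp add: D_def)
    have "(\<Sum>k<nlev j. ennreal (\<bar>c k\<bar> powr p) * ennreal D) = ennreal ((\<Sum>k<nlev j. \<bar>c k\<bar> powr p) * D)"
      using \<open>0 \<le> D\<close> by (simp add: ennreal_mult[symmetric] sum_ennreal sum_distrib_right)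
    then show ?thesis
      unfolding D_def[symmetric] using \<open>0 \<le> D\<close>
      by (simp add: ennreal_mult[symmetric] sum_nonneg mult.assoc mult.commute[of D])
  qed
  also have "\<dots> \<le> ennreal (((2 * K * M\<^sup>2) powr p * 2 powr (real_of_int j * (p / 2 - 1))) * (\<Sum>k<nlev j. \<bar>c k\<bar> powr p))"
  proof (intro ennreal_leI mult_right_mono sum_nonneg)
    have "K powr (p - 1) * (?B powr p * (2 * ?w))
        = (K powr (p - 1) * 2 * (M powr p * M)) * (2 powr (real_of_int j * p / 2) * 2 powr - real_of_int j)"
      using M by (simp add: powr_mult powr_powr)
    also have "\<dots> = (K powr (p - 1) * 2 powr 1 * (M powr p * M powr 1)) * 2 powr (real_of_int j * (p / 2 - 1))"
      using M by (simp add: powr_add[symmetric] algebra_simps)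
    also have "\<dots> \<le> (K powr p * 2 powr p * (M powr p * M powr p)) * 2 powr (real_of_int j * (p / 2 - 1))"
      using K M p by (intro mult_right_mono mult_mono powr_mono) auto
    also have "\<dots> = (2 * K * M\<^sup>2) powr p * 2 powr (real_of_int j * (p / 2 - 1))"
      using K M by (simp add: powr_mult power2_eq_square)
    finally show "K powr (p - 1) * (?B powr p * (2 * ?w)) \<le> (2 * K * M\<^sup>2) powr p * 2 powr (real_of_int j * (p / 2 - 1))" .
  qed auto
  finally show ?thesis .
qed

text \<open>The level norm of the Besov space with smoothness 0: its sum over the levels is the
  B^0_{p1} norm, which controls the L_p norm.\<close>

definition lvl_bound :: "real \<Rightarrow> (int \<times> nat \<Rightarrow> real) \<Rightarrow> nat \<Rightarrow> real" where
  "lvl_bound p c l = 2 powr (real_of_int (int l - 1) * (1/2 - 1/p))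
     * (\<Sum>k<nlev (int l - 1). \<bar>c (int l - 1, k)\<bar> powr p) powr (1/p)"

text \<open>Minkowski's inequality over the levels, via Jensen with weights \<open>b l / B\<close>. Where the series
  diverges, the dominating sum is infinite, so the value chosen by \<open>suminf\<close> there is irrelevant.\<close>
lemma Lp_norm_wav_fun_le:
  assumes wb: "wavelet_bounds e K M" and p: "1 \<le> p"
    and b: "\<And>l. 0 < b l" "\<And>l. lvl_bound p c l \<le> b l" "summable b" "suminf b \<le> B"
  shows "Lp_norm p (wav_fun e c) \<le> ennreal (2 * K * M\<^sup>2 * B)"
proof -
  define C where "C = 2 * K * M\<^sup>2"
  have C: "0 < C" using wb by (simp add: C_def wavelet_bounds_def)
  have B: "0 < B" using suminf_pos[OF b(3,1)] b(4) by linarith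
  \<comment> \<open>The majorant \<open>b\<close> is used in place of \<open>lvl_bound\<close>
    itself since Jensen weights must be positive, whereas a level may vanish.\<close>
  define w where "w l = b l / B" for l
  have w: "0 < w l" for l using b(1) B by (simp add: w_def)
  have wsum: "summable w" "suminf w \<le> 1"
    using b(3,4) B unfolding w_def by (auto simp: suminf_divide intro: summable_divide)
  define g where "g l x = (\<Sum>k<nlev (int l - 1). c (int l - 1, k) * e (int l - 1) k x)" for l x
  have [measurable]: "g l \<in> borel_measurable borel" for l
    unfolding g_def using wb
    by (intro borel_measurable_sum borel_measurable_times borel_measurable_const) (auto simp: wavelet_bounds_def wav_idx_def)
  have fun_eq: "wav_fun e c x = (\<Sum>l. g l x)" for x
    by (simp add: wav_fun_def lvl_sum_def g_def)
  have lev: "(\<integral>\<^sup>+ x \<in> {0..1}. ennreal (\<bar>g l x\<bar> powr p) \<partial>lborel) \<le> ennreal ((C * b l) powr p)" for l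
  proof -
    have "(\<integral>\<^sup>+ x \<in> {0..1}. ennreal (\<bar>g l x\<bar> powr p) \<partial>lborel)
      \<le> ennreal (C powr p * 2 powr (real_of_int (int l - 1) * (p / 2 - 1)) * (\<Sum>k<nlev (int l - 1). \<bar>c (int l - 1, k)\<bar> powr p))"
      unfolding g_def C_def by (intro wavelet_level_Lp_le wb p) simp
    also have "C powr p * 2 powr (real_of_int (int l - 1) * (p / 2 - 1)) * (\<Sum>k<nlev (int l - 1). \<bar>c (int l - 1, k)\<bar> powr p)
        = C powr p * (lvl_bound p c l) powr p"
      unfolding lvl_bound_def using p by (simp add: powr_mult powr_powr sum_nonneg algebra_simps)
    also have "\<dots> \<le> C powr p * b l powr p"
      using b p by (intro mult_left_mono powr_mono2) (auto simp: lvl_bound_def)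
    finally show ?thesis using C b(1)[of l] by (simp add: powr_mult less_imp_le ennreal_leI)
  qed
  have point: "ennreal (\<bar>wav_fun e c x\<bar> powr p) \<le> (\<Sum>l. ennreal (w l powr (1 - p) * \<bar>g l x\<bar> powr p))" for x
  proof (cases "(\<Sum>l. ennreal (w l powr (1 - p) * \<bar>g l x\<bar> powr p)) = top")
    case False
    let ?u = "\<lambda>l. w l powr (1 - p) * \<bar>g l x\<bar> powr p"
    have su: "summable ?u" using False by (intro summable_suminf_not_top) auto
    have part: "(\<Sum>l<N. \<bar>g l x\<bar>) \<le> suminf ?u powr (1/p)" for N
    proof -
      have "(\<Sum>l<N. w l) \<le> 1"
        using sum_le_suminf[OF wsum(1), of "{..<N}"] wsum(2) w by (simp add: less_imp_le)
      then have "(\<Sum>l<N. \<bar>g l x\<bar>) powr p \<le> (\<Sum>l<N. ?u l)"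
        using w by (intro powr_sum_le_weighted p) auto
      also have "\<dots> \<le> suminf ?u" using su by (intro sum_le_suminf) auto
      finally have "((\<Sum>l<N. \<bar>g l x\<bar>) powr p) powr (1/p) \<le> suminf ?u powr (1/p)"
        using p by (intro powr_mono2) auto
      then show ?thesis using p by (simp add: powr_powr sum_nonneg)
    qed
    have sg: "summable (\<lambda>l. \<bar>g l x\<bar>)"
      by (rule summableI_nonneg_bounded[OF _ part]) simp
    have "\<bar>wav_fun e c x\<bar> \<le> (\<Sum>l. \<bar>g l x\<bar>)"
      unfolding fun_eq using summable_rabs[OF sg] .
    also have "\<dots> \<le> suminf ?u powr (1/p)"
      using part by (intro suminf_le_const sg)
    finally have "\<bar>wav_fun e c x\<bar> powr p \<le> (suminf ?u powr (1/p)) powr p"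
      using p by (intro powr_mono2) auto
    also have "\<dots> = suminf ?u" using p su by (simp add: powr_powr suminf_nonneg)
    finally show ?thesis using su by (simp add: suminf_ennreal2 ennreal_leI)
  qed simp
  have "(\<integral>\<^sup>+ x \<in> {0..1}. ennreal (\<bar>wav_fun e c x\<bar> powr p) \<partial>lborel)
      \<le> (\<integral>\<^sup>+ x. (\<Sum>l. ennreal (w l powr (1 - p)) * (ennreal (\<bar>g l x\<bar> powr p) * indicator {0..1} x)) \<partial>lborel)"
    using point by (intro nn_integral_mono) (auto simp: ennreal_mult split: split_indicator)
  also have "\<dots> = (\<Sum>l. ennreal (w l powr (1 - p)) * (\<integral>\<^sup>+ x \<in> {0..1}. ennreal (\<bar>g l x\<bar> powr p) \<partial>lborel))"
    by (subst nn_integral_suminf) (auto simp: nn_integral_cmult)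
  also have "\<dots> \<le> (\<Sum>l. ennreal (w l powr (1 - p)) * ennreal ((C * b l) powr p))"
    using lev by (intro suminf_le mult_left_mono) auto
  also have "\<dots> = (\<Sum>l. ennreal ((C * B) powr p * w l))"
  proof (intro suminf_cong)
    fix l
    have "(C * b l) powr p = (C * B) powr p * w l powr p"
      using C B b(1)[of l] by (simp add: w_def powr_mult powr_divide)
    then have "w l powr (1 - p) * (C * b l) powr p = (C * B) powr p * (w l powr (1 - p) * w l powr p)"
      by simp
    also have "w l powr (1 - p) * w l powr p = w l"
      using w[of l] by (simp add: powr_add[symmetric])
    finally show "ennreal (w l powr (1 - p)) * ennreal ((C * b l) powr p) = ennreal ((C * B) powr p * w l)"
      by (simp add: ennreal_mult[symmetric])
  qed
  also have "\<dots> = ennreal ((C * B) powr p * suminf w)"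
    using wsum w by (simp add: suminf_ennreal2 less_imp_le summable_mult suminf_mult)
  also have "\<dots> \<le> ennreal ((C * B) powr p)"
    using wsum by (intro ennreal_leI) (simp add: mult_left_le)
  finally have I: "(\<integral>\<^sup>+ x \<in> {0..1}. ennreal (\<bar>wav_fun e c x\<bar> powr p) \<partial>lborel) \<le> ennreal ((C * B) powr p)" .
  then have "enn2real (\<integral>\<^sup>+ x \<in> {0..1}. ennreal (\<bar>wav_fun e c x\<bar> powr p) \<partial>lborel) \<le> (C * B) powr p"
    by (intro enn2real_leI) auto
  then have "enn2real (\<integral>\<^sup>+ x \<in> {0..1}. ennreal (\<bar>wav_fun e c x\<bar> powr p) \<partial>lborel) powr (1/p) \<le> ((C * B) powr p) powr (1/p)"
    using p by (intro powr_mono2) auto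
  also have "\<dots> = C * B" using C B p by (simp add: powr_powr)
  finally show ?thesis
    unfolding Lp_norm_def Let_def C_def[symmetric] using I by (auto intro!: ennreal_leI simp: top_unique)
qed


section \<open>Besov balls\<close>

text \<open>The embedding of l_Q into l_p with norm 1: no entry exceeds the l_Q norm, so
  \<open>p - Q\<close> of the \<open>p\<close> powers of each entry can be replaced by powers of
  that norm.\<close>

lemma sum_powr_le_powr_sum:
  fixes \<theta> :: "'a \<Rightarrow> real"
  assumes "0 < Q" "Q \<le> p" "finite I" and \<theta>: "\<And>i. i \<in> I \<Longrightarrow> 0 \<le> \<theta> i"
  shows "(\<Sum>i\<in>I. \<theta> i powr p) powr (1/p) \<le> (\<Sum>i\<in>I. \<theta> i powr Q) powr (1/Q)"
proof -
  define T where "T = (\<Sum>i\<in>I. \<theta> i powr Q)"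
  have T: "0 \<le> T" by (simp add: T_def sum_nonneg)
  have le: "\<theta> i powr p \<le> T powr ((p - Q) / Q) * \<theta> i powr Q" if i: "i \<in> I" for i
  proof -
    have "\<theta> i powr Q \<le> T"
      unfolding T_def using assms i by (intro member_le_sum) auto
    then have "(\<theta> i powr Q) powr ((p - Q) / Q) \<le> T powr ((p - Q) / Q)"
      using assms by (intro powr_mono2) auto
    then have "\<theta> i powr (p - Q) * \<theta> i powr Q \<le> T powr ((p - Q) / Q) * \<theta> i powr Q"
      using assms by (intro mult_right_mono) (auto simp: powr_powr)
    then show ?thesis by (simp add: powr_add[symmetric])
  qed
  have "(\<Sum>i\<in>I. \<theta> i powr p) \<le> T powr ((p - Q) / Q) * T"
    unfolding T_def[symmetric] sum_distrib_left[symmetric]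
    using le by (subst (2) T_def) (simp add: sum_distrib_left sum_mono)
  also have "\<dots> = T powr (p / Q)"
  proof (cases "T = 0")
    case False
    then have "T powr ((p - Q) / Q) * T powr 1 = T powr ((p - Q) / Q + 1)" by (simp add: powr_add)
    then show ?thesis using False T assms by (simp add: diff_divide_distrib)
  qed simp
  finally have "(\<Sum>i\<in>I. \<theta> i powr p) powr (1/p) \<le> (T powr (p / Q)) powr (1/p)"
    using assms by (intro powr_mono2) (auto intro: sum_nonneg)
  then show ?thesis using assms by (simp add: powr_powr T_def)
qed

text \<open>The sparsity bound: few entries can exceed \<open>\<nu>\<close>. Of the \<open>p\<close>
  powers of the minimum, \<open>p - Q\<close> are bounded by \<open>\<nu>\<close> and the other
  \<open>Q\<close> by the entry.\<close>

lemma sum_min_powr_le: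
  fixes \<theta> :: "'a \<Rightarrow> real"
  assumes "0 < Q" "Q \<le> p" "0 < \<nu>" and \<theta>: "\<And>i. i \<in> I \<Longrightarrow> 0 \<le> \<theta> i"
  shows "(\<Sum>i\<in>I. min (\<theta> i) \<nu> powr p) \<le> \<nu> powr (p - Q) * (\<Sum>i\<in>I. \<theta> i powr Q)"
  unfolding sum_distrib_left
proof (intro sum_mono)
  fix i assume i: "i \<in> I"
  have "min (\<theta> i) \<nu> powr p = min (\<theta> i) \<nu> powr (p - Q) * min (\<theta> i) \<nu> powr Q"
    by (simp add: powr_add[symmetric])
  also have "\<dots> \<le> \<nu> powr (p - Q) * \<theta> i powr Q"
    using assms i by (intro mult_mono powr_mono2) auto
  finally show "min (\<theta> i) \<nu> powr p \<le> \<nu> powr (p - Q) * \<theta> i powr Q" .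
qed

lemma sum_powr_norm_le:
  fixes \<theta> :: "'a \<Rightarrow> real"
  assumes "0 < Q" "Q \<le> p" "finite I" "I \<noteq> {}" and \<theta>: "\<And>i. i \<in> I \<Longrightarrow> 0 \<le> \<theta> i"
  shows "(\<Sum>i\<in>I. \<theta> i powr Q) powr (1/Q) \<le> real (card I) powr (1/Q - 1/p) * (\<Sum>i\<in>I. \<theta> i powr p) powr (1/p)"
proof -
  have c: "0 < real (card I)" using assms by (simp add: card_gt_0_iff)
  have "(\<Sum>i\<in>I. \<theta> i powr Q) powr (p / Q) \<le> real (card I) powr (p / Q - 1) * (\<Sum>i\<in>I. (\<theta> i powr Q) powr (p / Q))"
    using assms c by (intro powr_sum_le) auto
  then have "((\<Sum>i\<in>I. \<theta> i powr Q) powr (p / Q)) powr (1/p)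
      \<le> (real (card I) powr (p / Q - 1) * (\<Sum>i\<in>I. \<theta> i powr p)) powr (1/p)"
    using assms by (intro powr_mono2) (auto simp: powr_powr)
  also have "\<dots> = real (card I) powr ((p / Q - 1) * (1/p)) * (\<Sum>i\<in>I. \<theta> i powr p) powr (1/p)"
    by (simp add: powr_mult powr_powr sum_nonneg)
  also have "(p / Q - 1) * (1/p) = 1/Q - 1/p"
    using assms by (simp add: field_simps)
  finally show ?thesis using assms by (simp add: powr_powr)
qed

text \<open>A weighted geometric mean of two bounds; \<open>a\<close> says that the level-dependent
  powers of 2 cancel. Since \<open>C\<close> is at least 1, exponents up to 1 keep the constant at
  \<open>C\<close>.\<close>

lemma interpolate_bounds:
  fixes M C \<nu> :: real
  assumes "0 \<le> M" "1 \<le> C" "0 < \<nu>" "0 \<le> t" "t \<le> 1"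
    and 1: "M \<le> C powr c1 * (2 powr a1 * \<nu> powr b1)" and 2: "M \<le> C powr c2 * (2 powr a2 * \<nu> powr b2)"
    and c: "c1 \<le> 1" "c2 \<le> 1" and a: "t * a1 + (1 - t) * a2 = 0" and b: "t * b1 + (1 - t) * b2 = b"
  shows "M \<le> C * \<nu> powr b"
proof (cases "M = 0")
  case False
  then have M: "0 < M" using assms by simp
  have "M = M powr t * M powr (1 - t)"
    using M by (simp add: powr_add[symmetric])
  also have "\<dots> \<le> (C powr c1 * (2 powr a1 * \<nu> powr b1)) powr t * (C powr c2 * (2 powr a2 * \<nu> powr b2)) powr (1 - t)"
    using assms by (intro mult_mono powr_mono2) auto
  also have "\<dots> = C powr (t * c1 + (1 - t) * c2) * (2 powr (t * a1 + (1 - t) * a2) * \<nu> powr (t * b1 + (1 - t) * b2))"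
    by (simp add: powr_mult powr_powr powr_add mult.commute mult.left_commute)
  also have "\<dots> \<le> C powr 1 * (2 powr (t * a1 + (1 - t) * a2) * \<nu> powr (t * b1 + (1 - t) * b2))"
    using assms by (intro mult_right_mono powr_mono convex_bound_le) auto
  finally show ?thesis using assms by simp
qed (use assms in simp)

text \<open>The two regimes of the rate come from interpolating between different pairs of the three bounds
  below: the trivial bound by \<open>\<nu>\<close>, the sparsity bound, and the smoothness bound.\<close>
lemma truncated_norm_le:
  fixes \<theta> :: "'a \<Rightarrow> real"
  assumes Q: "1 \<le> Q" "Q \<le> p" and s: "0 < s" "0 < s - 1/Q + 1/p" and C: "1 \<le> C" and x: "0 \<le> x" and \<nu>: "0 < \<nu>"
    and I: "finite I" "real (card I) \<le> 2 powr x" and \<theta>: "\<And>i. i \<in> I \<Longrightarrow> 0 \<le> \<theta> i"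
    and bes: "(\<Sum>i\<in>I. \<theta> i powr Q) powr (1/Q) \<le> C * 2 powr (- (x * (s + 1/2 - 1/Q)))"
  shows "2 powr (x * (1/2 - 1/p)) * (\<Sum>i\<in>I. min (\<theta> i) \<nu> powr p) powr (1/p)
    \<le> C * \<nu> powr (2 * (if 0 < s * Q - (p - Q) / 2 then s / (1 + 2 * s) else (s - 1/Q + 1/p) / (1 + 2 * (s - 1/Q))))"
    (is "?M \<le> _")
proof -
  define \<eta> where "\<eta> = s * Q - (p - Q) / 2"
  define s' where "s' = s - 1/Q + 1/p"
  have M0: "0 \<le> ?M" by simp
  have m1: "?M \<le> C powr 0 * (2 powr (x / 2) * \<nu> powr 1)"
  proof -
    have "(\<Sum>i\<in>I. min (\<theta> i) \<nu> powr p) \<le> (\<Sum>i\<in>I. \<nu> powr p)"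
      using \<theta> \<nu> Q by (intro sum_mono powr_mono2) auto
    also have "\<dots> \<le> 2 powr x * \<nu> powr p"
      using I by (simp add: mult_right_mono)
    finally have "(\<Sum>i\<in>I. min (\<theta> i) \<nu> powr p) powr (1/p) \<le> (2 powr x * \<nu> powr p) powr (1/p)"
      using Q by (intro powr_mono2) (auto intro: sum_nonneg)
    also have "\<dots> = 2 powr (x / p) * \<nu>"
      using Q \<nu> by (simp add: powr_mult powr_powr)
    finally have "?M \<le> 2 powr (x * (1/2 - 1/p)) * (2 powr (x / p) * \<nu>)"
      by (rule mult_left_mono) simp
    also have "\<dots> = 2 powr (x * (1/2 - 1/p) + x / p) * \<nu>"
      by (simp only: powr_add ac_simps)
    also have "x * (1/2 - 1/p) + x / p = x / 2"
      by (simp add: algebra_simps)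
    finally show ?thesis using C \<nu> by simp
  qed
  have m2: "?M \<le> C powr 1 * (2 powr (- (x * s')) * \<nu> powr 0)"
  proof -
    have "(\<Sum>i\<in>I. min (\<theta> i) \<nu> powr p) powr (1/p) \<le> (\<Sum>i\<in>I. \<theta> i powr p) powr (1/p)"
      using \<theta> \<nu> Q by (intro powr_mono2 sum_mono sum_nonneg) auto
    also have "\<dots> \<le> (\<Sum>i\<in>I. \<theta> i powr Q) powr (1/Q)"
      using Q I \<theta> by (intro sum_powr_le_powr_sum) auto
    finally have "(\<Sum>i\<in>I. min (\<theta> i) \<nu> powr p) powr (1/p) \<le> C * 2 powr (- (x * (s + 1/2 - 1/Q)))"
      using bes by (rule order_trans)
    then have "?M \<le> 2 powr (x * (1/2 - 1/p)) * (C * 2 powr (- (x * (s + 1/2 - 1/Q))))"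
      by (rule mult_left_mono) simp
    also have "\<dots> = C * 2 powr (x * (1/2 - 1/p) + - (x * (s + 1/2 - 1/Q)))"
      by (simp only: powr_add ac_simps)
    also have "x * (1/2 - 1/p) + - (x * (s + 1/2 - 1/Q)) = - (x * s')"
      by (simp add: s'_def algebra_simps)
    finally show ?thesis using C \<nu> by simp
  qed
  have m3: "?M \<le> C powr (Q / p) * (2 powr (- (x * \<eta> / p)) * \<nu> powr ((p - Q) / p))"
  proof -
    have "((\<Sum>i\<in>I. \<theta> i powr Q) powr (1/Q)) powr Q \<le> (C * 2 powr (- (x * (s + 1/2 - 1/Q)))) powr Q"
      using Q bes by (intro powr_mono2) auto
    then have "(\<Sum>i\<in>I. \<theta> i powr Q) \<le> C powr Q * 2 powr (- (x * (s + 1/2 - 1/Q)) * Q)"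
      using Q C by (simp add: powr_powr powr_mult sum_nonneg)
    then have "\<nu> powr (p - Q) * (\<Sum>i\<in>I. \<theta> i powr Q) \<le> \<nu> powr (p - Q) * (C powr Q * 2 powr (- (x * (s + 1/2 - 1/Q)) * Q))"
      by (intro mult_left_mono) auto
    moreover have "(\<Sum>i\<in>I. min (\<theta> i) \<nu> powr p) \<le> \<nu> powr (p - Q) * (\<Sum>i\<in>I. \<theta> i powr Q)"
      using Q \<nu> \<theta> by (intro sum_min_powr_le) auto
    ultimately have "(\<Sum>i\<in>I. min (\<theta> i) \<nu> powr p) \<le> \<nu> powr (p - Q) * (C powr Q * 2 powr (- (x * (s + 1/2 - 1/Q)) * Q))"
      by (rule order_trans[rotated])
    then have "(\<Sum>i\<in>I. min (\<theta> i) \<nu> powr p) powr (1/p)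
        \<le> (\<nu> powr (p - Q) * (C powr Q * 2 powr (- (x * (s + 1/2 - 1/Q)) * Q))) powr (1/p)"
      using Q by (intro powr_mono2) (auto intro: sum_nonneg)
    also have "\<dots> = C powr (Q / p) * (2 powr (- (x * (s + 1/2 - 1/Q)) * Q / p) * \<nu> powr ((p - Q) / p))"
      by (simp add: powr_mult powr_powr)
    finally have "?M \<le> 2 powr (x * (1/2 - 1/p)) * (C powr (Q / p) * (2 powr (- (x * (s + 1/2 - 1/Q)) * Q / p) * \<nu> powr ((p - Q) / p)))"
      by (rule mult_left_mono) simp
    also have "\<dots> = C powr (Q / p) * (2 powr (x * (1/2 - 1/p) + - (x * (s + 1/2 - 1/Q)) * Q / p) * \<nu> powr ((p - Q) / p))"
      by (simp only: powr_add ac_simps)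
    also have "x * (1/2 - 1/p) + - (x * (s + 1/2 - 1/Q)) * Q / p = - (x * \<eta> / p)"
      using Q by (simp add: \<eta>_def field_simps)
    finally show ?thesis .
  qed
  show ?thesis
  proof (cases "0 < \<eta>")
    case True
    \<comment> \<open>Here \<open>m1\<close> grows with the level and \<open>m3\<close> decays.
      Cancellation requires t/2 = (1-t) \<eta>/p, hence t = 2\<eta>/(2\<eta> + p), and 2\<eta> + p =
      Q(1 + 2s).\<close>
    define t where "t = 2 * \<eta> / (Q * (1 + 2 * s))"
    have d: "0 < Q * (1 + 2 * s)" using Q s by simp
    have t1: "1 - t = p / (Q * (1 + 2 * s))"
      using d by (simp add: t_def \<eta>_def field_simps)
    have "?M \<le> C * \<nu> powr (2 * (s / (1 + 2 * s)))"
    proof (rule interpolate_bounds[OF M0 C \<nu> _ _ m1 m3])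
      show "0 \<le> t" using True d by (simp add: t_def)
      have "0 \<le> 1 - t" unfolding t1 using d Q by simp
      then show "t \<le> 1" by simp
      show "t * (x / 2) + (1 - t) * (- (x * \<eta> / p)) = 0"
        unfolding t1 using Q by (simp add: t_def)
      have "t * 1 + (1 - t) * ((p - Q) / p) = (2 * \<eta> + (p - Q)) / (Q * (1 + 2 * s))"
        unfolding t1 using Q by (simp add: t_def add_divide_distrib)
      also have "2 * \<eta> + (p - Q) = Q * (2 * s)" by (simp add: \<eta>_def)
      also have "Q * (2 * s) / (Q * (1 + 2 * s)) = 2 * (s / (1 + 2 * s))" using Q by simp
      finally show "t * 1 + (1 - t) * ((p - Q) / p) = 2 * (s / (1 + 2 * s))" .
    qed (use Q in auto)
    then show ?thesis using True by (simp add: \<eta>_def)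
  next
    case False
    define a where "a = s + 1/2 - 1/Q"
    have "0 < s * Q" using s Q by simp
    moreover have "2 * (s * Q) \<le> p - Q" using False by (simp add: \<eta>_def)
    ultimately have pQ: "Q < p" by simp
    then have "1/p < 1/Q" using Q by (simp add: frac_less2)
    moreover have "1/p \<le> 1" using Q by simp
    \<comment> \<open>The right-hand side identifies the denominator of the rate, as 2a = 1 + 2(s -
      1/Q), and yields \<open>0 < a\<close>; \<eta> \<le> 0 has forced Q < p.\<close>
    have sp: "s' - \<eta> / p = a * ((p - Q) / p)"
      using Q by (simp add: s'_def \<eta>_def a_def field_simps)
    have "0 < s' - \<eta> / p" using False s Q by (simp add: s'_def) (smt (verit) divide_nonpos_pos)
    then have a0: "0 < a" unfolding sp using pQ Q by (simp add: zero_less_mult_iff zero_less_divide_iff)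
    \<comment> \<open>Now \<open>m3\<close> no longer decays, so it is balanced against the
      smoothness bound \<open>m2\<close>: t solves t \<eta>/p + (1-t) s' = 0.\<close>
    define t where "t = s' / (s' - \<eta> / p)"
    have t1: "1 - t = (- \<eta> / p) / (s' - \<eta> / p)"
      using \<open>0 < s' - \<eta> / p\<close> by (simp add: t_def field_simps)
    have "?M \<le> C * \<nu> powr (2 * (s' / (1 + 2 * (s - 1/Q))))"
    proof (rule interpolate_bounds[OF M0 C \<nu> _ _ m3 m2])
      show "0 \<le> t" using \<open>0 < s' - \<eta> / p\<close> s by (simp add: t_def s'_def)
      have "0 \<le> - \<eta> / p" using False Q by (intro divide_nonneg_nonneg) auto
      then have "0 \<le> 1 - t" unfolding t1 using \<open>0 < s' - \<eta> / p\<close> by (rule divide_nonneg_pos)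
      then show "t \<le> 1" by simp
      show "t * (- (x * \<eta> / p)) + (1 - t) * (- (x * s')) = 0"
        unfolding t1 by (simp add: t_def)
      have "t * ((p - Q) / p) + (1 - t) * 0 = s' / a"
        unfolding t_def sp using pQ Q by simp
      also have "\<dots> = 2 * (s' / (1 + 2 * (s - 1/Q)))"
      proof -
        have "1 + 2 * (s - 1/Q) = 2 * a" by (simp add: a_def)
        then show ?thesis using a0 by simp
      qed
      finally show "t * ((p - Q) / p) + (1 - t) * 0 = 2 * (s' / (1 + 2 * (s - 1/Q)))" .
    qed (use Q in auto)
    then show ?thesis using False by (simp add: \<eta>_def s'_def)
  qed
qed

lemma lvl_bound_nonneg [simp]: "0 \<le> lvl_bound p c l"
  by (simp add: lvl_bound_def)

lemma lvl_bound_mono: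
  assumes "1 \<le> p" "\<And>k. k < nlev (int l - 1) \<Longrightarrow> \<bar>c (int l - 1, k)\<bar> \<le> \<bar>d (int l - 1, k)\<bar>"
  shows "lvl_bound p c l \<le> lvl_bound p d l"
  unfolding lvl_bound_def using assms
  by (intro mult_left_mono powr_mono2 sum_mono sum_nonneg) auto

lemma lvl_bound_scale:
  assumes "1 \<le> p" "0 \<le> R"
  shows "lvl_bound p (\<lambda>i. R * c i) l = R * lvl_bound p c l"
proof -
  have "(\<Sum>k<nlev (int l - 1). \<bar>R * c (int l - 1, k)\<bar> powr p) = R powr p * (\<Sum>k<nlev (int l - 1). \<bar>c (int l - 1, k)\<bar> powr p)"
    using assms by (simp add: abs_mult powr_mult sum_distrib_left)
  then show ?thesis
    unfolding lvl_bound_def using assms by (simp add: powr_mult powr_powr sum_nonneg)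
qed

lemma lvl_bound_const:
  assumes "1 \<le> p" "0 \<le> t"
  shows "lvl_bound p (\<lambda>_. t) l \<le> 2 * 2 powr (real l / 2) * t"
proof -
  have "(real (nlev (int l - 1)) * t powr p) powr (1/p) \<le> (2 powr real l * t powr p) powr (1/p)"
    using nlev_le_real[of l] assms by (intro powr_mono2 mult_right_mono) (auto simp: powr_realpow)
  also have "\<dots> = 2 powr (real l / p) * t"
    using assms by (simp add: powr_mult powr_powr)
  finally have "lvl_bound p (\<lambda>_. t) l \<le> 2 powr (real_of_int (int l - 1) * (1/2 - 1/p)) * (2 powr (real l / p) * t)"
    unfolding lvl_bound_def using assms by (intro mult_left_mono) auto
  also have "\<dots> = 2 powr (real_of_int (int l - 1) * (1/2 - 1/p) + real l / p) * t"
    by (simp only: powr_add ac_simps)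
  also have "real_of_int (int l - 1) * (1/2 - 1/p) + real l / p = real l / 2 + (1/p - 1/2)"
    by (simp add: algebra_simps add_divide_distrib diff_divide_distrib)
  also have "2 powr (real l / 2 + (1/p - 1/2)) * t \<le> 2 powr (real l / 2 + 1) * t"
    using assms by (intro mult_right_mono powr_mono) (auto simp: field_simps)
  finally show ?thesis by (simp add: powr_add mult.commute)
qed

text \<open>A crude substitute for Minkowski on one level: u + v \<le> 2 max u v is used once for
  the entries and once for the two sums, whence the 4.\<close>

lemma lvl_bound_add:
  assumes p: "1 \<le> p" and c: "\<And>k. k < nlev (int l - 1) \<Longrightarrow> \<bar>c (int l - 1, k)\<bar> \<le> \<bar>a (int l - 1, k)\<bar> + \<bar>b (int l - 1, k)\<bar>"
  shows "lvl_bound p c l \<le> 4 * (lvl_bound p a l + lvl_bound p b l)"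
proof -
  define N where "N d = (\<Sum>k<nlev (int l - 1). \<bar>d (int l - 1, k)\<bar> powr p)" for d :: "int \<times> nat \<Rightarrow> real"
  have N0: "0 \<le> N d" for d by (simp add: N_def sum_nonneg)
  have max_le: "(2 * max u v) powr r \<le> 2 powr r * (u powr r + v powr r)" if "0 \<le> u" "0 \<le> v" for u v r :: real
    using that by (cases "u \<le> v") (auto simp: powr_mult max_def intro!: mult_left_mono)
  have "N c \<le> (\<Sum>k<nlev (int l - 1). 2 powr p * (\<bar>a (int l - 1, k)\<bar> powr p + \<bar>b (int l - 1, k)\<bar> powr p))"
    unfolding N_def
  proof (intro sum_mono)
    fix k assume "k \<in> {..<nlev (int l - 1)}"
    then have "\<bar>c (int l - 1, k)\<bar> powr p \<le> (2 * max \<bar>a (int l - 1, k)\<bar> \<bar>b (int l - 1, k)\<bar>) powr p"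
      using p c[of k] by (intro powr_mono2) auto
    also have "\<dots> \<le> 2 powr p * (\<bar>a (int l - 1, k)\<bar> powr p + \<bar>b (int l - 1, k)\<bar> powr p)"
      by (intro max_le) auto
    finally show "\<bar>c (int l - 1, k)\<bar> powr p \<le> 2 powr p * (\<bar>a (int l - 1, k)\<bar> powr p + \<bar>b (int l - 1, k)\<bar> powr p)" .
  qed
  also have "\<dots> = 2 powr p * (N a + N b)"
    by (simp add: N_def sum_distrib_left[symmetric] sum.distrib)
  finally have "N c powr (1/p) \<le> (2 powr p * (N a + N b)) powr (1/p)"
    using p N0 by (intro powr_mono2) auto
  also have "\<dots> = 2 * (N a + N b) powr (1/p)"
    using p N0 by (simp add: powr_mult powr_powr)
  also have "\<dots> \<le> 2 * (2 * max (N a) (N b)) powr (1/p)"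
    using p N0 by (intro mult_left_mono powr_mono2) auto
  also have "\<dots> \<le> 2 * (2 powr (1/p) * (N a powr (1/p) + N b powr (1/p)))"
    using N0 by (intro mult_left_mono max_le) auto
  also have "\<dots> \<le> 2 * (2 powr 1 * (N a powr (1/p) + N b powr (1/p)))"
    using p by (intro mult_left_mono mult_right_mono powr_mono) auto
  finally have "N c powr (1/p) \<le> 4 * (N a powr (1/p) + N b powr (1/p))" by simp
  then have "2 powr (real_of_int (int l - 1) * (1/2 - 1/p)) * N c powr (1/p)
      \<le> 2 powr (real_of_int (int l - 1) * (1/2 - 1/p)) * (4 * (N a powr (1/p) + N b powr (1/p)))"
    by (intro mult_left_mono) auto
  then show ?thesis by (simp add: lvl_bound_def N_def algebra_simps)
qed

section \<open>Consequences of membership in the Besov ball\<close>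

locale besov_ball =
  fixes s F p' :: real and p q :: ereal and f0 :: "int \<times> nat \<Rightarrow> real"
  assumes s: "0 < s" and p: "1 \<le> p" and q: "1 \<le> q" and p': "1 \<le> p'" and F: "0 < F"
    and s_large: "s > max 0 (inv_e p - 1 / max p' 2)"
    and f0: "besov_norm s p q f0 \<le> ereal F"
begin

text \<open>The geometric decay exponent of single coefficients in \<open>coef_le\<close>. It is
  positive because 1 / max p' 2 is at most 1/2.\<close>

definition smooth :: real where "smooth = s + 1/2 - inv_e p"

lemma smooth_pos: "0 < smooth"
proof -
  have "1 / max p' 2 \<le> 1/2" by (intro divide_left_mono) auto
  moreover have "inv_e p - 1 / max p' 2 < s" using s_large by simp
  ultimately show ?thesis unfolding smooth_def by linarith
qed

lemma p_cases: "p = \<infinity> \<or> (\<exists>P\<ge>1. p = ereal P)"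
  using p by (cases p) auto

lemma lvl_norm_nonneg: "0 \<le> lvl_norm p f0 (int l - 1)"
proof (cases "p = \<infinity>")
  case True
  have "0 < nlev (int l - 1)" by (simp add: nlev_def)
  then have "\<bar>f0 (int l - 1, 0)\<bar> \<le> Max ((\<lambda>k. \<bar>f0 (int l - 1, k)\<bar>) ` {..<nlev (int l - 1)})"
    by (intro Max_ge) auto
  then show ?thesis using True by (simp add: lvl_norm_def)
qed (simp add: lvl_norm_def)

lemma lvl_norm_le: "lvl_norm p f0 (int l - 1) \<le> F * 2 powr (- ((real l - 1) * smooth))"
proof -
  define a where "a l = 2 powr (real_of_int (int l - 1) * (s + 1/2 - inv_e p)) * lvl_norm p f0 (int l - 1)" for l
  have a0: "0 \<le> a l" for l using lvl_norm_nonneg by (simp add: a_def)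
  have "a l \<le> F"
  proof (cases "q = \<infinity>")
    case True
    then have "(SUP l. ereal (a l)) \<le> ereal F"
      using f0 by (simp add: besov_norm_def a_def)
    then have "ereal (a l) \<le> ereal F" by (meson SUP_le_iff UNIV_I order_trans)
    then show ?thesis by simp
  next
    case False
    then obtain r where r: "q = ereal r" "1 \<le> r" using q by (cases q) auto
    \<comment> \<open>\<open>besov_norm\<close> is infinite when the series diverges, so finiteness
      provides summability.\<close>
    have sm: "summable (\<lambda>l. a l powr r)"
      using f0 False r by (auto simp: besov_norm_def a_def Let_def split: if_splits)
    then have le: "(\<Sum>l. a l powr r) powr (1/r) \<le> F"
      using f0 False r by (simp add: besov_norm_def a_def Let_def)
    have "a l powr r \<le> (\<Sum>l. a l powr r)"
      using sum_le_suminf[OF sm, of "{l}"] by simp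
    then have "(a l powr r) powr (1/r) \<le> (\<Sum>l. a l powr r) powr (1/r)"
      using r by (intro powr_mono2) auto
    then show ?thesis using le r a0[of l] by (simp add: powr_powr)
  qed
  then have "a l * 2 powr (- ((real l - 1) * smooth)) \<le> F * 2 powr (- ((real l - 1) * smooth))"
    by (intro mult_right_mono) auto
  moreover have "a l * 2 powr (- ((real l - 1) * smooth)) = lvl_norm p f0 (int l - 1)"
    by (simp add: a_def smooth_def powr_minus)
  ultimately show ?thesis by simp
qed

lemma coef_le:
  assumes "k < nlev (int l - 1)"
  shows "\<bar>f0 (int l - 1, k)\<bar> \<le> F * 2 powr (- ((real l - 1) * smooth))"
proof -
  have "\<bar>f0 (int l - 1, k)\<bar> \<le> lvl_norm p f0 (int l - 1)"
  proof (cases "p = \<infinity>")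
    case True
    then show ?thesis using assms by (auto simp: lvl_norm_def intro!: Max_ge)
  next
    case False
    then obtain P where P: "p = ereal P" "1 \<le> P" using p_cases by auto
    have "\<bar>f0 (int l - 1, k)\<bar> powr P \<le> (\<Sum>k<nlev (int l - 1). \<bar>f0 (int l - 1, k)\<bar> powr P)"
      using assms by (intro member_le_sum) auto
    then have "(\<bar>f0 (int l - 1, k)\<bar> powr P) powr (1/P) \<le> (\<Sum>k<nlev (int l - 1). \<bar>f0 (int l - 1, k)\<bar> powr P) powr (1/P)"
      using P by (intro powr_mono2) auto
    then show ?thesis using P by (simp add: powr_powr lvl_norm_def)
  qed
  then show ?thesis using lvl_norm_le[of l] by simp
qed

text \<open>Replacing \<open>p\<close> by \<open>min p p'\<close> costs nothing by Jensen's inequality on each level.\<close>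
definition Q :: real where "Q = (if p \<ge> ereal p' then p' else real_of_ereal p)"

lemma Q_bounds: "1 \<le> Q" "Q \<le> p'"
  using p_cases p' by (auto simp: Q_def)

lemma Q_smooth_pos: "0 < s - 1/Q + 1/p'"
proof (cases "p \<ge> ereal p'")
  case False
  then obtain P where P: "p = ereal P" "1 \<le> P" "P < p'" using p_cases by auto
  have "1 / max p' 2 \<le> 1 / p'" using p' by (intro divide_left_mono) auto
  moreover have "inv_e p = 1 / P" using P by (simp add: inv_e_def)
  moreover have "Q = P" unfolding Q_def using False P by simp
  ultimately show ?thesis using s_large by simp
qed (use s in \<open>simp add: Q_def\<close>)

text \<open>If p \<ge> p', then \<open>eta\<close> is positive both for p and for Q = p', so
  replacing p by Q stays in the regime s / (1 + 2s).\<close>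

lemma rate_eq: "rate s p p' = (if 0 < s * Q - (p' - Q) / 2 then s / (1 + 2 * s) else (s - 1/Q + 1/p') / (1 + 2 * (s - 1/Q)))"
proof (cases "p \<ge> ereal p'")
  case True
  have "0 < eta s p p'"
    using p_cases
  proof
    assume "\<exists>P\<ge>1. p = ereal P"
    then obtain P where P: "p = ereal P" "1 \<le> P" by blast
    then have "p' \<le> P" using True by simp
    moreover have "0 < s * P" using s P by simp
    ultimately show ?thesis using P by (simp add: eta_def)
  qed (simp add: eta_def)
  moreover have "0 < s * p'" using s p' by simp
  ultimately show ?thesis using True by (simp add: rate_def Q_def)
next
  case False
  then obtain P where P: "p = ereal P" "1 \<le> P" "P < p'" using p_cases by auto
  have [simp]: "Q = P" unfolding Q_def using False P by simp
  have "eta s p p' = ereal (s * P - (p' - P) / 2)" "inv_e p = 1 / P"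
    using P by (simp_all add: eta_def inv_e_def)
  then show ?thesis by (simp add: rate_def)
qed

text \<open>The strict bound leaves a power of n to absorb the low levels. In the sparse regime p'
  must exceed 2: otherwise s > 1/P - 1/2 gives sP > 1 - P/2 \<ge> (p' - P)/2, a contradiction. Then
  1/p' < 1/2 makes the quotient smaller than 1/2.\<close>

lemma rate_pos: "0 < rate s p p'" and rate_less_half: "rate s p p' < 1/2"
proof -
  have "0 < rate s p p' \<and> rate s p p' < 1/2"
  proof (cases "0 < s * Q - (p' - Q) / 2")
    case True
    then show ?thesis unfolding rate_eq using s by (simp add: field_simps)
  next
    case False
    have sQ: "0 < s * Q" using s Q_bounds by simp
    have "\<not> p \<ge> ereal p'"
    proof
      assume "p \<ge> ereal p'"
      then have "Q = p'" by (simp add: Q_def)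
      with False sQ show False by simp
    qed
    then obtain P where P: "p = ereal P" "1 \<le> P" "P < p'" using p_cases by auto
    have [simp]: "Q = P" unfolding Q_def using \<open>\<not> p \<ge> ereal p'\<close> P by simp
    have "2 < p'"
    proof (rule ccontr)
      assume "\<not> 2 < p'"
      then have "1 / P - 1/2 < s"
        using s_large P by (simp add: inv_e_def max_def split: if_splits)
      then have "(1 / P - 1/2) * P < s * P" using P by (intro mult_strict_right_mono) auto
      then have "1 - P / 2 < s * P" using P by (simp add: left_diff_distrib)
      with False \<open>\<not> 2 < p'\<close> show False by simp
    qed
    then have p2: "1 / p' < 1/2" by (simp add: field_simps)
    define u where "u = s - 1/Q"
    have u: "0 < u + 1 / p'" using Q_smooth_pos by (simp add: u_def)
    with p2 have "0 < 1 + 2 * u" "u + 1 / p' < (1 + 2 * u) / 2" by auto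
    with u have "0 < (u + 1 / p') / (1 + 2 * u) \<and> (u + 1 / p') / (1 + 2 * u) < 1/2"
      by (simp add: divide_less_eq)
    then show ?thesis
      unfolding rate_eq u_def using False by simp
  qed
  then show "0 < rate s p p'" "rate s p p' < 1/2" by auto
qed

text \<open>The level l = 0, that is j = -1, is excluded because it has 1 coefficient and not
  2^(l-1); it is later covered by the low levels.\<close>

lemma level_Q_le:
  assumes l: "1 \<le> l"
  shows "(\<Sum>k<nlev (int l - 1). \<bar>f0 (int l - 1, k)\<bar> powr Q) powr (1/Q) \<le> F * 2 powr (- ((real l - 1) * (s + 1/2 - 1/Q)))"
proof -
  have nl: "real (nlev (int l - 1)) = 2 powr (real l - 1)"
    using l by (simp add: nlev_def powr_realpow[symmetric] of_nat_diff nat_diff_distrib)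
  have ne: "0 < nlev (int l - 1)" by (simp add: nlev_def)
  let ?I = "{..<nlev (int l - 1)}" and ?f = "\<lambda>k. \<bar>f0 (int l - 1, k)\<bar>"
  have jensen: "(\<Sum>k\<in>?I. ?f k powr Q) powr (1/Q) \<le> 2 powr ((real l - 1) * (1/Q - inv_e p)) * lvl_norm p f0 (int l - 1)"
  proof (cases "p = \<infinity>")
    case True
    let ?m = "lvl_norm p f0 (int l - 1)"
    have "(\<Sum>k\<in>?I. ?f k powr Q) \<le> (\<Sum>k\<in>?I. ?m powr Q)"
      using Q_bounds True by (intro sum_mono powr_mono2) (auto simp: lvl_norm_def intro!: Max_ge)
    also have "\<dots> = 2 powr (real l - 1) * ?m powr Q" by (simp add: nl)
    finally have "(\<Sum>k\<in>?I. ?f k powr Q) powr (1/Q) \<le> (2 powr (real l - 1) * ?m powr Q) powr (1/Q)"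
      using Q_bounds by (intro powr_mono2) (auto intro: sum_nonneg)
    then show ?thesis
      using Q_bounds lvl_norm_nonneg[of l] True by (simp add: powr_mult powr_powr inv_e_def)
  next
    case False
    then obtain P where P: "p = ereal P" "1 \<le> P" using p_cases by auto
    have "Q \<le> P" unfolding Q_def using P by auto
    then have "(\<Sum>k\<in>?I. ?f k powr Q) powr (1/Q) \<le> real (card ?I) powr (1/Q - 1/P) * (\<Sum>k\<in>?I. ?f k powr P) powr (1/P)"
      using Q_bounds ne by (intro sum_powr_norm_le) auto
    then show ?thesis using P by (simp add: nl powr_powr inv_e_def lvl_norm_def)
  qed
  also have "\<dots> \<le> 2 powr ((real l - 1) * (1/Q - inv_e p)) * (F * 2 powr (- ((real l - 1) * smooth)))"
    by (intro mult_left_mono lvl_norm_le) auto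
  also have "\<dots> = F * 2 powr ((real l - 1) * (1/Q - inv_e p) + - ((real l - 1) * smooth))"
    by (simp only: powr_add ac_simps)
  also have "(real l - 1) * (1/Q - inv_e p) + - ((real l - 1) * smooth) = - ((real l - 1) * (s + 1/2 - 1/Q))"
    by (simp add: smooth_def algebra_simps)
  finally show ?thesis .
qed

lemma lvl_bound_tail:
  assumes l: "1 \<le> l"
  shows "lvl_bound p' f0 l \<le> F * 2 powr (- ((real l - 1) * (s - 1/Q + 1/p')))"
proof -
  have "(\<Sum>k<nlev (int l - 1). \<bar>f0 (int l - 1, k)\<bar> powr p') powr (1/p') \<le> (\<Sum>k<nlev (int l - 1). \<bar>f0 (int l - 1, k)\<bar> powr Q) powr (1/Q)"
    using Q_bounds by (intro sum_powr_le_powr_sum) auto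
  also note level_Q_le[OF l]
  finally have "lvl_bound p' f0 l \<le> 2 powr ((real l - 1) * (1/2 - 1/p')) * (F * 2 powr (- ((real l - 1) * (s + 1/2 - 1/Q))))"
    unfolding lvl_bound_def by (simp add: mult_left_mono)
  also have "\<dots> = F * 2 powr ((real l - 1) * (1/2 - 1/p') + - ((real l - 1) * (s + 1/2 - 1/Q)))"
    by (simp only: powr_add ac_simps)
  also have "(real l - 1) * (1/2 - 1/p') + - ((real l - 1) * (s + 1/2 - 1/Q)) = - ((real l - 1) * (s - 1/Q + 1/p'))"
    by (simp add: algebra_simps)
  finally show ?thesis .
qed

text \<open>The risk of an ideal thresholding rule on one level; at noise level n^(-1/2) the power
  is n^(-rate). Passing to \<open>max 1 F\<close> meets the requirement that the constant be at
  least 1.\<close>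

lemma lvl_bound_truncated:
  assumes l: "1 \<le> l" and \<nu>: "0 < \<nu>"
  shows "lvl_bound p' (\<lambda>i. min \<bar>f0 i\<bar> \<nu>) l \<le> max 1 F * \<nu> powr (2 * rate s p p')"
proof -
  have nl: "real (nlev (int l - 1)) = 2 powr (real l - 1)"
    using l by (simp add: nlev_def powr_realpow[symmetric] of_nat_diff nat_diff_distrib)
  have "F * 2 powr (- ((real l - 1) * (s + 1/2 - 1/Q))) \<le> max 1 F * 2 powr (- ((real l - 1) * (s + 1/2 - 1/Q)))"
    by (intro mult_right_mono) auto
  note bes = order_trans[OF level_Q_le[OF l] this]
  have "2 powr ((real l - 1) * (1/2 - 1/p')) * (\<Sum>k<nlev (int l - 1). min \<bar>f0 (int l - 1, k)\<bar> \<nu> powr p') powr (1/p')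
    \<le> max 1 F * \<nu> powr (2 * rate s p p')"
    unfolding rate_eq using l \<nu> s Q_bounds Q_smooth_pos bes
    by (intro truncated_norm_le) (auto simp: nl)
  then show ?thesis using \<nu> by (simp add: lvl_bound_def)
qed

end


section \<open>Asymptotics\<close>

text \<open>Applied with y = ln n and x = l. The left side collects the losses of
  \<open>eventually_shrinks\<close>: 16(ln n + l + 1) from
  \<open>exp (2 * (lam n l)\<^sup>2)\<close>, 2 ln n and 5l from the tolerance and the target bound
  (one l is spare), and D from constants. The right side is the gain from 2^(-(l-1)^2).\<close>

lemma quadratic_dominates:
  fixes x y D :: real
  assumes "(10 + \<bar>D\<bar>)\<^sup>2 \<le> y" "10 * sqrt y \<le> x"
  shows "18 * y + 22 * x + 16 + D \<le> (x - 1)\<^sup>2 / 2"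
proof -
  have y: "0 \<le> y" using assms(1) by (meson order_trans zero_le_power2)
  have "10 + \<bar>D\<bar> \<le> sqrt y" using assms(1) by (rule real_le_rsqrt)
  then have x: "100 + 10 * \<bar>D\<bar> \<le> x" using assms(2) by linarith
  have "(10 * sqrt y)\<^sup>2 \<le> x\<^sup>2" using assms y by (intro power_mono) auto
  then have y2: "100 * y \<le> x\<^sup>2" using y by (simp add: power_mult_distrib)
  have "(100 + 10 * \<bar>D\<bar>) * x \<le> x * x" using x by (intro mult_right_mono) auto
  moreover have "\<bar>D\<bar> * 100 \<le> \<bar>D\<bar> * x" using x by (intro mult_left_mono) auto
  ultimately have "100 * x + 1000 * \<bar>D\<bar> \<le> x\<^sup>2" by (simp add: algebra_simps power2_eq_square)
  then show ?thesis using y2 x by (simp add: power2_diff)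
qed

lemma powr_neg_two_le_exp:
  fixes x :: real
  assumes "0 \<le> x"
  shows "2 powr (- x) \<le> exp (- x / 2)"
proof -
  have "(1/2) * x \<le> ln 2 * x"
    using ln2_ge_two_thirds assms by (intro mult_right_mono) auto
  then show ?thesis by (simp add: powr_def mult.commute)
qed

lemma power_le_exp_of_nat:
  assumes "0 \<le> a" "a \<le> exp b"
  shows "a ^ l \<le> exp (b * real l)"
  using power_mono[OF assms(2,1), of l] by (simp add: exp_of_nat_mult[symmetric] mult.commute)

lemma four_le_exp_2: "(4::real) \<le> exp 2"
proof -
  have "(2::real) \<le> exp 1" using exp_ge_add_one_self[of 1] by simp
  then have "(2::real) * 2 \<le> exp 1 * exp 1" by (intro mult_mono) auto
  then show ?thesis by (simp add: exp_add[symmetric])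
qed

section \<open>Choice of levels, thresholds and tolerances\<close>

locale posterior_setting = heavy_tail h c + besov_ball s F p' p q f0
  for h :: "real \<Rightarrow> real" and c s F p' :: real and p q :: ereal and f0 :: "int \<times> nat \<Rightarrow> real" +
  fixes c1 \<kappa> :: real
  assumes c1: "0 < c1" and \<kappa>: "0 \<le> \<kappa>"
    and h_lower: "\<And>x. 0 \<le> x \<Longrightarrow> ln (1 / h x) \<le> c1 * (1 + ln (1 + x) powr (1 + \<kappa>))"
begin

definition tail_exp :: real where "tail_exp = s - 1/Q + 1/p'"
text \<open>Makes \<open>c3 * a\<close> at least 4 for both decay exponents \<open>a\<close>. Beyond
  \<open>c3 * ln n\<close>, half of the exponent then yields 2^(-2 ln n) \<le> 1/n, and the other
  half survives as a summable geometric factor.\<close>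

definition c3 :: real where "c3 = 4 * (1 / smooth + 1 / tail_exp)"

text \<open>Levels up to \<open>l1\<close> are negligible; from \<open>l1\<close> on the prior scale is below every power of \<open>n\<close> and the
  prior thresholds; beyond \<open>l2\<close> every coefficient of \<open>f0\<close> is below the noise level.\<close>
definition l1 :: "nat \<Rightarrow> nat" where "l1 n = nat \<lceil>10 * sqrt (ln n)\<rceil>"
definition l2 :: "nat \<Rightarrow> nat" where "l2 n = nat \<lceil>c3 * ln n\<rceil>"

text \<open>A noise quantile in units of 1/sqrt n. With the 8, \<open>normal_tail\<close> gives exp
  (-2(ln n + l + 1)), which beats (1/n) 4^(-l) and so survives the union bound over all
  coefficients.\<close>

definition lam :: "nat \<Rightarrow> nat \<Rightarrow> real" where "lam n l = sqrt (8 * (ln n + real l + 1))"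
definition R :: "nat \<Rightarrow> real" where "R n = ln n powr (2 * (1 + \<kappa>))"
definition \<nu> :: "nat \<Rightarrow> real" where "\<nu> n = 1 / sqrt n"

text \<open>In the first case the posterior concentrates near the truth up to
  \<open>R n * \<nu> n\<close>. In the second it is within
  \<open>(\<nu> n)\<^sup>2 * (1/8) ^ l\<close> of 0, so the distance to the truth is the true
  coefficient plus this summable amount.\<close>

definition rad :: "nat \<Rightarrow> nat \<Rightarrow> nat \<Rightarrow> real" where
  "rad n l k = (if l \<le> l1 n \<or> lam n l * \<nu> n < \<bar>f0 (int l - 1, k)\<bar> then R n * \<nu> n
     else \<bar>f0 (int l - 1, k)\<bar> + (\<nu> n)\<^sup>2 * (1/8) ^ l)"

text \<open>The value of \<open>coef_le\<close> at its weakest level, l = 0.\<close>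

definition f0_max :: real where "f0_max = F * 2 powr smooth"

lemma tail_exp_pos: "0 < tail_exp" using Q_smooth_pos by (simp add: tail_exp_def)

lemma c3_pos: "0 < c3" using tail_exp_pos smooth_pos by (simp add: c3_def add_pos_pos)

lemma c3_ge: "4 \<le> c3 * smooth" "4 \<le> c3 * tail_exp"
  using tail_exp_pos smooth_pos by (simp_all add: c3_def field_simps)

lemma f0_max_pos: "0 < f0_max" using F by (simp add: f0_max_def)

lemma abs_f0_le_max: "k < nlev (int l - 1) \<Longrightarrow> \<bar>f0 (int l - 1, k)\<bar> \<le> f0_max"
proof -
  assume "k < nlev (int l - 1)"
  then have "\<bar>f0 (int l - 1, k)\<bar> \<le> F * 2 powr (- ((real l - 1) * smooth))" by (rule coef_le)
  also have "\<dots> \<le> f0_max"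
    unfolding f0_max_def using F smooth_pos by (intro mult_left_mono powr_mono) (auto simp: algebra_simps)
  finally show ?thesis .
qed

lemma R_nonneg [simp]: "0 \<le> R n" by (simp add: R_def)
lemma \<nu>_nonneg [simp]: "0 \<le> \<nu> n" by (simp add: \<nu>_def)
lemma \<nu>_pos: "1 \<le> n \<Longrightarrow> 0 < \<nu> n" by (simp add: \<nu>_def)
lemma \<nu>_eq:
  assumes "1 \<le> n"
  shows "\<nu> n = exp (- ln n / 2)"
proof -
  have "sqrt (real n) = exp (ln (real n) / 2)"
    using assms by (subst ln_sqrt[symmetric]) auto
  then show ?thesis by (simp add: \<nu>_def exp_minus inverse_eq_divide)
qed
lemma \<nu>_sq: "1 \<le> n \<Longrightarrow> (\<nu> n)\<^sup>2 = 1 / n" by (simp add: \<nu>_def power_divide)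
lemma lam_nonneg [simp]: "1 \<le> n \<Longrightarrow> 0 \<le> lam n l" by (simp add: lam_def)
lemma lam_sq: "1 \<le> n \<Longrightarrow> (lam n l)\<^sup>2 = 8 * (ln n + real l + 1)" by (simp add: lam_def)
lemma lam_ge_1: "1 \<le> n \<Longrightarrow> 1 \<le> lam n l"
  unfolding lam_def by (rule real_le_rsqrt) simp

lemma l2_bounds: "1 \<le> n \<Longrightarrow> c3 * ln n \<le> real (l2 n)" "1 \<le> n \<Longrightarrow> real (l2 n) \<le> c3 * ln n + 1"
proof -
  assume "1 \<le> n"
  then have "0 \<le> c3 * ln n" using c3_pos by simp
  then show "c3 * ln n \<le> real (l2 n)" "real (l2 n) \<le> c3 * ln n + 1"
    unfolding l2_def by linarith+
qed

lemma l1_bounds: "1 \<le> n \<Longrightarrow> 10 * sqrt (ln n) \<le> real (l1 n)" "1 \<le> n \<Longrightarrow> real (l1 n) \<le> 10 * sqrt (ln n) + 1"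
proof -
  assume "1 \<le> n"
  then have "0 \<le> 10 * sqrt (ln n)" by simp
  then show "10 * sqrt (ln n) \<le> real (l1 n)" "real (l1 n) \<le> 10 * sqrt (ln n) + 1"
    unfolding l1_def by linarith+
qed

lemma high_level_decay:
  assumes n: "1 \<le> n" and l: "l2 n < l" and a: "4 \<le> c3 * a"
  shows "2 powr (- ((real l - 1) * a)) \<le> 1 / n * 2 powr (- ((real l - 1) * (a / 2)))"
proof -
  have "0 < a" using a c3_pos zero_less_mult_pos[of c3 a] by simp
  have "c3 * ln n \<le> real l - 1" using l2_bounds(1)[OF n] l by linarith
  then have "c3 * ln n * (a / 2) \<le> (real l - 1) * (a / 2)"
    using \<open>0 < a\<close> by (intro mult_right_mono) auto
  moreover have "2 * ln n \<le> c3 * ln n * (a / 2)"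
    using mult_right_mono[OF a, of "ln n"] n by (simp add: mult.commute mult.left_commute)
  ultimately have "2 * ln n \<le> (real l - 1) * (a / 2)" by linarith
  then have "2 powr (- ((real l - 1) * (a / 2))) \<le> 2 powr (- (2 * ln n))"
    by (intro powr_mono) auto
  also have "\<dots> \<le> exp (- (2 * ln n) / 2)"
    using n by (intro powr_neg_two_le_exp) auto
  also have "\<dots> = 1 / n"
    using n by (simp add: exp_minus inverse_eq_divide)
  finally have "2 powr (- ((real l - 1) * (a / 2))) * 2 powr (- ((real l - 1) * (a / 2)))
      \<le> 1 / n * 2 powr (- ((real l - 1) * (a / 2)))"
    by (intro mult_right_mono) auto
  moreover have "- ((real l - 1) * a) = - ((real l - 1) * (a / 2)) + - ((real l - 1) * (a / 2))"
    by (simp add: field_simps)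
  ultimately show ?thesis by (simp only: powr_add)
qed

text \<open>With x = ln n, powers of n become exponentials and each asymptotic comparison concerns
  one real variable.\<close>

lemma eventually_ln: "eventually P at_top \<Longrightarrow> eventually (\<lambda>n::nat. P (ln (real n))) sequentially"
  by (rule eventually_compose_filterlim[of P at_top]) (assumption, real_asymp)

lemma eventually_high_small:
  "eventually (\<lambda>n. \<forall>l>l2 n. \<forall>k<nlev (int l - 1). \<bar>f0 (int l - 1, k)\<bar> \<le> lam n l * \<nu> n) sequentially"
proof -
  have "eventually (\<lambda>n::nat. F\<^sup>2 \<le> ln (real n)) sequentially"
    by (rule eventually_ln) (rule eventually_ge_at_top)
  then show ?thesis
    using eventually_ge_at_top[of 1]
  proof eventually_elim
    case (elim n)
    show ?case
    proof (intro allI impI)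
      fix l k assume l: "l2 n < l" and k: "k < nlev (int l - 1)"
      have "F \<le> lam n l"
      proof -
        have "0 \<le> ln (real n)" using elim by simp
        then have "F\<^sup>2 \<le> 8 * (ln n + real l + 1)" using elim(1) by simp
        then show ?thesis unfolding lam_def by (rule real_le_rsqrt)
      qed
      have "1 / real n \<le> \<nu> n"
      proof -
        have "\<nu> n \<le> 1" using elim by (simp add: \<nu>_def)
        then have "\<nu> n * \<nu> n \<le> \<nu> n * 1" by (intro mult_left_mono) auto
        then show ?thesis using \<nu>_sq[of n] elim by (simp add: power2_eq_square)
      qed
      have "\<bar>f0 (int l - 1, k)\<bar> \<le> F * 2 powr (- ((real l - 1) * smooth))" using k by (rule coef_le)
      also have "\<dots> \<le> F * (1 / n * 2 powr (- ((real l - 1) * (smooth / 2))))"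
        using F elim l c3_ge by (intro mult_left_mono high_level_decay) auto
      also have "\<dots> \<le> F * (1 / n * 2 powr 0)"
        using F l smooth_pos by (intro mult_left_mono powr_mono) auto
      also have "\<dots> \<le> lam n l * \<nu> n"
        using F \<open>F \<le> lam n l\<close> \<open>1 / real n \<le> \<nu> n\<close> mult_mono[of F "lam n l" "1 / real n" "\<nu> n"] by simp
      finally show "\<bar>f0 (int l - 1, k)\<bar> \<le> lam n l * \<nu> n" .
    qed
  qed
qed

text \<open>The factor \<open>exp (2 * (lam n l)\<^sup>2)\<close> is exp (n x^2 / 2) at
  \<bar>x\<bar> = 2 \<open>lam n l * \<nu> n\<close>. The claim is uniform over infinitely many
  levels, hence the explicit inequality \<open>quadratic_dominates\<close> in place of a limit in n
  alone.\<close>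

lemma eventually_shrinks:
  "eventually (\<lambda>n. \<forall>l>l1 n. real n * (2 powr - (real l - 1)\<^sup>2)\<^sup>2 \<le> 1 \<and>
     exp (2 * (lam n l)\<^sup>2) * (2 * c * 2 powr - (real l - 1)\<^sup>2 / ((\<nu> n)\<^sup>2 * (1/8) ^ l)) * exp (1/2) / h 1
       \<le> 1 / n * (1/4) ^ l) sequentially"
proof -
  define K where "K = 2 * c * exp (1/2) / h 1"
  define D where "D = \<bar>ln K\<bar>"
  have K: "0 < K" using c_ge h_pos[of 1] by (simp add: K_def)
  have KD: "K \<le> exp D" using K by (simp add: D_def) (metis abs_ge_self exp_le_cancel_iff exp_ln)
  have "eventually (\<lambda>n::nat. (10 + \<bar>D\<bar>)\<^sup>2 \<le> ln (real n)) sequentially"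
    by (rule eventually_ln) (rule eventually_ge_at_top)
  then show ?thesis
    using eventually_ge_at_top[of 1]
  proof eventually_elim
    case (elim n)
    show ?case
    proof (intro allI impI)
      fix l assume l: "l1 n < l"
      have n: "real n = exp (ln n)" using elim by simp
      let ?y = "(real l - 1)\<^sup>2"
      have "10 * sqrt (ln n) \<le> real l" using l1_bounds(1)[of n] elim l by linarith
      then have q: "18 * ln n + 22 * real l + 16 + D \<le> ?y / 2"
        using elim by (intro quadratic_dominates) auto
      have \<sigma>: "2 powr (- ?y) \<le> exp (- ?y / 2)" by (rule powr_neg_two_le_exp) simp
      have D0: "0 \<le> D" by (simp add: D_def)
      have ln0: "0 \<le> ln (real n)" using elim by simp
      have "real n * (2 powr - ?y)\<^sup>2 \<le> exp (ln n) * (exp (- ?y / 2))\<^sup>2"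
        using \<sigma> n by (intro mult_mono power_mono) auto
      also have "\<dots> = exp (ln n + (- ?y / 2 + - ?y / 2))"
        by (simp only: exp_add power2_eq_square)
      also have "\<dots> \<le> 1" using q D0 ln0 by simp
      finally have first: "real n * (2 powr - ?y)\<^sup>2 \<le> 1" .
      have e2: "(2::real) \<le> exp 1" using exp_ge_add_one_self[of 1] by simp
      have "(32::real) ^ l = 2 ^ (5 * l)" by (simp add: power_mult)
      also have "\<dots> \<le> exp (1 * real (5 * l))" using e2 by (intro power_le_exp_of_nat) auto
      finally have p32: "(32::real) ^ l \<le> exp (5 * real l)" by simp
      have "exp (2 * (lam n l)\<^sup>2) * (2 * c * 2 powr - ?y / ((\<nu> n)\<^sup>2 * (1/8) ^ l)) * exp (1/2) / h 1
          = exp (16 * (ln n + real l + 1)) * K * 2 powr - ?y * (real n * 8 ^ l)"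
        using elim by (simp add: lam_sq \<nu>_sq K_def power_divide)
      also have "\<dots> = (exp (16 * (ln n + real l + 1)) * K * 2 powr - ?y * (real n * real n * 32 ^ l)) * (1 / n * (1/4) ^ l)"
      proof -
        have "(32::real) ^ l = 8 ^ l * 4 ^ l" by (simp add: power_mult_distrib[symmetric])
        then show ?thesis using elim by (simp add: power_divide)
      qed
      also have "\<dots> \<le> 1 * (1 / n * (1/4) ^ l)"
      proof (intro mult_right_mono)
        have "exp (16 * (ln n + real l + 1)) * K * 2 powr - ?y * (real n * real n * 32 ^ l)
            \<le> exp (16 * (ln n + real l + 1)) * exp D * exp (- ?y / 2) * (exp (ln n) * exp (ln n) * exp (5 * real l))"
          using KD \<sigma> p32 n K by (intro mult_mono) auto
        also have "\<dots> = exp (16 * (ln n + real l + 1) + D + - ?y / 2 + (ln n + ln n + 5 * real l))"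
          by (simp only: exp_add)
        also have "\<dots> \<le> 1" using q by simp
        finally show "exp (16 * (ln n + real l + 1)) * K * 2 powr - ?y * (real n * real n * 32 ^ l) \<le> 1" .
      qed auto
      finally show "real n * (2 powr - ?y)\<^sup>2 \<le> 1 \<and>
         exp (2 * (lam n l)\<^sup>2) * (2 * c * 2 powr - ?y / ((\<nu> n)\<^sup>2 * (1/8) ^ l)) * exp (1/2) / h 1 \<le> 1 / n * (1/4) ^ l"
        using first by simp
    qed
  qed
qed

lemma lam_le:
  assumes n: "1 \<le> n" and l: "l \<le> l2 n"
  shows "lam n l \<le> sqrt (8 * (ln n + c3 * ln n + 2))"
  unfolding lam_def using l2_bounds(2)[OF n] l by (intro real_sqrt_le_mono) auto

text \<open>The bound \<open>lam n l * \<nu> n \<le> 1\<close> keeps the observations within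
  \<open>f0_max + 1\<close>, where the prior density is controlled.\<close>

lemma eventually_lam_le_R:
  "eventually (\<lambda>n. 1 \<le> R n \<and> (\<forall>l\<le>l2 n. lam n l \<le> R n \<and> lam n l * \<nu> n \<le> 1)) sequentially"
proof -
  have "eventually (\<lambda>x::real. 1 \<le> x powr (2 * (1 + \<kappa>))) at_top"
    using \<kappa> by real_asymp
  moreover have "eventually (\<lambda>x::real. sqrt (8 * (x + c3 * x + 2)) \<le> x powr (2 * (1 + \<kappa>))) at_top"
    using \<kappa> c3_pos by real_asymp
  moreover have "eventually (\<lambda>x::real. sqrt (8 * (x + c3 * x + 2)) * exp (- x / 2) \<le> 1) at_top"
    using c3_pos by real_asymp
  ultimately have "eventually (\<lambda>x::real. 1 \<le> x powr (2 * (1 + \<kappa>)) \<and> sqrt (8 * (x + c3 * x + 2)) \<le> x powr (2 * (1 + \<kappa>))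
      \<and> sqrt (8 * (x + c3 * x + 2)) * exp (- x / 2) \<le> 1) at_top"
    by eventually_elim auto
  from eventually_ln[OF this] show ?thesis
    using eventually_ge_at_top[of 1]
  proof eventually_elim
    case (elim n)
    have "lam n l \<le> R n" "lam n l * \<nu> n \<le> 1" if l: "l \<le> l2 n" for l
    proof -
      have L: "lam n l \<le> sqrt (8 * (ln n + c3 * ln n + 2))" using elim l by (intro lam_le) auto
      then show "lam n l \<le> R n" using elim by (simp add: R_def)
      have "lam n l * \<nu> n \<le> sqrt (8 * (ln n + c3 * ln n + 2)) * exp (- ln n / 2)"
      proof (rule mult_mono)
        show "0 \<le> sqrt (8 * (ln n + c3 * ln n + 2))" using c3_pos elim by simp
      qed (use L elim in \<open>auto simp: \<nu>_eq\<close>)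
      then show "lam n l * \<nu> n \<le> 1" using elim by simp
    qed
    then show ?case using elim by (auto simp: R_def)
  qed
qed

text \<open>For l \<le> \<open>l2 n\<close> the argument of \<open>h\<close> is at most a constant
  times 2^((l-1)^2), with logarithm O((ln n)^2). By (H2), ln (1/h) is O((ln n)^(2(1+\<kappa>))),
  whereas \<open>R n\<close> squared is (ln n)^(4(1+\<kappa>)).\<close>

lemma eventually_concentrates:
  "eventually (\<lambda>n. \<forall>l\<le>l2 n. \<forall>x. \<bar>x\<bar> \<le> f0_max + 1 \<longrightarrow>
     exp (- (R n - lam n l)\<^sup>2 / 2) * sqrt n / h ((\<bar>x\<bar> + 1) / 2 powr - (real l - 1)\<^sup>2) \<le> 1 / n * (1/4) ^ l) sequentially"
proof -
  define D where "D = ln (f0_max + 3)"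
  have D: "0 \<le> D" using f0_max_pos by (simp add: D_def)
  \<comment> \<open>Here 3/2 x stands for \<open>sqrt n\<close> together with the target 1/n, and
    2(c3 x + 1) for 4^l with l \<le> \<open>l2 n\<close>.\<close>
  have "eventually (\<lambda>x::real. 3/2 * x + c1 * (1 + (D + (c3 * x + 2)\<^sup>2) powr (1 + \<kappa>)) + 2 * (c3 * x + 1)
      \<le> (x powr (2 * (1 + \<kappa>)) - sqrt (8 * (x + c3 * x + 2)))\<^sup>2 / 2) at_top"
    using \<kappa> c3_pos c1 by real_asymp
  moreover have "eventually (\<lambda>x::real. sqrt (8 * (x + c3 * x + 2)) \<le> x powr (2 * (1 + \<kappa>))) at_top"
    using \<kappa> c3_pos by real_asymp
  ultimately have "eventually (\<lambda>x::real. 3/2 * x + c1 * (1 + (D + (c3 * x + 2)\<^sup>2) powr (1 + \<kappa>)) + 2 * (c3 * x + 1)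
      \<le> (x powr (2 * (1 + \<kappa>)) - sqrt (8 * (x + c3 * x + 2)))\<^sup>2 / 2 \<and> sqrt (8 * (x + c3 * x + 2)) \<le> x powr (2 * (1 + \<kappa>))) at_top"
    by eventually_elim auto
  from eventually_ln[OF this] show ?thesis
    using eventually_ge_at_top[of 1]
  proof eventually_elim
    case (elim n)
    show ?case
    proof (intro allI impI)
      fix l x assume l: "l \<le> l2 n" and x: "\<bar>x\<bar> \<le> f0_max + 1"
      let ?\<Lambda> = "sqrt (8 * (ln n + c3 * ln n + 2))" and ?y = "(real l - 1)\<^sup>2"
      define Y where "Y = (\<bar>x\<bar> + 1) / 2 powr - ?y"
      have Y_eq: "Y = (\<bar>x\<bar> + 1) * 2 powr ?y" by (simp add: Y_def powr_minus divide_inverse)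
      have Y0: "0 \<le> Y" by (simp add: Y_eq)
      have y1: "1 \<le> 2 powr ?y" by (rule ge_one_powr_ge_zero) auto
      have "1 + Y \<le> (f0_max + 3) * 2 powr ?y"
      proof -
        have "(\<bar>x\<bar> + 1) * 2 powr ?y \<le> (f0_max + 2) * 2 powr ?y"
          using x by (intro mult_right_mono) auto
        then show ?thesis using y1 by (simp add: Y_eq algebra_simps)
      qed
      then have "ln (1 + Y) \<le> ln ((f0_max + 3) * 2 powr ?y)"
        using Y0 by (subst ln_le_cancel_iff) (use f0_max_pos in auto)
      also have "\<dots> = D + ?y * ln 2"
        using f0_max_pos by (simp add: ln_mult D_def ln_powr)
      also have "\<dots> \<le> D + (c3 * ln n + 2)\<^sup>2"
      proof -
        have lb: "real l \<le> c3 * ln n + 1" using l2_bounds(2)[of n] l elim by linarith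
        have "?y \<le> (c3 * ln n + 2)\<^sup>2"
        proof (rule power2_le_iff_abs_le[THEN iffD2])
          show "\<bar>real l - 1\<bar> \<le> c3 * ln n + 2" using lb by linarith
        qed (use c3_pos elim in auto)
        moreover have "?y * ln 2 \<le> ?y * 1" using ln2_le_25_over_36 by (intro mult_left_mono) auto
        ultimately show ?thesis by linarith
      qed
      finally have lnY: "ln (1 + Y) \<le> D + (c3 * ln n + 2)\<^sup>2" .
      have "ln (1 / h Y) \<le> c1 * (1 + ln (1 + Y) powr (1 + \<kappa>))" using Y0 by (rule h_lower)
      also have "\<dots> \<le> c1 * (1 + (D + (c3 * ln n + 2)\<^sup>2) powr (1 + \<kappa>))"
        using c1 \<kappa> Y0 lnY by (intro mult_left_mono add_left_mono powr_mono2) auto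
      finally have lnh: "ln (1 / h Y) \<le> c1 * (1 + (D + (c3 * ln n + 2)\<^sup>2) powr (1 + \<kappa>))" .
      have hY: "1 / h Y = exp (ln (1 / h Y))" using h_pos[of Y] by simp
      have L: "lam n l \<le> ?\<Lambda>" using elim l by (intro lam_le) auto
      have "(R n - ?\<Lambda>)\<^sup>2 \<le> (R n - lam n l)\<^sup>2"
        using L elim by (intro power_mono) (auto simp: R_def)
      then have main: "3/2 * ln n + ln (1 / h Y) + 2 * (c3 * ln n + 1) \<le> (R n - lam n l)\<^sup>2 / 2"
        using elim lnh by (simp add: R_def)
      have sq: "sqrt n = exp (ln n / 2)"
        using elim by (subst ln_sqrt[symmetric]) auto
      have n4: "4 ^ l \<le> exp (2 * real l)" by (rule power_le_exp_of_nat) (auto simp: four_le_exp_2)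
      have rn: "real n = exp (ln n)" using elim by simp
      have "exp (- (R n - lam n l)\<^sup>2 / 2) * sqrt n / h Y
          = (exp (- (R n - lam n l)\<^sup>2 / 2) * sqrt n * (1 / h Y) * real n * 4 ^ l) * (1 / n * (1/4) ^ l)"
        using elim by (simp add: power_divide)
      also have "\<dots> \<le> 1 * (1 / n * (1/4) ^ l)"
      proof (intro mult_right_mono)
        have "exp (- (R n - lam n l)\<^sup>2 / 2) * sqrt n * (1 / h Y) * real n * 4 ^ l
            \<le> exp (- (R n - lam n l)\<^sup>2 / 2) * exp (ln n / 2) * exp (ln (1 / h Y)) * exp (ln n) * exp (2 * real l)"
          using n4 sq hY rn by (intro mult_mono) auto
        also have "\<dots> = exp (- (R n - lam n l)\<^sup>2 / 2 + ln n / 2 + ln (1 / h Y) + ln n + 2 * real l)"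
          by (simp only: exp_add)
        also have "\<dots> \<le> 1"
          using main l2_bounds(2)[of n] l elim by simp
        finally show "exp (- (R n - lam n l)\<^sup>2 / 2) * sqrt n * (1 / h Y) * real n * 4 ^ l \<le> 1" .
      qed auto
      finally show "exp (- (R n - lam n l)\<^sup>2 / 2) * sqrt n / h ((\<bar>x\<bar> + 1) / 2 powr - ?y) \<le> 1 / n * (1/4) ^ l"
        by (simp add: Y_def)
    qed
  qed
qed

end


section \<open>Contraction\<close>

lemma posterior_le_1: "posterior h n B X \<le> 1"
proof -
  let ?D = "\<integral>\<^sup>+ f. ennreal (lik n X f) \<partial>prior h"
  have le: "(\<integral>\<^sup>+ f. indicator B f * ennreal (lik n X f) \<partial>prior h) \<le> ?D"
    by (intro nn_integral_mono) (auto split: split_indicator)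
  show ?thesis
  proof (cases "?D = 0 \<or> ?D = top")
    case True
    then show ?thesis using le by (auto simp: posterior_def)
  next
    case False
    then show ?thesis
      unfolding posterior_def using divide_right_mono_ennreal[OF le, of ?D]
      by (simp add: less_top)
  qed
qed

context posterior_setting
begin

text \<open>Gathers everything asymptotic about n, so that the probabilistic estimates below hold
  for each fixed good n.\<close>

definition good :: "nat \<Rightarrow> bool" where
  "good n \<longleftrightarrow> 1 \<le> n \<and> l1 n \<le> l2 n
     \<and> (\<forall>l>l2 n. \<forall>k<nlev (int l - 1). \<bar>f0 (int l - 1, k)\<bar> \<le> lam n l * \<nu> n)
     \<and> (\<forall>l>l1 n. real n * (2 powr - (real l - 1)\<^sup>2)\<^sup>2 \<le> 1 \<and>
          exp (2 * (lam n l)\<^sup>2) * (2 * c * 2 powr - (real l - 1)\<^sup>2 / ((\<nu> n)\<^sup>2 * (1/8) ^ l)) * exp (1/2) / h 1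
            \<le> 1 / n * (1/4) ^ l)
     \<and> 1 \<le> R n \<and> (\<forall>l\<le>l2 n. lam n l \<le> R n \<and> lam n l * \<nu> n \<le> 1)
     \<and> (\<forall>l\<le>l2 n. \<forall>x. \<bar>x\<bar> \<le> f0_max + 1 \<longrightarrow>
          exp (- (R n - lam n l)\<^sup>2 / 2) * sqrt n / h ((\<bar>x\<bar> + 1) / 2 powr - (real l - 1)\<^sup>2) \<le> 1 / n * (1/4) ^ l)"

lemma eventually_good: "eventually good sequentially"
proof -
  have "eventually (\<lambda>x::real. 10 * sqrt x + 1 \<le> c3 * x) at_top"
    using c3_pos by real_asymp
  from eventually_ln[OF this] show ?thesis
    using eventually_ge_at_top[of 1] eventually_high_small eventually_shrinks eventually_lam_le_R eventually_concentrates
  proof eventually_elim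
    case (elim n)
    have "real (l1 n) \<le> real (l2 n)"
      using l1_bounds(2)[of n] l2_bounds(1)[of n] elim(1,2) by linarith
    then show ?case unfolding good_def using elim by simp
  qed
qed

lemma coord_posterior_bound:
  assumes good: "good n" and k: "k < nlev (int l - 1)" and x: "\<bar>x - f0 (int l - 1, k)\<bar> \<le> lam n l * \<nu> n"
  shows "(\<integral>\<^sup>+ u. indicator {u. rad n l k < \<bar>u - f0 (int l - 1, k)\<bar>} u * ennreal (coord_lik n x u) \<partial>pc (int l - 1, k))
    \<le> ennreal (1 / n * (1/4) ^ l) * (\<integral>\<^sup>+ u. ennreal (coord_lik n x u) \<partial>pc (int l - 1, k))"
proof -
  let ?f = "f0 (int l - 1, k)" and ?\<sigma> = "2 powr - (real l - 1)\<^sup>2"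
  have n: "1 \<le> n" using good by (simp add: good_def)
  have pc: "pc (int l - 1, k) = coord_prior h ?\<sigma>" by simp
  show ?thesis
  proof (cases "l \<le> l1 n \<or> lam n l * \<nu> n < \<bar>?f\<bar>")
    case True
    \<comment> \<open>Beyond \<open>l2 n\<close> all true coefficients are below the noise, so the
      concentration regime never reaches levels where the prior density is too small.\<close>
    have l: "l \<le> l2 n"
    proof (rule ccontr)
      assume "\<not> l \<le> l2 n"
      then have "l2 n < l" by simp
      then have "\<bar>?f\<bar> \<le> lam n l * \<nu> n" using good k unfolding good_def by blast
      moreover have "\<not> l \<le> l1 n" using good \<open>l2 n < l\<close> by (auto simp: good_def)
      ultimately show False using True by linarith
    qed
    have lam: "lam n l \<le> R n" "lam n l * \<nu> n \<le> 1" using good l by (auto simp: good_def)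
    have "\<bar>x\<bar> \<le> f0_max + 1" using x lam abs_f0_le_max[OF k] by linarith
    then have e: "exp (- (R n - lam n l)\<^sup>2 / 2) * sqrt n / h ((\<bar>x\<bar> + 1) / ?\<sigma>) \<le> 1 / n * (1/4) ^ l"
      using good l unfolding good_def by blast
    have r: "rad n l k = R n / sqrt n" using True by (simp add: rad_def \<nu>_def)
    have "(\<integral>\<^sup>+ u. indicator {u. R n / sqrt n < \<bar>u - ?f\<bar>} u * ennreal (coord_lik n x u) \<partial>coord_prior h ?\<sigma>)
      \<le> ennreal (exp (- (R n - lam n l)\<^sup>2 / 2) * sqrt n / h ((\<bar>x\<bar> + 1) / ?\<sigma>))
        * (\<integral>\<^sup>+ u. ennreal (coord_lik n x u) \<partial>coord_prior h ?\<sigma>)"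
    proof (rule coord_posterior_concentrates)
      have "2 powr - (real l - 1)\<^sup>2 \<le> 2 powr 0" by (intro powr_mono) auto
      then show "?\<sigma> \<le> 1" by simp
      show "\<bar>x - ?f\<bar> \<le> lam n l / sqrt n" using x by (simp add: \<nu>_def)
    qed (use n lam in auto)
    also have "\<dots> \<le> ennreal (1 / n * (1/4) ^ l) * (\<integral>\<^sup>+ u. ennreal (coord_lik n x u) \<partial>coord_prior h ?\<sigma>)"
      by (intro mult_right_mono ennreal_leI e) simp
    finally show ?thesis unfolding pc r .
  next
    case False
    then have l: "l1 n < l" and f: "\<bar>?f\<bar> \<le> lam n l * \<nu> n" by auto
    define t where "t = (\<nu> n)\<^sup>2 * (1/8) ^ l"
    have t: "0 < t" using \<nu>_pos[OF n] by (simp add: t_def)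
    have r: "rad n l k = \<bar>?f\<bar> + t" using False by (simp add: rad_def t_def)
    have n\<sigma>: "real n * ?\<sigma>\<^sup>2 \<le> 1"
      and e: "exp (2 * (lam n l)\<^sup>2) * (2 * c * ?\<sigma> / t) * exp (1/2) / h 1 \<le> 1 / n * (1/4) ^ l"
      using good l unfolding good_def t_def by blast+
    \<comment> \<open>Signal and noise are each at most \<open>lam n l * \<nu> n\<close>; this is
      the origin of the factor \<open>exp (2 * (lam n l)\<^sup>2)\<close>.\<close>
    have "\<bar>x\<bar> \<le> 2 * lam n l * \<nu> n" using x f by linarith
    then have "x\<^sup>2 \<le> (2 * lam n l * \<nu> n)\<^sup>2"
      using n by (intro power2_le_iff_abs_le[THEN iffD2]) auto
    then have "real n * x\<^sup>2 \<le> real n * (2 * lam n l * \<nu> n)\<^sup>2" by (intro mult_left_mono) auto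
    also have "\<dots> = 4 * (lam n l)\<^sup>2" using n by (simp add: power_mult_distrib \<nu>_sq)
    finally have ex: "exp (real n * x\<^sup>2 / 2) \<le> exp (2 * (lam n l)\<^sup>2)" by simp
    have "(\<integral>\<^sup>+ u. indicator {u. rad n l k < \<bar>u - ?f\<bar>} u * ennreal (coord_lik n x u) \<partial>coord_prior h ?\<sigma>)
      \<le> (\<integral>\<^sup>+ u. indicator {u. t < \<bar>u\<bar>} u * ennreal (coord_lik n x u) \<partial>coord_prior h ?\<sigma>)"
      unfolding r by (intro nn_integral_mono mult_right_mono) (auto split: split_indicator)
    also have "\<dots> \<le> ennreal (exp (real n * x\<^sup>2 / 2) * (2 * c * ?\<sigma> / t) * exp (1/2) / h 1)
        * (\<integral>\<^sup>+ u. ennreal (coord_lik n x u) \<partial>coord_prior h ?\<sigma>)"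
      using t n\<sigma> by (intro coord_posterior_shrinks) auto
    also have "\<dots> \<le> ennreal (1 / n * (1/4) ^ l) * (\<integral>\<^sup>+ u. ennreal (coord_lik n x u) \<partial>coord_prior h ?\<sigma>)"
    proof (intro mult_right_mono ennreal_leI)
      have "exp (real n * x\<^sup>2 / 2) * (2 * c * ?\<sigma> / t) * exp (1/2) / h 1
          \<le> exp (2 * (lam n l)\<^sup>2) * (2 * c * ?\<sigma> / t) * exp (1/2) / h 1"
        using ex t c_ge by (intro divide_right_mono mult_right_mono) auto
      then show "exp (real n * x\<^sup>2 / 2) * (2 * c * ?\<sigma> / t) * exp (1/2) / h 1 \<le> 1 / n * (1/4) ^ l"
        using e by linarith
    qed simp
    finally show ?thesis unfolding pc .
  qed
qed

lemma posterior_bound: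
  assumes good: "good n"
    and X: "\<And>l k. k < nlev (int l - 1) \<Longrightarrow> \<bar>X (int l - 1, k) - f0 (int l - 1, k)\<bar> \<le> lam n l * \<nu> n"
    and B: "\<And>f. f \<in> B \<Longrightarrow> \<exists>l k. k < nlev (int l - 1) \<and> rad n l k < \<bar>f (int l - 1, k) - f0 (int l - 1, k)\<bar>"
  shows "posterior h n B X \<le> ennreal (2 / n)"
proof -
  have n: "1 \<le> n" using good by (simp add: good_def)
  define r where "r i = rad n (nat (fst i + 1)) (snd i)" for i
  have r: "r (int l - 1, k) = rad n l k" for l k by (simp add: r_def)
  \<comment> \<open>This growth bound serves the almost sure convergence of the series in
    \<open>lik\<close>.\<close>
  have X_le: "\<bar>X (int l - 1, k)\<bar> \<le> (f0_max + 8 * (ln n + 2)) * 2 ^ l" if k: "k < nlev (int l - 1)" for l k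
  proof -
    have ln0: "0 \<le> ln (real n)" using n by simp
    have "lam n l \<le> (lam n l)\<^sup>2"
      using mult_left_mono[OF lam_ge_1[OF n, of l], of "lam n l"] n by (simp add: power2_eq_square)
    then have "lam n l \<le> 8 * (ln n + real l + 1)" using n by (simp add: lam_sq)
    moreover have "lam n l * \<nu> n \<le> lam n l * 1"
      using n by (intro mult_left_mono) (auto simp: \<nu>_def)
    ultimately have "\<bar>X (int l - 1, k)\<bar> \<le> f0_max + 8 * (ln n + real l + 1)"
      using X[OF k] abs_f0_le_max[OF k] by linarith
    also have "\<dots> \<le> (f0_max + 8 * (ln n + 2)) * 2 ^ l"
    proof -
      have "real l + 1 \<le> 2 ^ l" by (induction l) auto
      moreover have "(f0_max + 8 * ln n) * 1 \<le> (f0_max + 8 * ln n) * 2 ^ l"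
        using f0_max_pos ln0 by (intro mult_left_mono) auto
      ultimately show ?thesis by (simp add: algebra_simps)
    qed
    finally show ?thesis .
  qed
  have coord: "(\<integral>\<^sup>+ u. indicator {u. r (int l - 1, k) < \<bar>u - f0 (int l - 1, k)\<bar>} u
          * ennreal (coord_lik n (X (int l - 1, k)) u) \<partial>pc (int l - 1, k))
      \<le> ennreal (1 / n * (1/4) ^ l) * (\<integral>\<^sup>+ u. ennreal (coord_lik n (X (int l - 1, k)) u) \<partial>pc (int l - 1, k))"
    if k: "k < nlev (int l - 1)" for l k
    unfolding r by (rule coord_posterior_bound[OF good k X[OF k]])
  have escape: "\<exists>i\<in>wav_idx. r i < \<bar>f i - f0 i\<bar>" if fB: "f \<in> B" for f
  proof -
    obtain l k where "k < nlev (int l - 1)" "rad n l k < \<bar>f (int l - 1, k) - f0 (int l - 1, k)\<bar>"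
      using B[OF fB] by blast
    then show "\<exists>i\<in>wav_idx. r i < \<bar>f i - f0 i\<bar>"
      by (intro bexI[of _ "(int l - 1, k)"]) (auto simp: wav_idx_iff r)
  qed
  have "posterior h n B X \<le> ennreal (2 * (1 / n))"
    by (rule posterior_le[where r = r and ?f0.0 = f0, OF X_le escape coord]) auto
  then show ?thesis by simp
qed

section \<open>The event of large noise and the expected posterior mass\<close>

definition noisy :: "nat \<Rightarrow> int \<times> nat \<Rightarrow> (int \<times> nat \<Rightarrow> real) set" where
  "noisy n i = {X \<in> space (data_law f0 n). lam n (nat (fst i + 1)) * \<nu> n < \<bar>X i - f0 i\<bar>}"

lemma prob_space_data_law: "1 \<le> n \<Longrightarrow> prob_space (data_law f0 n)"
  unfolding data_law_def by (intro prob_space_PiM prob_space_normal_density) simp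

lemma data_component_measurable:
  "i \<in> wav_idx \<Longrightarrow> (\<lambda>X. X i) \<in> borel_measurable (data_law f0 n)"
  unfolding data_law_def
  using measurable_component_singleton[of i wav_idx "\<lambda>i. density lborel (normal_density (f0 i) (1 / sqrt (real n)))"]
  by (simp cong: measurable_cong_sets)

lemma noisy_sets:
  assumes "i \<in> wav_idx"
  shows "noisy n i \<in> sets (data_law f0 n)"
proof -
  note [measurable] = data_component_measurable[OF assms]
  show ?thesis unfolding noisy_def by measurable
qed

lemma emeasure_noisy_le:
  assumes n: "1 \<le> n"
  shows "emeasure (data_law f0 n) (\<Union>i\<in>wav_idx. noisy n i) \<le> ennreal (4 / n)"
proof -
  let ?N = "\<lambda>i. density lborel (normal_density (f0 i) (1 / sqrt (real n)))"
  have "emeasure (data_law f0 n) (\<Union>i\<in>wav_idx. noisy n i) \<le> ennreal (2 * (2 / n)) * 1"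
  proof (rule emeasure_UN_wav_idx_le)
    fix l k assume k: "k < nlev (int l - 1)"
    let ?i = "(int l - 1, k)"
    have i: "?i \<in> wav_idx" using k by (simp add: wav_idx_iff)
    have N: "prob_space (?N i)" for i using n by (intro prob_space_normal_density) simp
    let ?A = "{x. lam n l * (1 / sqrt n) < \<bar>x - f0 ?i\<bar>}"
    have "emeasure (data_law f0 n) (noisy n ?i) = emeasure (distr (PiM wav_idx ?N) (?N ?i) (\<lambda>X. X ?i)) ?A"
      unfolding data_law_def noisy_def using i data_component_measurable[OF i, unfolded data_law_def]
      by (subst emeasure_distr) (auto intro!: arg_cong2[where f = emeasure] simp: measurable_component_singleton \<nu>_def)
    also have "\<dots> = emeasure (?N ?i) ?A"
      using i N by (subst distr_PiM_component) auto
    also have "\<dots> \<le> ennreal (2 * exp (- (lam n l)\<^sup>2 / 4))"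
      using n by (intro normal_tail) auto
    also have "\<dots> \<le> ennreal (2 / n * (1/4) ^ l)"
    proof (rule ennreal_leI)
      have n4: "4 ^ l \<le> exp (2 * real l)" by (rule power_le_exp_of_nat) (auto simp: four_le_exp_2)
      have rn: "real n = exp (ln n)" using n by simp
      have ln0: "0 \<le> ln (real n)" using n by simp
      have "exp (- (lam n l)\<^sup>2 / 4) * (real n * 4 ^ l) \<le> exp (- (lam n l)\<^sup>2 / 4) * (exp (ln n) * exp (2 * real l))"
        using n4 rn by (intro mult_mono) auto
      also have "\<dots> = exp (- (lam n l)\<^sup>2 / 4 + (ln n + 2 * real l))"
        by (simp only: exp_add)
      also have "- (lam n l)\<^sup>2 / 4 + (ln n + 2 * real l) = - ln n - 2"
        using n by (simp add: lam_sq add_divide_distrib diff_divide_distrib)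
      also have "exp (- ln n - 2) \<le> 1" using ln0 by simp
      finally have "exp (- (lam n l)\<^sup>2 / 4) \<le> 1 / (real n * 4 ^ l)"
        using n by (subst pos_le_divide_eq) auto
      then show "2 * exp (- (lam n l)\<^sup>2 / 4) \<le> 2 / n * (1/4) ^ l"
        by (simp add: power_divide)
    qed
    finally show "emeasure (data_law f0 n) (noisy n (int l - 1, k)) \<le> ennreal (2 / n * (1/4) ^ l) * 1" by simp
  qed (auto intro: noisy_sets)
  then show ?thesis by simp
qed

text \<open>The data are noisy with probability at most 4/n, where the posterior is bounded by 1;
  otherwise it is at most 2/n. The pointwise majorant is measurable, so no measurability of the
  posterior in the data is invoked.\<close>

lemma expected_posterior_le:
  assumes good: "good n"
    and B: "\<And>f. f \<in> B \<Longrightarrow> \<exists>l k. k < nlev (int l - 1) \<and> rad n l k < \<bar>f (int l - 1, k) - f0 (int l - 1, k)\<bar>"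
  shows "(\<integral>\<^sup>+ X. posterior h n B X \<partial>data_law f0 n) \<le> ennreal (6 / n)"
proof -
  have n: "1 \<le> n" using good by (simp add: good_def)
  let ?A = "\<Union>i\<in>wav_idx. noisy n i"
  have A: "?A \<in> sets (data_law f0 n)"
    by (intro sets.countable_UN' countable_wav_idx) (auto intro: noisy_sets)
  have "(\<integral>\<^sup>+ X. posterior h n B X \<partial>data_law f0 n) \<le> (\<integral>\<^sup>+ X. indicator ?A X + ennreal (2 / n) \<partial>data_law f0 n)"
  proof (intro nn_integral_mono)
    fix X assume X: "X \<in> space (data_law f0 n)"
    show "posterior h n B X \<le> indicator ?A X + ennreal (2 / n)"
    proof (cases "X \<in> ?A")
      case True
      then show ?thesis using posterior_le_1[of h n B X] by (simp add: add_increasing2)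
    next
      case False
      have "\<bar>X (int l - 1, k) - f0 (int l - 1, k)\<bar> \<le> lam n l * \<nu> n" if "k < nlev (int l - 1)" for l k
      proof (rule ccontr)
        assume "\<not> ?thesis"
        then have "X \<in> noisy n (int l - 1, k)" using X by (simp add: noisy_def)
        then show False using False that wav_idx_iff by blast
      qed
      then show ?thesis using posterior_bound[OF good _ B] False by simp
    qed
  qed
  also have "\<dots> = emeasure (data_law f0 n) ?A + ennreal (2 / n)"
    using A prob_space.emeasure_space_1[OF prob_space_data_law[OF n]] by (subst nn_integral_add) auto
  also have "\<dots> \<le> ennreal (4 / n) + ennreal (2 / n)"
    by (intro add_right_mono emeasure_noisy_le n)
  also have "\<dots> = ennreal (6 / n)"
    by (simp add: ennreal_plus[symmetric] add_divide_distrib[symmetric] del: ennreal_plus)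
  finally show ?thesis .
qed

section \<open>The L_p' size of the box of tolerances\<close>

definition tail_const :: real where
  "tail_const = 4 * F * 2 powr (tail_exp / 2) / (1 - 2 powr (- (tail_exp / 2))) + 16"

definition radius :: "nat \<Rightarrow> real" where
  "radius n = (real (l1 n) + 1) * (2 * 2 powr (real (l1 n) / 2) * (R n * \<nu> n))
     + (real (l2 n) + 1) * (4 * (R n * (max 1 F * \<nu> n powr (2 * rate s p p'))))
     + (\<nu> n)\<^sup>2 * tail_const"

lemma Lp_norm_in_box_le:
  assumes wb: "wavelet_bounds e K M" and good: "good n"
    and f: "\<And>l k. k < nlev (int l - 1) \<Longrightarrow> \<bar>f (int l - 1, k) - f0 (int l - 1, k)\<bar> \<le> rad n l k"
  shows "Lp_norm p' (wav_fun e (\<lambda>i. f i - f0 i)) \<le> ennreal (2 * K * M\<^sup>2 * radius n)"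
proof -
  have n: "1 \<le> n" and R1: "1 \<le> R n" using good by (simp_all add: good_def)
  define \<rho> where "\<rho> = 2 powr (- (tail_exp / 2))"
  have "2 powr (- (tail_exp / 2)) < 2 powr 0" using tail_exp_pos by (intro powr_less_mono) auto
  then have \<rho>: "0 < \<rho>" "\<rho> < 1" by (simp_all add: \<rho>_def)
  have \<rho>_pow: "\<rho> ^ l = 2 powr (- (tail_exp / 2) * real l)" for l
    by (simp add: \<rho>_def powr_realpow[symmetric] powr_powr)
  define A1 where "A1 = 2 * 2 powr (real (l1 n) / 2) * (R n * \<nu> n)"
  define A2 where "A2 = 4 * (R n * (max 1 F * \<nu> n powr (2 * rate s p p')))"
  \<comment> \<open>The last, geometric term is present at every level: it keeps \<open>b\<close>
    positive, pays for the amounts (1/8)^l in \<open>rad\<close>, and beyond \<open>l2 n\<close>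
    majorises the tail of \<open>f0\<close>.\<close>
  define b where "b l = (if l \<le> l1 n then A1 else 0) + (if l \<le> l2 n then A2 else 0)
      + (\<nu> n)\<^sup>2 * (4 * F * 2 powr (tail_exp / 2) * \<rho> ^ l + 8 * (1/2) ^ l)" for l
  have A: "0 \<le> A1" "0 \<le> A2" by (simp_all add: A1_def A2_def)
  have "b sums ((\<Sum>l | l \<le> l1 n. A1) + (\<Sum>l | l \<le> l2 n. A2)
      + (\<nu> n)\<^sup>2 * (4 * F * 2 powr (tail_exp / 2) * (1 / (1 - \<rho>)) + 8 * (1 / (1 - 1/2))))"
    unfolding b_def using \<rho>
    by (intro sums_add sums_mult sums_If_finite geometric_sums) auto
  then have sums: "b sums radius n"
    by (simp add: radius_def tail_const_def A1_def A2_def \<rho>_def add.commute[of 1])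
  have b_ge: "(\<nu> n)\<^sup>2 * (8 * (1/2) ^ l) \<le> b l" "l \<le> l1 n \<Longrightarrow> A1 \<le> b l"
    "l \<le> l2 n \<Longrightarrow> A2 + (\<nu> n)\<^sup>2 * (8 * (1/2) ^ l) \<le> b l"
    "(\<nu> n)\<^sup>2 * (4 * F * 2 powr (tail_exp / 2) * \<rho> ^ l) + (\<nu> n)\<^sup>2 * (8 * (1/2) ^ l) \<le> b l" for l
    using A F \<rho> by (auto simp: b_def distrib_left intro!: add_nonneg_nonneg mult_nonneg_nonneg)
  show ?thesis
  proof (rule Lp_norm_wav_fun_le[OF wb p', where b = b])
    show "summable b" "suminf b \<le> radius n" using sums by (auto simp: sums_iff)
    have "0 < (\<nu> n)\<^sup>2 * (8 * (1/2) ^ l)" for l using \<nu>_pos[OF n] by simp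
    then show "0 < b l" for l using b_ge(1)[of l] by (rule less_le_trans)
    fix l
    let ?c = "\<lambda>i. f i - f0 i"
    define t where "t = (\<nu> n)\<^sup>2 * (1/8) ^ l"
    have t0: "0 \<le> t" by (simp add: t_def)
    have tb: "4 * lvl_bound p' (\<lambda>_. t) l \<le> (\<nu> n)\<^sup>2 * (8 * (1/2) ^ l)"
    proof -
      have "lvl_bound p' (\<lambda>_. t) l \<le> 2 * 2 powr (real l / 2) * t"
        using p' t0 by (rule lvl_bound_const)
      also have "\<dots> \<le> 2 * 2 powr (real l) * t"
        using t0 by (intro mult_right_mono mult_left_mono powr_mono) auto
      also have "\<dots> = 2 * (\<nu> n)\<^sup>2 * (2 ^ l * (1/8) ^ l)"
        by (simp add: t_def powr_realpow)
      also have "2 ^ l * (1/8) ^ l = (1/4::real) ^ l" by (simp add: power_mult_distrib[symmetric])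
      also have "2 * (\<nu> n)\<^sup>2 * (1/4) ^ l \<le> 2 * (\<nu> n)\<^sup>2 * (1/2) ^ l"
        by (intro mult_left_mono power_mono) auto
      finally show ?thesis by simp
    qed
    consider "l \<le> l1 n" | "l1 n < l" "l \<le> l2 n" | "l1 n < l" "l2 n < l" by linarith
    then show "lvl_bound p' ?c l \<le> b l"
    proof cases
      case 1
      have "lvl_bound p' ?c l \<le> lvl_bound p' (\<lambda>_. R n * \<nu> n) l"
      proof (rule lvl_bound_mono[OF p'])
        fix k assume "k < nlev (int l - 1)"
        with f[of k l] 1 show "\<bar>f (int l - 1, k) - f0 (int l - 1, k)\<bar> \<le> \<bar>R n * \<nu> n\<bar>"
          by (simp add: rad_def)
      qed
      also have "\<dots> \<le> 2 * 2 powr (real l / 2) * (R n * \<nu> n)"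
        using p' by (intro lvl_bound_const) auto
      also have "\<dots> \<le> A1"
        unfolding A1_def using 1 by (intro mult_right_mono mult_left_mono powr_mono) auto
      finally show ?thesis using b_ge(2)[OF 1] by simp
    next
      case 2
      have lamR: "lam n l \<le> R n" using good 2 by (simp add: good_def)
      have "lvl_bound p' ?c l \<le> 4 * (lvl_bound p' (\<lambda>i. R n * min \<bar>f0 i\<bar> (\<nu> n)) l + lvl_bound p' (\<lambda>_. t) l)"
      proof (rule lvl_bound_add[OF p'])
        fix k assume k: "k < nlev (int l - 1)"
        let ?f = "\<bar>f0 (int l - 1, k)\<bar>"
        have "rad n l k \<le> R n * min ?f (\<nu> n) + t"
        proof (cases "lam n l * \<nu> n < ?f")
          case True
          have "1 * \<nu> n \<le> lam n l * \<nu> n" using lam_ge_1[OF n] by (intro mult_right_mono) auto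
          then have "min ?f (\<nu> n) = \<nu> n" using True by simp
          then show ?thesis using True t0 by (simp add: rad_def)
        next
          \<comment> \<open>If \<bar>f0\<bar> exceeds \<open>\<nu> n\<close> without passing the
            threshold, it is at most \<open>lam n l * \<nu> n \<le> R n * \<nu> n\<close>; so in
            both cases the error is \<open>R n\<close> times the truncated coefficient, up to
            \<open>t\<close>.\<close>
          case False
          have "lam n l * \<nu> n \<le> R n * \<nu> n" using lamR by (intro mult_right_mono) auto
          moreover have "1 * ?f \<le> R n * ?f" using R1 by (intro mult_right_mono) auto
          ultimately have "?f \<le> R n * min ?f (\<nu> n)" using False by (simp add: min_def)
          then show ?thesis using False 2 by (simp add: rad_def t_def)
        qed
        then show "\<bar>f (int l - 1, k) - f0 (int l - 1, k)\<bar> \<le> \<bar>R n * min ?f (\<nu> n)\<bar> + \<bar>t\<bar>"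
          using f[OF k] by (smt (verit))
      qed
      also have "\<dots> \<le> 4 * (R n * (max 1 F * \<nu> n powr (2 * rate s p p'))) + (\<nu> n)\<^sup>2 * (8 * (1/2) ^ l)"
      proof -
        have "lvl_bound p' (\<lambda>i. min \<bar>f0 i\<bar> (\<nu> n)) l \<le> max 1 F * \<nu> n powr (2 * rate s p p')"
          using 2 \<nu>_pos[OF n] by (intro lvl_bound_truncated) auto
        then have "R n * lvl_bound p' (\<lambda>i. min \<bar>f0 i\<bar> (\<nu> n)) l \<le> R n * (max 1 F * \<nu> n powr (2 * rate s p p'))"
          by (intro mult_left_mono) auto
        then show ?thesis using tb p' by (simp add: lvl_bound_scale distrib_left)
      qed
      finally show ?thesis using b_ge(3)[OF 2(2)] by (simp add: A2_def)
    next
      case 3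
      have "lvl_bound p' ?c l \<le> 4 * (lvl_bound p' f0 l + lvl_bound p' (\<lambda>_. t) l)"
      proof (rule lvl_bound_add[OF p'])
        fix k assume k: "k < nlev (int l - 1)"
        have "\<bar>f0 (int l - 1, k)\<bar> \<le> lam n l * \<nu> n" using good 3 k unfolding good_def by blast
        then have "rad n l k = \<bar>f0 (int l - 1, k)\<bar> + t" using 3 by (simp add: rad_def t_def)
        then show "\<bar>f (int l - 1, k) - f0 (int l - 1, k)\<bar> \<le> \<bar>f0 (int l - 1, k)\<bar> + \<bar>t\<bar>"
          using f[OF k] t0 by simp
      qed
      also have "\<dots> \<le> 4 * (F * 2 powr (- ((real l - 1) * tail_exp))) + (\<nu> n)\<^sup>2 * (8 * (1/2) ^ l)"
        using lvl_bound_tail[of l] 3 tb by (simp add: distrib_left tail_exp_def)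
      also have "4 * (F * 2 powr (- ((real l - 1) * tail_exp))) \<le> 4 * (F * (1 / n * 2 powr (- ((real l - 1) * (tail_exp / 2)))))"
        using F n 3 c3_ge by (intro mult_left_mono high_level_decay) auto
      also have "\<dots> = (\<nu> n)\<^sup>2 * (4 * F * 2 powr (tail_exp / 2) * \<rho> ^ l)"
      proof -
        have "- ((real l - 1) * (tail_exp / 2)) = tail_exp / 2 + - (tail_exp / 2) * real l"
          by (simp add: algebra_simps diff_divide_distrib add_divide_distrib)
        then have "2 powr (- ((real l - 1) * (tail_exp / 2))) = 2 powr (tail_exp / 2) * \<rho> ^ l"
          unfolding \<rho>_pow by (simp only: powr_add)
        then show ?thesis using n by (simp add: \<nu>_sq)
      qed
      finally show ?thesis using b_ge(4)[of l] by simp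
    qed
  qed
qed

text \<open>The low levels give n^(-1/2 + o(1)), beaten because the rate is below 1/2. The middle
  levels give (ln n)^(2(1+\<kappa>)+1) n^(-rate), beaten by the one remaining power of the
  logarithm. The tail is O(1/n).\<close>

lemma eventually_radius_small:
  assumes C: "0 < C"
  shows "eventually (\<lambda>n. C * radius n < ln (real n) powr (2 * (1 + \<kappa>) + 2) * real n powr (- rate s p p')) sequentially"
proof -
  define r where "r = rate s p p'"
  define D where "D = max 1 F"
  define G where "G = \<bar>tail_const\<bar> + 1"
  have D: "0 < D" and G: "0 < G" "tail_const \<le> G" by (auto simp: D_def G_def)
  have r: "0 < r" "r < 1/2" using rate_pos rate_less_half by (auto simp: r_def)
  define U where "U x = (10 * sqrt x + 2) * (2 * 2 powr ((10 * sqrt x + 1) / 2) * (x powr (2 * (1 + \<kappa>)) * exp (- x / 2)))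
      + (c3 * x + 2) * (4 * (x powr (2 * (1 + \<kappa>)) * (D * exp (- r * x)))) + exp (- x) * G" for x :: real
  have "eventually (\<lambda>x::real. C * U x < x powr (2 * (1 + \<kappa>) + 2) * exp (- r * x)) at_top"
    unfolding U_def using C D G r \<kappa> c3_pos by real_asymp
  from eventually_ln[OF this] show ?thesis
    using eventually_ge_at_top[of 1]
  proof eventually_elim
    case (elim n)
    then have n: "1 \<le> n" by simp
    have ln0: "0 \<le> ln (real n)" using n by simp
    have npow: "real n powr a = exp (a * ln n)" for a
      using n by (simp add: powr_def)
    have \<nu>pow: "\<nu> n powr (2 * r) = exp (- r * ln n)"
      using n by (simp add: \<nu>_eq powr_def)
    have \<nu>2: "(\<nu> n)\<^sup>2 = exp (- ln n)"
      using n by (simp add: \<nu>_sq exp_minus inverse_eq_divide)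
    have "radius n \<le> U (ln n)"
      unfolding radius_def U_def r_def[symmetric] D_def[symmetric] \<nu>pow \<nu>2
    proof (intro add_mono)
      have l: "real (l1 n) + 1 \<le> 10 * sqrt (ln n) + 2" using l1_bounds(2)[OF n] by linarith
      show "(real (l1 n) + 1) * (2 * 2 powr (real (l1 n) / 2) * (R n * \<nu> n))
          \<le> (10 * sqrt (ln n) + 2) * (2 * 2 powr ((10 * sqrt (ln n) + 1) / 2) * (ln n powr (2 * (1 + \<kappa>)) * exp (- ln n / 2)))"
        unfolding R_def \<nu>_eq[OF n]
        using l ln0 l1_bounds(2)[OF n] by (intro mult_mono powr_mono order_refl) auto
      show "(real (l2 n) + 1) * (4 * (R n * (D * exp (- r * ln n))))
          \<le> (c3 * ln n + 2) * (4 * (ln n powr (2 * (1 + \<kappa>)) * (D * exp (- r * ln n))))"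
        unfolding R_def using l2_bounds(2)[OF n] D by (intro mult_right_mono) auto
      show "exp (- ln n) * tail_const \<le> exp (- ln n) * G"
        using G by (intro mult_left_mono) auto
    qed
    then have "C * radius n \<le> C * U (ln n)" using C by (intro mult_left_mono) auto
    also have "\<dots> < ln n powr (2 * (1 + \<kappa>) + 2) * exp (- r * ln n)" using elim by simp
    also have "exp (- r * ln n) = real n powr (- rate s p p')" by (simp add: npow r_def)
    finally show ?case .
  qed
qed

lemma expected_posterior_tendsto:
  assumes wb: "wavelet_bounds e K M"
  shows "((\<lambda>n::nat. \<integral>\<^sup>+ X. posterior h n
        {f. Lp_norm p' (wav_fun e (\<lambda>i. f i - f0 i))
              \<ge> ennreal (ln (real n) powr (2 * (1 + \<kappa>) + 2) * real n powr (- rate s p p'))} X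
      \<partial>data_law f0 n) \<longlongrightarrow> 0) sequentially"
proof (rule tendsto_sandwich[OF _ _ tendsto_const])
  show "(\<lambda>n. ennreal (6 / real n)) \<longlonglongrightarrow> 0"
  proof -
    have "(\<lambda>n. 6 / real n) \<longlonglongrightarrow> 0" by real_asymp
    then show ?thesis using tendsto_ennrealI by fastforce
  qed
  have "0 < 2 * K * M\<^sup>2" using wb by (simp add: wavelet_bounds_def)
  from eventually_radius_small[OF this] eventually_good
  show "eventually (\<lambda>n. (\<integral>\<^sup>+ X. posterior h n
        {f. Lp_norm p' (wav_fun e (\<lambda>i. f i - f0 i))
              \<ge> ennreal (ln (real n) powr (2 * (1 + \<kappa>) + 2) * real n powr (- rate s p p'))} X
      \<partial>data_law f0 n) \<le> ennreal (6 / real n)) sequentially"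
  proof eventually_elim
    case (elim n)
    show ?case
    proof (rule expected_posterior_le[OF elim(2)])
      fix f assume f: "f \<in> {f. Lp_norm p' (wav_fun e (\<lambda>i. f i - f0 i))
              \<ge> ennreal (ln (real n) powr (2 * (1 + \<kappa>) + 2) * real n powr (- rate s p p'))}"
      show "\<exists>l k. k < nlev (int l - 1) \<and> rad n l k < \<bar>f (int l - 1, k) - f0 (int l - 1, k)\<bar>"
      proof (rule ccontr)
        assume "\<not> ?thesis"
        then have "Lp_norm p' (wav_fun e (\<lambda>i. f i - f0 i)) \<le> ennreal (2 * K * M\<^sup>2 * radius n)"
          by (intro Lp_norm_in_box_le[OF wb elim(2)]) (meson not_le)
        also have "\<dots> < ennreal (ln (real n) powr (2 * (1 + \<kappa>) + 2) * real n powr (- rate s p p'))"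
        proof (rule ennreal_lessI)
          have n: "1 \<le> n" "1 \<le> R n" using elim(2) by (simp_all add: good_def)
          \<comment> \<open>At n = 1 the threshold is 0 and strictness would fail;
            \<open>R n \<ge> 1\<close> excludes this since \<open>0 powr a = 0\<close>.\<close>
          then have "ln (real n) \<noteq> 0" using \<kappa> by (auto simp: R_def)
          then show "0 < ln (real n) powr (2 * (1 + \<kappa>) + 2) * real n powr (- rate s p p')"
            using n by simp
        qed (use elim(1) in simp)
        finally show False using f by simp
      qed
    qed
  qed
qed auto

end

theorem theorem3:
  fixes S :: nat and s F p' :: real and p q :: ereal
    and phi :: "nat \<Rightarrow> real \<Rightarrow> real" and psi :: "nat \<Rightarrow> nat \<Rightarrow> real \<Rightarrow> real"
    and h :: "real \<Rightarrow> real" and f0 :: "int \<times> nat \<Rightarrow> real"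
  assumes basis: "cdv_wavelet_basis S phi psi"
    and sS: "0 < s" "s < real S"
    and pq: "1 \<le> p" "1 \<le> q"
    and p': "1 \<le> p'"
    and F: "F > 0"
    and s_large: "s > max 0 (inv_e p - 1 / max p' 2)"
    and f0: "besov_norm s p q f0 \<le> ereal F"
    and h_meas: "h \<in> borel_measurable borel"
    and h_dens: "integrable lborel h" "(\<integral>x. h x \<partial>lborel) = 1"
    and H1: "\<forall>x. h x > 0" "\<forall>x. h (- x) = h x" "\<forall>x y. 0 \<le> x \<longrightarrow> x \<le> y \<longrightarrow> h y \<le> h x"
    and H2: "\<exists>c1 > 0. \<exists>\<kappa> \<ge> 0. \<forall>x \<ge> 0. ln (1 / h x) \<le> c1 * (1 + ln (1 + x) powr (1 + \<kappa>))"
    and H3: "\<exists>c2 > 0. \<forall>x \<ge> 1. (LINT u:{x..}|lborel. h u) \<le> c2 / x"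
  shows "\<exists>\<delta> > 0.
    ((\<lambda>n::nat. \<integral>\<^sup>+ X. posterior h n
        {f. Lp_norm p' (wav_fun (basis_fn (wavJ S) phi psi) (\<lambda>i. f i - f0 i))
              \<ge> ennreal (ln (real n) powr \<delta> * real n powr (- rate s p p'))} X
      \<partial>data_law f0 n) \<longlongrightarrow> 0) sequentially"
proof -
  obtain K M where wb: "wavelet_bounds (basis_fn (wavJ S) phi psi) K M"
    using basis by (rule cdv_wavelet_bounds)
  obtain c1 \<kappa> where c1: "0 < c1" "0 \<le> \<kappa>" and lower: "\<And>x. 0 \<le> x \<Longrightarrow> ln (1 / h x) \<le> c1 * (1 + ln (1 + x) powr (1 + \<kappa>))"
    using H2 by blast
  obtain c2 where tail: "\<And>x. 1 \<le> x \<Longrightarrow> (LINT u:{x..}|lborel. h u) \<le> c2 / x"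
    using H3 by blast
  interpret posterior_setting h "max 1 c2" s F p' p q f0 c1 \<kappa>
  proof
    fix x :: real assume x: "1 \<le> x"
    show "(LINT u:{x..}|lborel. h u) \<le> max 1 c2 / x"
      using x by (intro order_trans[OF tail[OF x]] divide_right_mono) auto
  qed (use assms c1 lower in auto)
  have "0 < 2 * (1 + \<kappa>) + 2" using \<kappa> by simp
  with expected_posterior_tendsto[OF wb] show ?thesis by blast
qed

end
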